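(* Let $0<p<\infty$, $k\ge2$, $0\le r\le k-2$, $0<s/2<r+1/p$, and $1/\tau=s/2+1/p$. Then there is a constant $c>0$, depending only on $s,p,k,r$ and $N_0,c_0,\beta$, such that for every $n\ge n_0$ and every $S\in\mathcal{S}(n,k,r)$, $$|S|_{B^{s,k}_\tau}\le c\,n^{s/2}\|S\|_{L^p(\Omega)}.$$
   Context: Fix constants $N_0\in\mathbb{N}$, $c_0\ge 1$ and $0<\beta\le\pi/3$. A compact convex set $Q\subset\mathbb{R}^2$ is regular if there are balls $B(x_2,r_2)\subset Q\subset B(x_1,r_1)$ with $r_1\le c_0r_2$. A set $R\subset\mathbb{R}^2$ is a ring if $R=Q_1\setminus Q_2$ where: (a) $Q_2\subset Q_1$ or $Q_2=\emptyset$; (b) each of $Q_1,Q_2$ (when nonempty) is a compact regular convex set whose boundary is a polygon consisting of at most $N_0$ line segments; (c) each edge $E$ of $\partial R$ can be written as $E=E_1\cup E_2$, a union of at most two segments with disjoint one-dimensional interiors, such that for each $i$ there is a triangle $\triangle_i\subset R$ having $E_i$ as a side with both angles adjacent to $E_i$ equal to $\beta$. The domain $\Omega$ is either $\mathbb{R}^2$ or a compact polygonal domain, i.e. a union of finitely many triangles with disjoint interiors obeying the minimum angle condition; in the compact case it is assumed that $\Omega$ is the union of $n_0$ rings with disjoint interiors for some fixed $n_0\ge1$, and if $\Omega=\mathbb{R}^2$ then $n_0:=1$. $\Pi_k$ is the space of algebraic polynomials in two variables of total degree $\le k-1$. $\mathcal{S}(n,k,r)$ is the set of all $S=\sum_{j=1}^nP_j\mathbb{1}_{R_j}$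 with $P_j\in\Pi_k$, where $R_1,\dots,R_n$ are rings with disjoint interiors such that $\Omega=\bigcup_jR_j$, and $S\in W^r(\Omega)$, meaning all partial derivatives $\partial^\alpha S$ with $|\alpha|\le r$ are continuous on $\Omega$. Besov spaces: for $h\in\mathbb{R}^2$, $\Delta_h^kf(x)=\sum_{\nu=0}^k(-1)^{k+\nu}\binom{k}{\nu}f(x+\nu h)$ if the segment $[x,x+kh]\subset\Omega$ and $\Delta_h^kf(x)=0$ otherwise; $\omega_k(f,t)_\tau=\sup_{|h|\le t}\|\Delta_h^kf\|_{L^\tau(\Omega)}$; $|f|_{B^{s,k}_\tau}=\big(\int_0^\infty[t^{-s}\omega_k(f,t)_\tau]^\tau\,dt/t\big)^{1/\tau}$. *)

theory Defs
  imports "HOL-Analysis.Analysis"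
begin

type_synonym pt = "real ^ 2"

definition vangle :: "pt \<Rightarrow> pt \<Rightarrow> real" where
  "vangle u v = arccos ((u \<bullet> v) / (norm u * norm v))"

definition regular_set :: "real \<Rightarrow> pt set \<Rightarrow> bool" where
  "regular_set c0 Q \<longleftrightarrow> (\<exists>x1 r1 x2 r2. r2 > 0 \<and> ball x2 r2 \<subseteq> Q \<and> Q \<subseteq> ball x1 r1 \<and> r1 \<le> c0 * r2)"

definition convex_polygon :: "nat \<Rightarrow> real \<Rightarrow> pt set \<Rightarrow> bool" where
  "convex_polygon N0 c0 Q \<longleftrightarrow> compact Q \<and> convex Q \<and> regular_set c0 Q \<and>
     (\<exists>segs :: (pt \<times> pt) set. finite segs \<and> card segs \<le> N0 \<and>
        frontier Q = (\<Union>(a, b)\<in>segs. closed_segment a b))"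

definition is_edge :: "pt set \<Rightarrow> pt \<Rightarrow> pt \<Rightarrow> bool" where
  "is_edge R a b \<longleftrightarrow> a \<noteq> b \<and> closed_segment a b \<subseteq> frontier R \<and>
     (\<forall>c d. closed_segment a b \<subseteq> closed_segment c d \<and> closed_segment c d \<subseteq> frontier R
            \<longrightarrow> closed_segment c d = closed_segment a b)"

definition has_beta_triangle :: "real \<Rightarrow> pt set \<Rightarrow> pt \<Rightarrow> pt \<Rightarrow> bool" where
  "has_beta_triangle \<beta> R u v \<longleftrightarrow> (\<exists>w. convex hull {u, v, w} \<subseteq> R \<and>
      vangle (v - u) (w - u) = \<beta> \<and> vangle (u - v) (w - v) = \<beta>)"

definition is_ring :: "nat \<Rightarrow> real \<Rightarrow> real \<Rightarrow> pt set \<Rightarrow> bool" where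
  "is_ring N0 c0 \<beta> R \<longleftrightarrow> (\<exists>Q1 Q2. (Q2 \<subseteq> Q1 \<or> Q2 = {}) \<and> convex_polygon N0 c0 Q1 \<and>
      (Q2 \<noteq> {} \<longrightarrow> convex_polygon N0 c0 Q2) \<and> R = closure (Q1 - Q2) \<and>
      (\<forall>a b. is_edge R a b \<longrightarrow>
         (\<exists>m\<in>closed_segment a b. (a \<noteq> m \<longrightarrow> has_beta_triangle \<beta> R a m) \<and>
                                  (m \<noteq> b \<longrightarrow> has_beta_triangle \<beta> R m b))))"

definition polygonal_domain :: "pt set \<Rightarrow> bool" where
  "polygonal_domain \<Omega> \<longleftrightarrow> (\<exists>m (A :: nat \<Rightarrow> pt) B C.
      (\<forall>i<m. \<not> collinear {A i, B i, C i}) \<and>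
      (\<forall>i<m. \<forall>j<m. i \<noteq> j \<longrightarrow> interior (convex hull {A i, B i, C i}) \<inter> interior (convex hull {A j, B j, C j}) = {}) \<and>
      \<Omega> = (\<Union>i<m. convex hull {A i, B i, C i}))"

definition admissible_domain :: "nat \<Rightarrow> real \<Rightarrow> real \<Rightarrow> pt set \<Rightarrow> nat \<Rightarrow> bool" where
  "admissible_domain N0 c0 \<beta> \<Omega> n0 \<longleftrightarrow>
     (\<Omega> = UNIV \<and> n0 = 1) \<or>
     (n0 \<ge> 1 \<and> polygonal_domain \<Omega> \<and>
      (\<exists>R :: nat \<Rightarrow> pt set. (\<forall>j<n0. is_ring N0 c0 \<beta> (R j)) \<and>
         (\<forall>i<n0. \<forall>j<n0. i \<noteq> j \<longrightarrow> interior (R i) \<inter> interior (R j) = {}) \<and>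
         \<Omega> = (\<Union>j<n0. R j)))"

definition poly2 :: "nat \<Rightarrow> (pt \<Rightarrow> real) \<Rightarrow> bool" where
  "poly2 k P \<longleftrightarrow> (\<exists>c :: nat \<Rightarrow> nat \<Rightarrow> real.
      \<forall>x. P x = (\<Sum>i<k. \<Sum>j<k - i. c i j * (x $ 1) ^ i * (x $ 2) ^ j))"

fun Cr :: "nat \<Rightarrow> pt set \<Rightarrow> (pt \<Rightarrow> real) \<Rightarrow> bool" where
  "Cr 0 \<Omega> f = continuous_on \<Omega> f"
| "Cr (Suc m) \<Omega> f = (continuous_on \<Omega> f \<and>
     (\<forall>i::2. \<exists>g. (\<forall>x\<in>interior \<Omega>. ((\<lambda>t. f (x + t *\<^sub>R axis i 1)) has_real_derivative g x) (at 0))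
               \<and> Cr m \<Omega> g))"

definition spline_class :: "nat \<Rightarrow> real \<Rightarrow> real \<Rightarrow> pt set \<Rightarrow> nat \<Rightarrow> nat \<Rightarrow> nat \<Rightarrow> (pt \<Rightarrow> real) \<Rightarrow> bool" where
  "spline_class N0 c0 \<beta> \<Omega> n k r S \<longleftrightarrow>
     (\<exists>(R :: nat \<Rightarrow> pt set) (P :: nat \<Rightarrow> pt \<Rightarrow> real).
        (\<forall>j<n. is_ring N0 c0 \<beta> (R j) \<and> poly2 k (P j)) \<and>
        (\<forall>i<n. \<forall>j<n. i \<noteq> j \<longrightarrow> interior (R i) \<inter> interior (R j) = {}) \<and>
        \<Omega> = (\<Union>j<n. R j) \<and>
        (\<forall>j<n. \<forall>x\<in>R j. S x = P j x) \<and>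
        Cr r \<Omega> S)"

text \<open>Real power of an extended nonnegative real (exponent positive).\<close>
definition en_pow :: "ennreal \<Rightarrow> real \<Rightarrow> ennreal" where
  "en_pow x a = (if x = top then top else ennreal (enn2real x powr a))"

definition Lnorm :: "real \<Rightarrow> pt set \<Rightarrow> (pt \<Rightarrow> real) \<Rightarrow> ennreal" where
  "Lnorm p \<Omega> f = en_pow (\<integral>\<^sup>+ x\<in>\<Omega>. ennreal (\<bar>f x\<bar> powr p) \<partial>lborel) (1 / p)"

definition fdiff :: "nat \<Rightarrow> pt set \<Rightarrow> pt \<Rightarrow> (pt \<Rightarrow> real) \<Rightarrow> pt \<Rightarrow> real" where
  "fdiff k \<Omega> h f x = (if closed_segment x (x + real k *\<^sub>R h) \<subseteq> \<Omega>
      then (\<Sum>\<nu>\<le>k. (-1) ^ (k + \<nu>) * real (k choose \<nu>) * f (x + real \<nu> *\<^sub>R h)) else 0)"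

definition modulus :: "nat \<Rightarrow> pt set \<Rightarrow> (pt \<Rightarrow> real) \<Rightarrow> real \<Rightarrow> real \<Rightarrow> ennreal" where
  "modulus k \<Omega> f t \<tau> = (SUP h\<in>{h. norm h \<le> t}. Lnorm \<tau> \<Omega> (fdiff k \<Omega> h f))"

definition besov_seminorm :: "real \<Rightarrow> nat \<Rightarrow> real \<Rightarrow> pt set \<Rightarrow> (pt \<Rightarrow> real) \<Rightarrow> ennreal" where
  "besov_seminorm s k \<tau> \<Omega> f = en_pow
     (\<integral>\<^sup>+ t\<in>{0<..}. en_pow (ennreal (t powr (- s)) * modulus k \<Omega> f t \<tau>) \<tau> * ennreal (1 / t) \<partial>lborel)
     (1 / \<tau>)"

end

theory Submission
  imports Defs
begin

text \<open>A \<open>k\<close>-th difference of a spline vanishes unless its segment crosses an edge, and every edge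
  \<open>e\<close>, cut into two if necessary, is the base of a triangle of base angle \<open>\<beta>\<close> inside its ring. In a
  neighbourhood of \<open>e\<close> of size comparable to its length \<open>l\<close>, the polynomial of that ring is bounded
  by \<open>(I / l\<^sup>2) powr (1 / p)\<close>, where \<open>I\<close> is the integral of \<open>\<bar>S\<bar> powr p\<close> over a ball in the triangle.

  At scale \<open>t\<close>, call \<open>e\<close> long if \<open>l > t\<close>. Where a difference passes between two long edges, the
  smoothness of \<open>S\<close> gives a factor \<open>(t / l) ^ r\<close> on a strip of area \<open>O(t l)\<close>. Near short edges no
  cancellation is used: they affect the polynomial at \<open>e\<close> only on an area \<open>O(min (m t\<^sup>2) (l\<^sup>2))\<close>, where \<open>m\<close>
  counts the shorter edges that touch \<open>e\<close> and the edges of the same ring. The integrals against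
  \<open>t powr (- s \<tau> - 1)\<close> converge because \<open>s / 2 < r + 1 / p\<close> and \<open>s \<tau> < 2\<close>, and what remains is the
  sum over \<open>e\<close> of \<open>m powr (s \<tau> / 2) * I powr (\<tau> / p)\<close>. Packing of the triangles bounds the sum
  of the \<open>m\<close> by \<open>O(n)\<close>, and Hoelder's inequality with \<open>s \<tau> / 2 + \<tau> / p = 1\<close> concludes.\<close>

section \<open>Pointwise bounds for polynomials\<close>

text \<open>Nothing relates the sizes of neighbouring rings, and a long edge may be touched by
  arbitrarily many short ones. A polynomial is therefore never estimated through its neighbour, only
  through a ball at an edge of its own ring, and the unbounded number \<open>m\<close> is kept as a
  weight until the end, where only its sum matters. That sum is counted from the shorter edge: only
  boundedly many edges of at least its length can touch it.

  A segment may pass through many pieces. Its difference is summed by parts along their chain, so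
  that the first polynomial is annihilated and each crossing contributes one jump. Since \<tau> may
  be smaller or larger than 1, powers of sums are estimated crudely by the number of terms; this is
  affordable because packing bounds the number of long edges near a point at every scale.

  The choice of \<tau> makes the final sum free of lengths: integration in \<open>t\<close> yields
  \<open>l powr (2 - s * \<tau>)\<close>, which cancels the power of \<open>l\<close> in the
  normalised integrals because \<open>2 - s * \<tau> = 2 * \<tau> / p\<close>.\<close>

lemma poly_coeff_bound_nodes:
  fixes X :: "real set"
  assumes "finite X"
  shows "\<exists>C\<ge>0. \<forall>(q::real poly) M. (q = 0 \<or> degree q < card X) \<longrightarrow> M \<ge> 0 \<longrightarrow>
           (\<forall>x\<in>X. \<bar>poly q x\<bar> \<le> M) \<longrightarrow> (\<forall>i. \<bar>coeff q i\<bar> \<le> C * M)"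
  using assms
proof (induction X rule: finite_induct)
  case empty
  then show ?case by (intro exI[of _ 0]) auto
next
  case (insert a X)
  then obtain C where C: "C \<ge> 0" and IH: "\<And>(q::real poly) M i. q = 0 \<or> degree q < card X \<Longrightarrow> M \<ge> 0 \<Longrightarrow>
      (\<forall>x\<in>X. \<bar>poly q x\<bar> \<le> M) \<Longrightarrow> \<bar>coeff q i\<bar> \<le> C * M" by blast
  define B where "B = (\<Sum>x\<in>X. 2 / \<bar>x - a\<bar>)"
  have B0: "B \<ge> 0" unfolding B_def by (intro sum_nonneg) auto
  show ?case
  proof (intro exI[of _ "C * B * (1 + \<bar>a\<bar>) + 1"] conjI allI impI)
    show "0 \<le> C * B * (1 + \<bar>a\<bar>) + 1" using C B0 by simp
    fix q :: "real poly" and M :: real and i :: nat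
    assume q: "q = 0 \<or> degree q < card (insert a X)" and M: "M \<ge> 0"
      and bd: "\<forall>x\<in>insert a X. \<bar>poly q x\<bar> \<le> M"
    \<comment> \<open>Dividing \<open>q - q(a)\<close> by \<open>x - a\<close> loses one degree and
      one node, and the quotient is still bounded at the remaining nodes. The alternative
      \<open>q = 0\<close> in the claim serves the case in which no node remains and the quotient
      vanishes.\<close>
    define s where "s = synthetic_div q a"
    have eq: "q = [:- a, 1:] * s + [:poly q a:]"
      using synthetic_div_correct'[of a q] by (simp add: s_def)
    have deg: "s = 0 \<or> degree s < card X"
    proof (cases "degree q = 0")
      case True
      then show ?thesis by (simp add: s_def synthetic_div_eq_0_iff)
    next
      case False
      then show ?thesis using q insert.hyps by (auto simp: s_def degree_synthetic_div)
    qed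
    have val: "\<bar>poly s x\<bar> \<le> B * M" if x: "x \<in> X" for x
    proof -
      have xa: "x \<noteq> a" using x insert.hyps by auto
      have "poly q x = (x - a) * poly s x + poly q a"
        by (subst eq) (simp add: algebra_simps)
      then have "poly s x = (poly q x - poly q a) / (x - a)" using xa by simp
      then have "\<bar>poly s x\<bar> \<le> 2 * M / \<bar>x - a\<bar>"
        using bd x by (auto simp: abs_divide intro!: divide_right_mono dest!: bspec[of _ _ x])
      also have "\<dots> = (2 / \<bar>x - a\<bar>) * M" by simp
      also have "\<dots> \<le> B * M" unfolding B_def
        by (intro mult_right_mono member_le_sum x insert.hyps M) auto
      finally show ?thesis .
    qed
    have sc: "\<bar>coeff s j\<bar> \<le> C * (B * M)" for j
      using IH[OF deg _ ] val B0 M by simp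
    have "coeff q i = (case i of 0 \<Rightarrow> 0 | Suc j \<Rightarrow> coeff s j) - a * coeff s i + (if i = 0 then poly q a else 0)"
      by (subst eq) (auto simp: coeff_pCons split: nat.splits)
    also have "\<bar>\<dots>\<bar> \<le> C * (B * M) + \<bar>a\<bar> * (C * (B * M)) + M"
    proof -
      have 1: "\<bar>case i of 0 \<Rightarrow> 0 | Suc j \<Rightarrow> coeff s j\<bar> \<le> C * (B * M)"
        using sc C B0 M by (auto split: nat.splits)
      have 2: "\<bar>a * coeff s i\<bar> \<le> \<bar>a\<bar> * (C * (B * M))"
        using sc[of i] by (simp add: abs_mult mult_left_mono)
      have 3: "\<bar>if i = 0 then poly q a else 0\<bar> \<le> M" using bd M by auto
      show ?thesis using 1 2 3 by linarith
    qed
    also have "\<dots> = (C * B * (1 + \<bar>a\<bar>) + 1) * M" by (simp add: algebra_simps)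
    finally show "\<bar>coeff q i\<bar> \<le> (C * B * (1 + \<bar>a\<bar>) + 1) * M" .
  qed
qed

lemma poly2_line:
  assumes "poly2 k P" "k \<ge> 1"
  obtains q :: "real poly" where "degree q < k" "\<And>u. P (y + u *\<^sub>R w) = poly q u"
proof -
  obtain c where c: "\<And>x. P x = (\<Sum>i<k. \<Sum>j<k - i. c i j * (x $ 1) ^ i * (x $ 2) ^ j)"
    using assms(1) unfolding poly2_def by blast
  define q where "q = (\<Sum>i<k. \<Sum>j<k - i. smult (c i j) ([:y $ 1, w $ 1:] ^ i * [:y $ 2, w $ 2:] ^ j))"
  have "degree q \<le> k - 1" unfolding q_def
  proof (intro degree_sum_le)
    fix i j assume i: "i \<in> {..<k}" and j: "j \<in> {..<k - i}"
    have l: "degree ([:a, b:] ^ n) \<le> n" for a b :: real and n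
    proof -
      have "degree ([:a, b:] ^ n) \<le> degree [:a, b:] * n" by (rule degree_power_le)
      also have "\<dots> \<le> 1 * n" by (intro mult_right_mono) auto
      finally show ?thesis by simp
    qed
    have "degree (smult (c i j) ([:y $ 1, w $ 1:] ^ i * [:y $ 2, w $ 2:] ^ j)) \<le> degree ([:y $ 1, w $ 1:] ^ i * [:y $ 2, w $ 2:] ^ j)"
      by (rule degree_smult_le)
    also have "\<dots> \<le> i + j"
      by (intro order_trans[OF degree_mult_le] add_mono l)
    also have "\<dots> \<le> k - 1" using i j by auto
    finally show "degree (smult (c i j) ([:y $ 1, w $ 1:] ^ i * [:y $ 2, w $ 2:] ^ j)) \<le> k - 1" .
  qed auto
  then have d: "degree q < k" using assms(2) by simp
  moreover have "P (y + u *\<^sub>R w) = poly q u" for u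
    by (simp add: c q_def poly_sum algebra_simps)
  ultimately show thesis using that by blast
qed

lemma poly2_continuous: "poly2 k P \<Longrightarrow> continuous_on A P"
proof -
  assume "poly2 k P"
  then obtain c where c: "P = (\<lambda>x. \<Sum>i<k. \<Sum>j<k - i. c i j * (x $ 1) ^ i * (x $ 2) ^ j)"
    unfolding poly2_def by blast
  show ?thesis unfolding c by (intro continuous_intros)
qed

lemma poly2_measurable: "poly2 k P \<Longrightarrow> P \<in> borel_measurable borel"
  by (rule borel_measurable_continuous_onI[OF poly2_continuous])

text \<open>The sum is at most \<open>card F\<close> times its largest term, which works on both
  sides of \<tau> = 1. The loss is harmless because every index set to which this is applied has
  bounded size.\<close>

lemma sum_powr_le:
  fixes b :: "'a \<Rightarrow> real"
  assumes "finite F" "\<And>i. i \<in> F \<Longrightarrow> b i \<ge> 0" "\<tau> > 0"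
  shows "(\<Sum>i\<in>F. b i) powr \<tau> \<le> real (card F) powr \<tau> * (\<Sum>i\<in>F. b i powr \<tau>)"
proof (cases "F = {}")
  case False
  define m where "m = Max (b ` F)"
  have m: "b i \<le> m" if "i \<in> F" for i unfolding m_def using assms that by auto
  obtain i0 where i0: "i0 \<in> F" "b i0 = m"
  proof -
    have "Max (b ` F) \<in> b ` F" using assms False by (intro Max_in) auto
    then show thesis using that unfolding m_def by auto
  qed
  have "(\<Sum>i\<in>F. b i) \<le> real (card F) * m" using sum_bounded_above[of F b m] m by auto
  then have "(\<Sum>i\<in>F. b i) powr \<tau> \<le> (real (card F) * m) powr \<tau>"
    by (intro powr_mono2 sum_nonneg) (use assms in auto)
  also have "\<dots> = real (card F) powr \<tau> * m powr \<tau>"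
    using i0 assms by (subst powr_mult) auto
  also have "\<dots> \<le> real (card F) powr \<tau> * (\<Sum>i\<in>F. b i powr \<tau>)"
    using i0 assms member_le_sum[of i0 F "\<lambda>i. b i powr \<tau>"] by (intro mult_left_mono) auto
  finally show ?thesis .
qed auto

text \<open>In the plane the change of variables has Jacobian \<open>c^2\<close>, which is at least
  1/4; hence the factor 4.\<close>

lemma nn_integral_affine_ball_le:
  fixes f :: "pt \<Rightarrow> ennreal"
  assumes "f \<in> borel_measurable borel" "c \<ge> 1/2"
    and "\<And>z. z \<in> A \<Longrightarrow> t + c *\<^sub>R z \<in> B" "A \<in> sets borel" "B \<in> sets borel"
  shows "(\<integral>\<^sup>+z\<in>A. f (t + c *\<^sub>R z) \<partial>lborel) \<le> 4 * (\<integral>\<^sup>+z\<in>B. f z \<partial>lborel)"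
proof -
  have c0: "c \<noteq> 0" using assms(2) by auto
  note [measurable] = assms(1,4,5)
  have "(\<integral>\<^sup>+z\<in>B. f z \<partial>lborel) = (\<integral>\<^sup>+z. f z * indicator B z \<partial>(density (distr lborel borel (\<lambda>x. t + c *\<^sub>R x)) (\<lambda>_. ennreal (\<bar>c\<bar>^DIM(pt)))))"
    using lborel_affine[OF c0, of t] by simp
  also have "\<dots> = (\<integral>\<^sup>+z. ennreal (c^2) * (f (t + c *\<^sub>R z) * indicator B (t + c *\<^sub>R z)) \<partial>lborel)"
    by (simp add: nn_integral_density nn_integral_distr)
  also have "\<dots> = ennreal (c^2) * (\<integral>\<^sup>+z. (f (t + c *\<^sub>R z) * indicator B (t + c *\<^sub>R z)) \<partial>lborel)"
    by (subst nn_integral_cmult) simp_all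
  finally have eq: "(\<integral>\<^sup>+z\<in>B. f z \<partial>lborel) = \<dots>" .
  have "(\<integral>\<^sup>+z\<in>A. f (t + c *\<^sub>R z) \<partial>lborel) \<le> (\<integral>\<^sup>+z. (f (t + c *\<^sub>R z) * indicator B (t + c *\<^sub>R z)) \<partial>lborel)"
    by (intro nn_integral_mono) (auto simp: indicator_def assms(3))
  also have "\<dots> \<le> (4 * ennreal (c^2)) * (\<integral>\<^sup>+z. (f (t + c *\<^sub>R z) * indicator B (t + c *\<^sub>R z)) \<partial>lborel)"
  proof -
    have "(1/2)^2 \<le> c^2" using assms(2) by (intro power_mono) auto
    then have "1 \<le> ennreal (4 * c^2)" by (simp add: power2_eq_square)
    then have "1 \<le> 4 * ennreal (c^2)" by (simp add: ennreal_mult)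
    then show ?thesis using mult_right_mono by fastforce
  qed
  also have "\<dots> = 4 * (\<integral>\<^sup>+z\<in>B. f z \<partial>lborel)" unfolding eq by (simp add: mult.assoc)
  finally show ?thesis .
qed

lemma emeasure_ball_pt:
  fixes z :: pt assumes "\<rho> \<ge> 0" shows "emeasure lborel (ball z \<rho>) = ennreal (pi * \<rho>^2)"
  using emeasure_ball[OF assms, of z] by (simp add: unit_ball_vol_2 DIM_cart)

lemma emeasure_cball_pt:
  fixes z :: pt assumes "\<rho> \<ge> 0" shows "emeasure lborel (cball z \<rho>) = ennreal (pi * \<rho>^2)"
  using emeasure_cball[OF assms, of z] by (simp add: unit_ball_vol_2 DIM_cart)

text \<open>Along the segments from \<open>y\<close> to points of a smaller concentric ball, interpolation at nodes
  close to the far end bounds the value at \<open>y\<close>; averaging over these segments works for every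
  exponent \<open>p > 0\<close>.\<close>

lemma poly2_pointwise_le_ball_norm:
  fixes p K :: real
  assumes "k \<ge> 1" "p > 0" "K \<ge> 0"
  shows "\<exists>C>0. \<forall>P (y::pt) z0 \<rho>. poly2 k P \<longrightarrow> \<rho> > 0 \<longrightarrow> dist y z0 \<le> K * \<rho> \<longrightarrow>
     ennreal (\<bar>P y\<bar> powr p * \<rho>^2) \<le> ennreal C * (\<integral>\<^sup>+z\<in>ball z0 \<rho>. ennreal (\<bar>P z\<bar> powr p) \<partial>lborel)"
proof -
  \<comment> \<open>For \<open>x\<close> between 1 - \<epsilon> and 1 the point
    \<open>y + x (z - y)\<close> is displaced by at most \<epsilon> K \<rho> \<le> \<rho>/2 towards
    \<open>y\<close>, so \<open>z\<close> in the half ball lands in the full ball. Taking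
    \<open>K + 1\<close> also gives \<epsilon> \<le> 1/2, as the change of variables
    requires.\<close>
  define \<epsilon> where "\<epsilon> = 1 / (2 * (K + 1))"
  have e: "\<epsilon> > 0" "\<epsilon> \<le> 1/2" using assms by (auto simp: \<epsilon>_def field_simps)
  have "infinite {1 - \<epsilon>..1}" using e by (simp add: infinite_Icc)
  then obtain X where X: "finite X" "card X = k" "X \<subseteq> {1 - \<epsilon>..1}"
    using infinite_arbitrarily_large by blast
  obtain C where C: "C \<ge> 0" and CC: "\<And>(q::real poly) M i. q = 0 \<or> degree q < card X \<Longrightarrow> M \<ge> 0 \<Longrightarrow>
      (\<forall>x\<in>X. \<bar>poly q x\<bar> \<le> M) \<Longrightarrow> \<bar>coeff q i\<bar> \<le> C * M"
    using poly_coeff_bound_nodes[OF X(1)] by blast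
  \<comment> \<open>Of the factor 16, one 4 comes from the change of variables and one from the area
    of the half ball, estimated with pi \<ge> 1. The factor \<open>k\<close> counts the
    nodes.\<close>
  define D where "D = (C + 1) powr p * real k powr p * real k * 16"
  have D: "D > 0" using C assms by (auto simp: D_def)
  have "ennreal (\<bar>P y\<bar> powr p * \<rho>^2) \<le> ennreal D * (\<integral>\<^sup>+z\<in>ball z0 \<rho>. ennreal (\<bar>P z\<bar> powr p) \<partial>lborel)"
    if P: "poly2 k P" and r: "\<rho> > 0" and d: "dist y z0 \<le> K * \<rho>" for P and y z0 :: pt and \<rho>
  proof -
    note [measurable] = poly2_measurable[OF P]
    define I where "I = (\<integral>\<^sup>+z\<in>ball z0 \<rho>. ennreal (\<bar>P z\<bar> powr p) \<partial>lborel)"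
    have pw: "\<bar>P y\<bar> powr p \<le> (C+1) powr p * real k powr p * (\<Sum>x\<in>X. \<bar>P (y + x *\<^sub>R (z - y))\<bar> powr p)" for z
    proof -
      \<comment> \<open>The value at \<open>y\<close> is the constant coefficient of
        \<open>q\<close>, so the coefficient bound recovers it from the far nodes.\<close>
      obtain q where q: "degree q < k" "\<And>u. P (y + u *\<^sub>R (z - y)) = poly q u"
        using poly2_line[OF P assms(1)] by metis
      define M where "M = (\<Sum>x\<in>X. \<bar>poly q x\<bar>)"
      have "\<bar>coeff q 0\<bar> \<le> C * M"
        by (rule CC) (use q X in \<open>auto simp: M_def intro!: sum_nonneg member_le_sum\<close>)
      then have "\<bar>P y\<bar> \<le> C * M" using q(2)[of 0] by (simp add: poly_0_coeff_0)
      also have "\<dots> \<le> (C+1) * M" by (intro mult_right_mono) (auto simp: M_def intro!: sum_nonneg)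
      finally have "\<bar>P y\<bar> powr p \<le> ((C+1) * M) powr p" using assms by (intro powr_mono2) auto
      also have "\<dots> = (C+1) powr p * M powr p" using C by (subst powr_mult) (auto simp: M_def intro!: sum_nonneg)
      also have "\<dots> \<le> (C+1) powr p * (real k powr p * (\<Sum>x\<in>X. \<bar>poly q x\<bar> powr p))"
        unfolding M_def using sum_powr_le[OF X(1), of "\<lambda>x. \<bar>poly q x\<bar>" p] assms X
        by (intro mult_left_mono) auto
      finally show ?thesis by (simp add: q(2) mult.assoc)
    qed
    have one: "(\<integral>\<^sup>+z\<in>ball z0 (\<rho>/2). ennreal (\<bar>P (y + x *\<^sub>R (z - y))\<bar> powr p) \<partial>lborel) \<le> 4 * I" if x: "x \<in> X" for x
    proof -
      have x': "1 - \<epsilon> \<le> x" "x \<le> 1" using x X by auto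
      have "(\<integral>\<^sup>+z\<in>ball z0 (\<rho>/2). ennreal (\<bar>P ((1-x) *\<^sub>R y + x *\<^sub>R z)\<bar> powr p) \<partial>lborel) \<le> 4 * I"
        unfolding I_def
      proof (rule nn_integral_affine_ball_le)
        show "1/2 \<le> x" using x' e by simp
        fix z assume z: "z \<in> ball z0 (\<rho>/2)"
        have "dist z0 ((1-x) *\<^sub>R y + x *\<^sub>R z) = norm ((1-x) *\<^sub>R (z0 - y) + x *\<^sub>R (z0 - z))"
          by (simp add: dist_norm algebra_simps)
        also have "\<dots> \<le> (1-x) * norm (z0 - y) + x * norm (z0 - z)"
          using x' e by (intro order_trans[OF norm_triangle_ineq]) auto
        also have "\<dots> \<le> \<epsilon> * (K * \<rho>) + 1 * norm (z0 - z)"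
        proof (intro add_mono mult_mono)
          show "norm (z0 - y) \<le> K * \<rho>" using d by (simp add: dist_norm norm_minus_commute)
        qed (use x' e assms r in auto)
        also have "\<epsilon> * (K * \<rho>) \<le> \<rho> / 2" using assms r by (auto simp: \<epsilon>_def field_simps)
        also have "norm (z0 - z) < \<rho>/2" using z by (simp add: dist_norm)
        finally show "(1-x) *\<^sub>R y + x *\<^sub>R z \<in> ball z0 \<rho>" by simp
      qed auto
      then show ?thesis by (simp add: algebra_simps)
    qed
    define b where "b = (C+1) powr p * real k powr p"
    have b: "b \<ge> 0" by (simp add: b_def)
    define F where "F = (\<lambda>x z. ennreal (\<bar>P (y + x *\<^sub>R (z - y))\<bar> powr p) * indicator (ball z0 (\<rho>/2)) z)"
    have [measurable]: "ball z0 (\<rho>/2) \<in> sets borel" by simp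
    have F[measurable]: "F x \<in> borel_measurable borel" for x unfolding F_def by measurable
    have "ennreal (\<bar>P y\<bar> powr p) * ennreal (pi * (\<rho>/2)^2) = (\<integral>\<^sup>+z\<in>ball z0 (\<rho>/2). ennreal (\<bar>P y\<bar> powr p) \<partial>lborel)"
      using r by (simp add: nn_integral_cmult_indicator emeasure_ball_pt)
    also have "\<dots> \<le> (\<integral>\<^sup>+z. (\<Sum>x\<in>X. ennreal b * F x z) \<partial>lborel)"
    proof (intro nn_integral_mono)
      fix z
      have "ennreal (\<bar>P y\<bar> powr p) \<le> ennreal (b * (\<Sum>x\<in>X. \<bar>P (y + x *\<^sub>R (z - y))\<bar> powr p))"
        using pw unfolding b_def by (intro ennreal_leI)
      also have "\<dots> = (\<Sum>x\<in>X. ennreal b * ennreal (\<bar>P (y + x *\<^sub>R (z - y))\<bar> powr p))"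
        using b by (simp add: ennreal_mult' sum_ennreal[symmetric] sum_nonneg sum_distrib_left)
      finally show "ennreal (\<bar>P y\<bar> powr p) * indicator (ball z0 (\<rho>/2)) z \<le> (\<Sum>x\<in>X. ennreal b * F x z)"
        by (auto simp: indicator_def F_def)
    qed
    also have "\<dots> = (\<Sum>x\<in>X. (\<integral>\<^sup>+z. ennreal b * F x z \<partial>lborel))"
      by (rule nn_integral_sum) simp
    also have "\<dots> = (\<Sum>x\<in>X. ennreal b * (\<integral>\<^sup>+z. F x z \<partial>lborel))"
      by (intro sum.cong nn_integral_cmult) simp_all
    also have "\<dots> \<le> (\<Sum>x\<in>X. ennreal b * (4 * I))"
      unfolding F_def by (intro sum_mono mult_left_mono one) auto
    also have "\<dots> = ennreal (b * real k * 4) * I"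
      using b by (simp add: X ennreal_mult' mult_ac ennreal_of_nat_eq_real_of_nat)
    finally have 1: "ennreal (\<bar>P y\<bar> powr p) * ennreal (pi * (\<rho>/2)^2) \<le> ennreal (b * real k * 4) * I" .
    have "\<bar>P y\<bar> powr p * \<rho>^2 \<le> 4 * (\<bar>P y\<bar> powr p * (pi * (\<rho>/2)^2))"
    proof -
      have "1 * (\<bar>P y\<bar> powr p * \<rho>^2) \<le> pi * (\<bar>P y\<bar> powr p * \<rho>^2)" using pi_gt3 by (intro mult_right_mono) auto
      then show ?thesis by (simp add: power_divide mult_ac)
    qed
    then have "ennreal (\<bar>P y\<bar> powr p * \<rho>^2) \<le> ennreal (4 * (\<bar>P y\<bar> powr p * (pi * (\<rho>/2)^2)))" by (rule ennreal_leI)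
    also have "\<dots> = 4 * (ennreal (\<bar>P y\<bar> powr p) * ennreal (pi * (\<rho>/2)^2))" by (simp add: ennreal_mult)
    also have "\<dots> \<le> 4 * (ennreal (b * real k * 4) * I)" by (intro mult_left_mono 1) auto
    also have "\<dots> = ennreal D * I" 
    proof -
      have "D = 4 * (b * real k * 4)" by (simp add: D_def b_def)
      then have "ennreal D = ennreal 4 * ennreal (b * real k * 4)" by (simp only: ennreal_mult')
      then show ?thesis by (simp only: ennreal_numeral mult.assoc)
    qed
    finally show ?thesis unfolding I_def .
  qed
  then show ?thesis using D by blast
qed

section \<open>Matching of Taylor coefficients\<close>

lemma real_polynomial_function_line:
  assumes "real_polynomial_function P"
  shows "\<exists>q::real poly. \<forall>u. P (z + u *\<^sub>R h) = poly q u"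
  using assms
proof induction
  case (linear f)
  interpret bounded_linear f by fact
  show ?case by (intro exI[of _ "[:f z, f h:]"]) (simp add: add scaleR)
next
  case (const c)
  show ?case by (intro exI[of _ "[:c:]"]) simp
next
  case (add f g)
  then obtain p q where "\<forall>u. f (z + u *\<^sub>R h) = poly p u" "\<forall>u. g (z + u *\<^sub>R h) = poly q u" by blast
  then show ?case by (intro exI[of _ "p + q"]) simp
next
  case (mult f g)
  then obtain p q where "\<forall>u. f (z + u *\<^sub>R h) = poly p u" "\<forall>u. g (z + u *\<^sub>R h) = poly q u" by blast
  then show ?case by (intro exI[of _ "p * q"]) simp
qed

text \<open>Matching of coefficients proceeds by induction on the order of smoothness and
  differentiates the pieces. The class \<open>real_polynomial_function\<close> is closed under
  partial derivatives without any bookkeeping of degrees.\<close>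

lemma real_polynomial_function_partials:
  fixes P :: "pt \<Rightarrow> real"
  assumes "real_polynomial_function P"
  shows "\<exists>D. (\<forall>i::2. real_polynomial_function (D i)) \<and>
           (\<forall>x. (P has_derivative (\<lambda>v. \<Sum>i\<in>UNIV. v $ i * D i x)) (at x))"
  using assms
proof induction
  case (linear f)
  interpret bounded_linear f by fact
  have eq: "f = (\<lambda>v. \<Sum>i\<in>UNIV. v $ i * f (axis i 1))"
  proof
    fix v
    have "f v = f (\<Sum>i\<in>UNIV. v $ i *\<^sub>R axis i 1)"
      by (subst basis_expansion[of v, symmetric]) (simp add: scalar_mult_eq_scaleR)
    then show "f v = (\<Sum>i\<in>UNIV. v $ i * f (axis i 1))" by (simp add: sum scaleR)
  qed
  show ?case
    by (intro exI[of _ "\<lambda>i x. f (axis i 1)"] conjI allI real_polynomial_function.intros(2),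
        subst eq[symmetric]) (rule bounded_linear_imp_has_derivative[OF linear.hyps])
next
  case (const c)
  show ?case by (intro exI[of _ "\<lambda>i x. 0"] conjI allI real_polynomial_function.intros(2)) simp
next
  case (add f g)
  from add.IH(1) obtain D where D: "\<And>i. real_polynomial_function (D i)" "\<And>x. (f has_derivative (\<lambda>v. \<Sum>i\<in>UNIV. v $ i * D i x)) (at x)"
    by auto
  from add.IH(2) obtain E where E: "\<And>i. real_polynomial_function (E i)" "\<And>x. (g has_derivative (\<lambda>v. \<Sum>i\<in>UNIV. v $ i * E i x)) (at x)"
    by auto
  show ?case
  proof (intro exI[of _ "\<lambda>i x. D i x + E i x"] conjI allI real_polynomial_function.intros(3) D(1) E(1))
    fix x
    have "((\<lambda>x. f x + g x) has_derivative (\<lambda>v. (\<Sum>i\<in>UNIV. v $ i * D i x) + (\<Sum>i\<in>UNIV. v $ i * E i x))) (at x)"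
      by (intro has_derivative_add D E)
    then show "((\<lambda>x. f x + g x) has_derivative (\<lambda>v. \<Sum>i\<in>UNIV. v $ i * (D i x + E i x))) (at x)"
      by (simp add: distrib_left sum.distrib)
  qed
next
  case (mult f g)
  from mult.IH(1) obtain D where D: "\<And>i. real_polynomial_function (D i)" "\<And>x. (f has_derivative (\<lambda>v. \<Sum>i\<in>UNIV. v $ i * D i x)) (at x)"
    by auto
  from mult.IH(2) obtain E where E: "\<And>i. real_polynomial_function (E i)" "\<And>x. (g has_derivative (\<lambda>v. \<Sum>i\<in>UNIV. v $ i * E i x)) (at x)"
    by auto
  show ?case
  proof (intro exI[of _ "\<lambda>i x. f x * E i x + D i x * g x"] conjI allI real_polynomial_function.intros(3) real_polynomial_function.intros(4) D(1) E(1) mult.hyps)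
    fix x
    have "((\<lambda>x. f x * g x) has_derivative (\<lambda>v. f x * (\<Sum>i\<in>UNIV. v $ i * E i x) + (\<Sum>i\<in>UNIV. v $ i * D i x) * g x)) (at x)"
      by (intro has_derivative_mult D E)
    then show "((\<lambda>x. f x * g x) has_derivative (\<lambda>v. \<Sum>i\<in>UNIV. v $ i * (f x * E i x + D i x * g x))) (at x)"
      by (simp add: distrib_left sum.distrib sum_distrib_left sum_distrib_right mult_ac)
  qed
qed

lemma poly2_real_polynomial_function:
  assumes "poly2 k P"
  shows "real_polynomial_function P"
proof -
  obtain c where c: "P = (\<lambda>x. \<Sum>i<k. \<Sum>j<k - i. c i j * (x $ 1) ^ i * (x $ 2) ^ j)"
    using assms unfolding poly2_def by blast
  have "real_polynomial_function (\<lambda>x::pt. x $ i)" for i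
    by (intro real_polynomial_function.intros(1) bounded_linear_vec_nth)
  then show ?thesis unfolding c
    by (intro real_polynomial_function_sum real_polynomial_function.intros(4) real_polynomial_function.intros(2)
        real_polynomial_function_power) auto
qed

text \<open>The partial derivatives in the definition of \<open>Cr\<close> are continuous up to the boundary, so
  the Taylor coefficients of two pieces agree at any common point, even on the boundary of \<open>\<Omega>\<close>.\<close>

lemma Cr_matching_coeffs:
  assumes "Cr m \<Omega> f" "real_polynomial_function A" "real_polynomial_function B"
    and "\<And>x. x \<in> R \<Longrightarrow> f x = A x" "\<And>x. x \<in> R' \<Longrightarrow> f x = B x"
    and R: "R \<subseteq> \<Omega>" "R \<subseteq> closure (interior R)" and R': "R' \<subseteq> \<Omega>" "R' \<subseteq> closure (interior R')"
    and z: "z \<in> R" "z \<in> R'"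
    and "\<And>u. A (z + u *\<^sub>R h) = poly a u" "\<And>u. B (z + u *\<^sub>R h) = poly b u"
    and "l \<le> m"
  shows "coeff a l = coeff b l"
  using assms(1-5) assms(12-14)
proof (induction m arbitrary: f A B a b l)
  case 0
  then show ?case using z by (simp flip: poly_0_coeff_0) (metis add_0_right scaleR_zero_left)
next
  case (Suc m)
  obtain DA where DA: "\<And>i. real_polynomial_function (DA i)" "\<And>x. (A has_derivative (\<lambda>v. \<Sum>i\<in>UNIV. v $ i * DA i x)) (at x)"
    using real_polynomial_function_partials[OF Suc.prems(2)] by auto
  obtain DB where DB: "\<And>i. real_polynomial_function (DB i)" "\<And>x. (B has_derivative (\<lambda>v. \<Sum>i\<in>UNIV. v $ i * DB i x)) (at x)"
    using real_polynomial_function_partials[OF Suc.prems(3)] by auto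
  have "\<forall>i. \<exists>g. (\<forall>x\<in>interior \<Omega>. ((\<lambda>t. f (x + t *\<^sub>R axis i 1)) has_real_derivative g x) (at 0)) \<and> Cr m \<Omega> g"
    using Suc.prems(1) by simp
  then obtain g where g: "\<And>i x. x \<in> interior \<Omega> \<Longrightarrow> ((\<lambda>t. f (x + t *\<^sub>R axis i 1)) has_real_derivative g i x) (at 0)"
    and Cg: "\<And>i. Cr m \<Omega> (g i)" by metis
  have cg: "continuous_on \<Omega> (g i)" for i using Cg[of i] by (cases m) auto
  \<comment> \<open>In the interior of a piece the derivative supplied by \<open>Cr\<close> is that
    of the polynomial. Both sides are continuous on the whole piece, which is contained in the
    closure of its interior, so the equality reaches its boundary.\<close>
  have on_piece: "g i x = D i x"
    if D: "\<And>i. real_polynomial_function (D i)" "\<And>x. (P has_derivative (\<lambda>v. \<Sum>i\<in>UNIV. v $ i * D i x)) (at x)"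
      and fP: "\<And>x. x \<in> Q \<Longrightarrow> f x = P x" and Q: "Q \<subseteq> \<Omega>" "Q \<subseteq> closure (interior Q)" and x: "x \<in> Q"
    for P D Q i x
  proof -
    have eq: "g i y = D i y" if y: "y \<in> interior Q" for y
    proof -
      have "y \<in> interior \<Omega>" using y Q interior_mono by blast
      from g[OF this] have 1: "((\<lambda>t. f (y + t *\<^sub>R axis i 1)) has_real_derivative g i y) (at 0)" .
      have "((\<lambda>t. P (y + t *\<^sub>R axis i 1)) has_derivative (\<lambda>t. \<Sum>l\<in>UNIV. (t *\<^sub>R axis i 1 :: pt) $ l * D l y)) (at 0)"
        by (rule has_derivative_compose[where f="\<lambda>t. y + t *\<^sub>R axis i 1" and g=P])
          (auto intro!: derivative_eq_intros D(2))
      moreover have "(\<lambda>t. \<Sum>l\<in>UNIV. (t *\<^sub>R axis i 1 :: pt) $ l * D l y) = (*) (D i y)"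
        by (simp add: axis_def if_distrib if_distribR sum.delta fun_eq_iff cong: if_cong)
      ultimately have 2: "((\<lambda>t. P (y + t *\<^sub>R axis i 1)) has_real_derivative D i y) (at 0)"
        by (simp add: has_field_derivative_def)
      have "open ((\<lambda>t::real. y + t *\<^sub>R axis i 1) -` interior Q)"
        by (intro continuous_open_vimage) (auto intro!: continuous_intros)
      moreover have "0 \<in> (\<lambda>t::real. y + t *\<^sub>R axis i 1) -` interior Q" using y by simp
      ultimately have "((\<lambda>t. f (y + t *\<^sub>R axis i 1)) has_real_derivative D i y) (at 0)"
        by (intro has_field_derivative_transform_within_open[OF 2])
          (use fP interior_subset in \<open>auto intro!: fP[symmetric]\<close>)
      then show ?thesis using 1 DERIV_unique by blast
    qed
    have "continuous_on \<Omega> (\<lambda>x. g i x - D i x)"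
      using D(1)[of i] by (intro continuous_intros cg) (metis continuous_on_polymonial_function real_polynomial_function_eq)
    then have c: "continuous_on Q (\<lambda>x. g i x - D i x)" using Q(1) continuous_on_subset by blast
    have "x \<in> closure (interior Q)" using x Q by auto
    then obtain s where s: "\<And>n. s n \<in> interior Q" "s \<longlonglongrightarrow> x" unfolding closure_sequential by blast
    have "(\<lambda>n. g i (s n) - D i (s n)) \<longlonglongrightarrow> g i x - D i x"
      by (rule continuous_on_tendsto_compose[OF c s(2) x])
        (use s(1) interior_subset[of Q] in \<open>auto intro: always_eventually\<close>)
    then have "(\<lambda>n. 0) \<longlonglongrightarrow> g i x - D i x" using eq s(1) by simp
    then show ?thesis using LIMSEQ_const_iff[of 0 "g i x - D i x"] by simp
  qed
  \<comment> \<open>By the chain rule the derivative along the line is a fixed combination of the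
    restricted partial derivatives. Coefficient \<open>Suc l'\<close> of the restriction is thereby
    reduced to coefficient \<open>l'\<close> of the partials.\<close>
  have lineder: "pderiv q = (\<Sum>i\<in>UNIV. smult (h $ i) (d i))"
    if D: "\<And>x. (P has_derivative (\<lambda>v. \<Sum>i\<in>UNIV. v $ i * D i x)) (at x)"
      and q: "\<And>u. P (z + u *\<^sub>R h) = poly q u" and d: "\<And>i u. D i (z + u *\<^sub>R h) = poly (d i) u"
    for P D and q :: "real poly" and d :: "2 \<Rightarrow> real poly"
  proof -
    have "poly (pderiv q) u = poly (\<Sum>i\<in>UNIV. smult (h $ i) (d i)) u" for u
    proof -
      have "((\<lambda>t. P (z + t *\<^sub>R h)) has_derivative (\<lambda>t. \<Sum>l\<in>UNIV. (t *\<^sub>R h) $ l * D l (z + u *\<^sub>R h))) (at u)"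
        by (rule has_derivative_compose[where f="\<lambda>t. z + t *\<^sub>R h" and g=P])
          (auto intro!: derivative_eq_intros D)
      then have "(poly q has_derivative (\<lambda>t. \<Sum>l\<in>UNIV. t * h $ l * poly (d l) u)) (at u)"
        by (simp add: q d)
      moreover have "(\<lambda>t. \<Sum>l\<in>UNIV. t * h $ l * poly (d l) u) = (*) (\<Sum>l\<in>UNIV. h $ l * poly (d l) u)"
        by (simp add: fun_eq_iff sum_distrib_left mult_ac)
      ultimately have "(poly q has_real_derivative (\<Sum>l\<in>UNIV. h $ l * poly (d l) u)) (at u)"
        by (simp add: has_field_derivative_def)
      then have "(\<Sum>l\<in>UNIV. h $ l * poly (d l) u) = poly (pderiv q) u"
        using poly_DERIV DERIV_unique by blast
      then show ?thesis by (simp add: poly_sum)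
    qed
    then show ?thesis by (simp add: poly_eq_poly_eq_iff[symmetric] fun_eq_iff)
  qed
  have "\<forall>i. \<exists>d. \<forall>u. DA i (z + u *\<^sub>R h) = poly d u" using real_polynomial_function_line DA(1) by blast
  then obtain da where da: "\<And>i u. DA i (z + u *\<^sub>R h) = poly (da i) u" by metis
  have "\<forall>i. \<exists>d. \<forall>u. DB i (z + u *\<^sub>R h) = poly d u" using real_polynomial_function_line DB(1) by blast
  then obtain db where db: "\<And>i u. DB i (z + u *\<^sub>R h) = poly (db i) u" by metis
  show ?case
  proof (cases l)
    case 0
    have "poly a 0 = poly b 0"
      using Suc.prems(4)[OF z(1)] Suc.prems(5)[OF z(2)] Suc.prems(6)[of 0] Suc.prems(7)[of 0] by simp
    then show ?thesis using 0 by (simp add: poly_0_coeff_0)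
  next
    case (Suc l')
    have "coeff (da i) l' = coeff (db i) l'" for i
    proof (rule Suc.IH[OF Cg[of i] DA(1)[of i] DB(1)[of i]])
      show "g i x = DA i x" if "x \<in> R" for x
        by (rule on_piece[OF DA Suc.prems(4) R that])
      show "g i x = DB i x" if "x \<in> R'" for x
        by (rule on_piece[OF DB Suc.prems(5) R' that])
    qed (use da db Suc Suc.prems in auto)
    then have "coeff (pderiv a) l' = coeff (pderiv b) l'"
      using lineder[OF DA(2) Suc.prems(6) da] lineder[OF DB(2) Suc.prems(7) db]
      by (simp add: coeff_sum)
    then show ?thesis using Suc by (simp add: coeff_pderiv)
  qed
qed

section \<open>Half-edges of rings\<close>

text \<open>This is all that later steps retain of the triangle: balls shrinking towards any point
  of the edge, with radius proportional to the distance travelled. At \<theta> = 1 one obtains the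
  ball over which \<open>S\<close> is integrated, and at \<theta> = t / length a ball of size
  \<open>t\<close> near a prescribed point for the packing argument.\<close>

definition fat_at :: "real \<Rightarrow> pt set \<Rightarrow> pt \<Rightarrow> pt \<Rightarrow> pt \<Rightarrow> bool" where
  "fat_at c R u v z0 \<longleftrightarrow> u \<noteq> v \<and> (\<forall>z\<in>closed_segment u v. dist z z0 \<le> dist u v \<and>
     (\<forall>\<theta>\<in>{0..1}. ball (z + \<theta> *\<^sub>R (z0 - z)) (\<theta> * (c * dist u v)) \<subseteq> R))"

lemma vangle_inner:
  assumes "vangle x y = \<beta>" "0 < \<beta>" "\<beta> \<le> pi / 3"
  shows "x \<bullet> y = cos \<beta> * (norm x * norm y)"
proof -
  define q where "q = (x \<bullet> y) / (norm x * norm y)"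
  have "\<bar>x \<bullet> y\<bar> \<le> norm x * norm y" by (rule Cauchy_Schwarz_ineq2)
  then have "\<bar>q\<bar> \<le> 1" unfolding q_def
    by (cases "norm x * norm y = 0") (auto simp: abs_divide divide_le_eq)
  then have cq: "cos \<beta> = q" using assms(1) unfolding vangle_def q_def[symmetric] by (auto intro: cos_arccos)
  \<comment> \<open>For a zero vector the quotient would be 0, by the convention for division, and
    could not equal a positive cosine.\<close>
  have "cos \<beta> > 0" using assms by (intro cos_gt_zero) auto
  then have "norm x * norm y \<noteq> 0" using cq unfolding q_def by auto
  then show ?thesis using cq unfolding q_def by (simp add: field_simps)
qed

text \<open>The quarter turn: \<open>d\<close> and \<open>rot d\<close> are orthogonal and equally
  long, so coordinates of a triangle over \<open>d\<close> in this frame do not depend on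
  scale.\<close>

definition rot :: "pt \<Rightarrow> pt" where "rot d = vector [- (d $ 2), d $ 1]"

lemma rot_simps [simp]: "rot d $ 1 = - (d $ 2)" "rot d $ 2 = d $ 1"
  by (auto simp: rot_def vector_2)

lemma pt_inner: "(x::pt) \<bullet> y = x $ 1 * y $ 1 + x $ 2 * y $ 2"
  by (simp add: inner_vec_def sum_2)

lemma pt_norm_sq: "(norm (x::pt))^2 = (x $ 1)^2 + (x $ 2)^2"
  unfolding power2_norm_eq_inner pt_inner by (simp add: power2_eq_square)

lemma rot_norm_sq: "(norm (a *\<^sub>R d + b *\<^sub>R rot d))^2 = (a^2 + b^2) * (norm d)^2"
  unfolding pt_norm_sq by (simp add: power2_eq_square algebra_simps)

lemma rot_inner: "(a *\<^sub>R d + b *\<^sub>R rot d) \<bullet> d = a * (norm d)^2"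
  unfolding pt_norm_sq pt_inner by (simp add: power2_eq_square algebra_simps)

lemma rot_decompose:
  assumes "d \<noteq> 0" obtains a b where "x = a *\<^sub>R d + b *\<^sub>R rot d"
proof -
  define n where "n = (d$1)^2 + (d$2)^2"
  have n: "n \<noteq> 0" using assms pt_norm_sq[of d] by (auto simp: n_def)
  have "x = ((x$1 * d$1 + x$2 * d$2) / n) *\<^sub>R d + ((x$2 * d$1 - x$1 * d$2) / n) *\<^sub>R rot d"
    using n by (simp add: vec_eq_iff forall_2 field_simps) (simp add: n_def power2_eq_square algebra_simps)
  then show thesis by (rule that)
qed

text \<open>In the frame \<open>v - u\<close>, \<open>rot (v - u)\<close> the two angle conditions force the apex to have
  coordinates \<open>(1/2, \<plusminus> tan \<beta> / 2)\<close>.\<close>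

lemma beta_triangle_fat:
  assumes T: "has_beta_triangle \<beta> R u v" and uv: "u \<noteq> v" and b: "0 < \<beta>" "\<beta> \<le> pi / 3"
  shows "\<exists>z0. fat_at (sin \<beta> / 16) R u v z0"
proof -
  obtain w where w: "convex hull {u, v, w} \<subseteq> R" "vangle (v - u) (w - u) = \<beta>" "vangle (u - v) (w - v) = \<beta>"
    using T unfolding has_beta_triangle_def by blast
  define d where "d = v - u"
  have d: "d \<noteq> 0" using uv by (simp add: d_def)
  have nd: "norm d > 0" using d by simp
  obtain a h where ah: "w - u = a *\<^sub>R d + h *\<^sub>R rot d" using rot_decompose[OF d] by metis
  have wv: "w - v = (a - 1) *\<^sub>R d + h *\<^sub>R rot d" using ah by (simp add: d_def algebra_simps)
  have cos: "cos \<beta> \<ge> 1/2" using b cos_monotone_0_pi_le[of \<beta> "pi/3"] by (simp add: cos_60)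
  have sin: "sin \<beta> > 0" using b pi_gt_zero by (intro sin_gt_zero) auto
  have "a * (norm d)^2 = cos \<beta> * (norm d * norm (w - u))"
    using vangle_inner[OF w(2) b] rot_inner[of a d h] ah by (simp add: d_def inner_commute)
  then have e1: "a * norm d = cos \<beta> * norm (w - u)" using nd by (simp add: power2_eq_square)
  have "(w - v) \<bullet> (u - v) = (1 - a) * (norm d)^2"
  proof -
    have "(w - v) \<bullet> (u - v) = - ((w - v) \<bullet> d)" by (simp add: d_def inner_diff_right)
    also have "\<dots> = - ((a - 1) * (norm d)^2)" unfolding wv rot_inner ..
    finally show ?thesis by (simp add: algebra_simps)
  qed
  then have "(1 - a) * (norm d)^2 = cos \<beta> * (norm d * norm (w - v))"
    using vangle_inner[OF w(3) b] by (simp add: d_def inner_commute norm_minus_commute)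
  then have e2: "(1 - a) * norm d = cos \<beta> * norm (w - v)" using nd by (simp add: power2_eq_square)
  have n1: "(norm (w - u))^2 = (a^2 + h^2) * (norm d)^2" unfolding ah by (rule rot_norm_sq)
  have n2: "(norm (w - v))^2 = ((a-1)^2 + h^2) * (norm d)^2" unfolding wv by (rule rot_norm_sq)
  have "a^2 * (norm d)^2 = (cos \<beta>)^2 * ((a^2 + h^2) * (norm d)^2)"
    using e1 n1 by (metis power_mult_distrib)
  then have f1: "a^2 = (cos \<beta>)^2 * (a^2 + h^2)" using nd by simp
  have "(1-a)^2 * (norm d)^2 = (cos \<beta>)^2 * (((a-1)^2 + h^2) * (norm d)^2)"
    using e2 n2 by (metis power_mult_distrib)
  then have f2: "(1-a)^2 = (cos \<beta>)^2 * ((1-a)^2 + h^2)" using nd by (simp add: power2_commute)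
  have sc: "(cos \<beta>)^2 = 1 - (sin \<beta>)^2" by (simp add: cos_squared_eq)
  have "a^2 * (sin \<beta>)^2 + h^2 * (sin \<beta>)^2 = h^2" "(1-a)^2 * (sin \<beta>)^2 + h^2 * (sin \<beta>)^2 = h^2"
    using f1 f2 unfolding sc by (simp_all add: algebra_simps)
  then have "a^2 * (sin \<beta>)^2 = (1-a)^2 * (sin \<beta>)^2" by linarith
  then have "a^2 = (1-a)^2" using sin by simp
  then have a: "a = 1/2" by (simp add: power2_eq_square algebra_simps)
  have g: "(sin \<beta>)^2 / 4 = (cos \<beta>)^2 * h^2" using f1 unfolding a sc by (simp add: algebra_simps power2_eq_square)
  have "(cos \<beta>)^2 * h^2 \<le> 1 * h^2" by (intro mult_right_mono) (auto simp: abs_square_le_1)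
  then have "(sin \<beta> / 2)^2 \<le> h^2" using g by (simp add: power_divide)
  then have hl: "sin \<beta> / 2 \<le> \<bar>h\<bar>" using sin by (simp add: abs_le_square_iff[symmetric])
  have "(1/2)^2 * h^2 \<le> (cos \<beta>)^2 * h^2" by (intro mult_right_mono power_mono cos) auto
  also have "\<dots> \<le> 1/4" using g abs_square_le_1[of "sin \<beta>"] by simp
  finally have hu: "h^2 \<le> 1" by (simp add: power2_eq_square)
  have h0: "h \<noteq> 0" using hl sin by auto
  \<comment> \<open>The middle of the height. Relative to the base the height is at least sin
    \<beta> / 2, so a radius of sin \<beta> / 16 is at most one eighth of it; this is small enough
    to keep all barycentric coordinates in the ball nonnegative.\<close>
  define z0 where "z0 = u + (1/2) *\<^sub>R d + (h/2) *\<^sub>R rot d"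
  have w_eq: "w = u + (1/2) *\<^sub>R d + h *\<^sub>R rot d" using ah a by (simp add: algebra_simps)
  define c where "c = sin \<beta> / 16"
  have c: "c > 0" "c \<le> \<bar>h\<bar> / 8" "c \<le> 1/16" using sin hl sin_le_one[of \<beta>] by (auto simp: c_def)
  have ball: "y \<in> convex hull {u, v, w}" if y: "y \<in> ball z0 (c * dist u v)" for y
  proof -
    obtain \<alpha> \<gamma> where ag: "y - u = \<alpha> *\<^sub>R d + \<gamma> *\<^sub>R rot d" using rot_decompose[OF d] by metis
    have "y - z0 = (y - u) - ((1/2) *\<^sub>R d + (h/2) *\<^sub>R rot d)" by (simp add: z0_def)
    also have "\<dots> = (\<alpha> - 1/2) *\<^sub>R d + (\<gamma> - h/2) *\<^sub>R rot d" unfolding ag by (simp add: algebra_simps)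
    finally have "(norm (y - z0))^2 = ((\<alpha> - 1/2)^2 + (\<gamma> - h/2)^2) * (norm d)^2" by (simp add: rot_norm_sq)
    moreover have "norm (y - z0) < c * norm d" using y by (simp add: dist_norm d_def norm_minus_commute)
    then have "(norm (y - z0))^2 < (c * norm d)^2" by (intro power_strict_mono) auto
    ultimately have "((\<alpha> - 1/2)^2 + (\<gamma> - h/2)^2) * (norm d)^2 < c^2 * (norm d)^2" by (simp add: power_mult_distrib)
    then have lt: "(\<alpha> - 1/2)^2 + (\<gamma> - h/2)^2 < c^2" using nd by simp
    then have "(\<alpha> - 1/2)^2 \<le> c^2" "(\<gamma> - h/2)^2 \<le> c^2"
      using zero_le_power2[of "\<alpha> - 1/2"] zero_le_power2[of "\<gamma> - h/2"] by linarith+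
    then have al: "\<bar>\<alpha> - 1/2\<bar> \<le> 1/16" and ga: "\<bar>\<gamma> - h/2\<bar> \<le> \<bar>h\<bar>/8"
      using c abs_le_square_iff[of "\<alpha> - 1/2" c] abs_le_square_iff[of "\<gamma> - h/2" c] by auto
    define l where "l = \<gamma> / h"
    have "\<bar>l - 1/2\<bar> = \<bar>\<gamma> - h/2\<bar> / \<bar>h\<bar>" using h0 by (simp add: l_def abs_divide[symmetric] diff_divide_distrib)
    also have "\<dots> \<le> 1/8" using ga h0 by (simp add: divide_le_eq)
    finally have l: "\<bar>l - 1/2\<bar> \<le> 1/8" .
    have "y = u + (\<alpha> *\<^sub>R d + \<gamma> *\<^sub>R rot d)" using ag by (simp add: algebra_simps)
    also have "\<dots> = (1 - \<alpha> - l/2) *\<^sub>R u + (\<alpha> - l/2) *\<^sub>R v + l *\<^sub>R w"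
      using h0 unfolding w_eq d_def l_def by (simp add: vec_eq_iff forall_2 field_simps)
    finally have "y = (1 - \<alpha> - l/2) *\<^sub>R u + (\<alpha> - l/2) *\<^sub>R v + l *\<^sub>R w" .
    moreover have "0 \<le> 1 - \<alpha> - l/2" "0 \<le> \<alpha> - l/2" "0 \<le> l" "(1 - \<alpha> - l/2) + (\<alpha> - l/2) + l = 1"
      using al l unfolding abs_le_iff by linarith+
    ultimately show ?thesis unfolding convex_hull_3 by blast
  qed
  show ?thesis unfolding fat_at_def c_def[symmetric]
  proof (intro exI[of _ z0] conjI ballI uv)
    fix z assume z: "z \<in> closed_segment u v"
    then obtain t where t: "0 \<le> t" "t \<le> 1" "z = (1 - t) *\<^sub>R u + t *\<^sub>R v" by (auto simp: in_segment)
    have "z - z0 = (t - 1/2) *\<^sub>R d + (-h/2) *\<^sub>R rot d" unfolding t z0_def d_def by (simp add: algebra_simps)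
    then have "(norm (z - z0))^2 = ((t - 1/2)^2 + (-h/2)^2) * (norm d)^2" by (simp only: rot_norm_sq)
    also have "\<dots> \<le> 1 * (norm d)^2"
    proof (rule mult_right_mono)
      have "(t - 1/2)^2 \<le> (1/2)^2" 
      proof -
        have "\<bar>t - 1/2\<bar> \<le> \<bar>1/2\<bar>" using t by (simp only: abs_le_iff) linarith
        then show ?thesis by (simp only: abs_le_square_iff)
      qed
      then show "(t - 1/2)^2 + (-h/2)^2 \<le> 1" using hu by (simp add: power_divide)
    qed auto
    finally show "dist z z0 \<le> dist u v" by (simp add: dist_norm d_def norm_minus_commute)
    have zh: "z \<in> convex hull {u, v, w}"
    proof -
      have "closed_segment u v \<subseteq> convex hull {u, v, w}" unfolding segment_convex_hull by (rule hull_mono) auto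
      then show ?thesis using z by auto
    qed
    fix \<theta> :: real assume th: "\<theta> \<in> {0..1}"
    show "ball (z + \<theta> *\<^sub>R (z0 - z)) (\<theta> * (c * dist u v)) \<subseteq> R"
    proof
      fix y assume y: "y \<in> ball (z + \<theta> *\<^sub>R (z0 - z)) (\<theta> * (c * dist u v))"
      have "\<theta> \<noteq> 0" using y by (auto simp: ball_def)
      then have tp: "\<theta> > 0" using th by auto
      \<comment> \<open>A point of the shrunken ball lies on a segment from \<open>z\<close> to a
        point of the full ball, so convexity of the triangle suffices.\<close>
      define y' where "y' = z0 + (1/\<theta>) *\<^sub>R (y - (z + \<theta> *\<^sub>R (z0 - z)))"
      have "dist z0 y' = dist (z + \<theta> *\<^sub>R (z0 - z)) y / \<theta>"
        using tp by (simp add: y'_def dist_norm norm_minus_commute divide_inverse mult_ac)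
      also have "\<dots> < c * dist u v" using y tp by (simp add: divide_less_eq mult_ac)
      finally have "y' \<in> convex hull {u, v, w}" using ball by auto
      moreover have "y = (1 - \<theta>) *\<^sub>R z + \<theta> *\<^sub>R y'" using tp by (simp add: y'_def algebra_simps)
      ultimately have "y \<in> convex hull {u, v, w}"
        using zh th by (auto intro!: convexD_alt[OF convex_convex_hull])
      then show "y \<in> R" using w by auto
    qed
  qed
qed

section \<open>Segments parametrised along a line\<close>

lemma line_point_in_segment:
  fixes a b :: pt
  assumes "x \<in> closed_segment (a + s *\<^sub>R (b - a)) (a + e *\<^sub>R (b - a))" "s \<le> e"
  obtains t where "s \<le> t" "t \<le> e" "x = a + t *\<^sub>R (b - a)"
proof -
  obtain l where l: "0 \<le> l" "l \<le> 1" "x = (1 - l) *\<^sub>R (a + s *\<^sub>R (b - a)) + l *\<^sub>R (a + e *\<^sub>R (b - a))"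
    using assms(1) unfolding in_segment by blast
  have "x = a + (s + l * (e - s)) *\<^sub>R (b - a)" unfolding l(3) by (simp add: algebra_simps)
  moreover have "l * (e - s) \<le> 1 * (e - s)" using l assms(2) by (intro mult_right_mono) auto
  moreover have "0 \<le> l * (e - s)" using l assms(2) by simp
  ultimately show thesis using that[of "s + l * (e - s)"] by simp
qed

lemma segment_point_on_line:
  fixes a b :: pt
  assumes "s \<le> t" "t \<le> e"
  shows "a + t *\<^sub>R (b - a) \<in> closed_segment (a + s *\<^sub>R (b - a)) (a + e *\<^sub>R (b - a))"
proof (cases "s = e")
  case False
  define l where "l = (t - s) / (e - s)"
  have l: "0 \<le> l" "l \<le> 1" "l * (e - s) = t - s" using assms False by (auto simp: l_def divide_le_eq)
  have "a + t *\<^sub>R (b - a) = a + (s + l * (e - s)) *\<^sub>R (b - a)" using l by simp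
  also have "\<dots> = (1 - l) *\<^sub>R (a + s *\<^sub>R (b - a)) + l *\<^sub>R (a + e *\<^sub>R (b - a))"
    by (simp add: algebra_simps)
  finally show ?thesis using l unfolding in_segment by blast
qed (use assms in auto)

lemma in_segment_line:
  fixes a b :: pt
  shows "x \<in> closed_segment a b \<longleftrightarrow> (\<exists>t. 0 \<le> t \<and> t \<le> 1 \<and> x = a + t *\<^sub>R (b - a))"
  unfolding in_segment by (auto simp: algebra_simps)

lemma convex_line_vimage:
  fixes a d :: pt
  assumes "convex S"
  shows "convex ((\<lambda>t. a + t *\<^sub>R d) -` S)"
proof (rule convexI)
  fix x y u v :: real
  assume h: "x \<in> (\<lambda>t. a + t *\<^sub>R d) -` S" "y \<in> (\<lambda>t. a + t *\<^sub>R d) -` S" "0 \<le> u" "0 \<le> v" "u + v = 1"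
  have "u *\<^sub>R a + v *\<^sub>R a = a" using h by (simp flip: scaleR_add_left)
  then have "a + (u *\<^sub>R x + v *\<^sub>R y) *\<^sub>R d = u *\<^sub>R (a + x *\<^sub>R d) + v *\<^sub>R (a + y *\<^sub>R d)"
    by (simp add: algebra_simps)
  then show "u *\<^sub>R x + v *\<^sub>R y \<in> (\<lambda>t. a + t *\<^sub>R d) -` S" using h convexD[OF assms] by auto
qed

lemma segment_subset_closed:
  fixes a b :: pt
  assumes "closed F" "s < e" "\<And>t. s < t \<Longrightarrow> t < e \<Longrightarrow> a + t *\<^sub>R (b - a) \<in> F"
  shows "closed_segment (a + s *\<^sub>R (b - a)) (a + e *\<^sub>R (b - a)) \<subseteq> F"
proof
  fix x assume "x \<in> closed_segment (a + s *\<^sub>R (b - a)) (a + e *\<^sub>R (b - a))"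
  then obtain t where t: "s \<le> t" "t \<le> e" "x = a + t *\<^sub>R (b - a)"
    using line_point_in_segment assms(2) by (metis less_imp_le)
  have "(\<lambda>t. a + t *\<^sub>R (b - a)) ` closure {s<..<e} \<subseteq> F"
    by (intro image_closure_subset continuous_intros assms(1)) (use assms(3) in auto)
  then show "x \<in> F" using t assms(2) by (auto simp: closure_greaterThanLessThan image_subset_iff)
qed

text \<open>The supporting line of \<open>Q1\<close> at \<open>z\<close> must contain the chord.
  Points of \<open>Q1\<close> close to \<open>z\<close> then lie in the triangle spanned by the
  chord and an interior point \<open>w\<close> of \<open>Q2\<close>, hence in \<open>Q2\<close>, and
  the difference stays away from \<open>z\<close>. This is why the part of an outer edge covered by
  \<open>Q2\<close> disappears from the ring.\<close>

lemma boundary_chord_not_in_closure_diff: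
  fixes Q1 Q2 :: "pt set"
  assumes "convex Q1" "convex Q2" "Q2 \<subseteq> Q1" and w: "w \<in> interior Q2"
    and pq: "p \<in> Q2" "q \<in> Q2" "z \<in> open_segment p q" "z \<in> frontier Q1"
  shows "z \<notin> closure (Q1 - Q2)"
proof -
  define d where "d = q - p"
  obtain t where t: "0 < t" "t < 1" and zt: "z = p + t *\<^sub>R d" and pnq: "p \<noteq> q"
    using pq(3) by (auto simp: in_segment d_def algebra_simps)
  have d: "d \<noteq> 0" using pnq by (simp add: d_def)
  have "z \<in> closure Q1" "z \<notin> rel_interior Q1"
    using pq(4) w assms(3) interior_mono[OF assms(3)] rel_interior_nonempty_interior[of Q1]
    by (auto simp: frontier_def)
  then obtain m where m: "m \<noteq> 0" "\<And>y. y \<in> closure Q1 \<Longrightarrow> m \<bullet> z \<le> m \<bullet> y"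
    using supporting_hyperplane_relative_frontier[OF assms(1)] by metis
  have mQ: "m \<bullet> z \<le> m \<bullet> y" if "y \<in> Q1" for y using m(2) that closure_subset by blast
  have "0 \<le> - t * (m \<bullet> d)" using mQ[of p] pq assms(3) zt by (auto simp: inner_add_right)
  moreover have "m \<bullet> q = m \<bullet> z + (1 - t) * (m \<bullet> d)" unfolding zt d_def by (simp add: algebra_simps)
  then have "0 \<le> (1 - t) * (m \<bullet> d)" using mQ[of q] pq assms(3) by auto
  ultimately have md: "m \<bullet> d = 0" using t by (auto simp: zero_le_mult_iff mult_le_0_iff)
  obtain \<epsilon> where e: "\<epsilon> > 0" "cball w \<epsilon> \<subseteq> Q2" using w unfolding mem_interior_cball by blast
  define w' where "w' = w - (\<epsilon> / norm m) *\<^sub>R m"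
  have "w' \<in> cball w \<epsilon>" using e m(1) by (simp add: w'_def dist_norm)
  then have "m \<bullet> z \<le> m \<bullet> w'" using mQ e assms(3) by blast
  moreover have "m \<bullet> w' < m \<bullet> w" using e m(1) by (simp add: w'_def inner_diff_right)
  ultimately have mw: "0 < m \<bullet> (w - z)" by (simp add: inner_diff_right)
  \<comment> \<open>Oblique coordinates at \<open>z\<close>: \<open>f\<close> measures the distance
    from the supporting line in units of that of \<open>w\<close>, and \<open>g\<close> is the
    remaining coordinate along the chord, so that
    \<open>x = z + f x *\<^sub>R (w - z) + g x *\<^sub>R d\<close>.\<close>
  define f where "f x = m \<bullet> (x - z) / (m \<bullet> (w - z))" for x
  define g where "g x = ((x - z - f x *\<^sub>R (w - z)) \<bullet> d) / (d \<bullet> d)" for x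
  define \<delta> where "\<delta> = min t (1 - t)"
  have dl: "\<delta> > 0" using t by (simp add: \<delta>_def)
  have "isCont f z" unfolding f_def using mw by (intro continuous_intros) auto
  moreover from this have "isCont g z" unfolding g_def using d by (intro continuous_intros) auto
  ultimately have lim: "(f \<longlongrightarrow> f z) (nhds z)" "(g \<longlongrightarrow> g z) (nhds z)"
    by (auto simp: continuous_at_imp_continuous_within tendsto_at_iff_tendsto_nhds[symmetric] isCont_def)
  have z0: "f z = 0" "g z = 0" by (auto simp: f_def g_def)
  have "\<forall>\<^sub>F x in nhds z. f x < 1/2" using lim(1) z0 by (intro order_tendstoD(2)) auto
  moreover have "\<forall>\<^sub>F x in nhds z. g x < \<delta> / 2" using lim(2) z0 dl by (intro order_tendstoD(2)) auto
  moreover have "\<forall>\<^sub>F x in nhds z. g x > - \<delta> / 2" using lim(2) z0 dl by (intro order_tendstoD(1)) auto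
  ultimately have "\<forall>\<^sub>F x in nhds z. f x < 1/2 \<and> \<bar>g x\<bar> < \<delta> / 2"
    by eventually_elim auto
  then obtain U where U: "open U" "z \<in> U" "\<And>x. x \<in> U \<Longrightarrow> f x < 1/2 \<and> \<bar>g x\<bar> < \<delta> / 2"
    unfolding eventually_nhds by blast
  have "x \<in> Q2" if x: "x \<in> U" "x \<in> Q1" for x
  proof -
    have fx: "0 \<le> f x" "f x < 1/2" and gx: "\<bar>g x\<bar> < \<delta> / 2"
      using U(3)[OF x(1)] mQ[OF x(2)] mw by (auto simp: f_def inner_diff_right)
    define y where "y = x - z - f x *\<^sub>R (w - z)"
    have "m \<bullet> y = 0" using mw by (simp add: y_def f_def inner_diff_right)
    obtain a b where ab: "y = a *\<^sub>R d + b *\<^sub>R rot d" using rot_decompose[OF d] by metis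
    obtain a' b' where ab': "m = a' *\<^sub>R d + b' *\<^sub>R rot d" using rot_decompose[OF d] by metis
    have "a' = 0" using md d unfolding ab' rot_inner by simp
    then have mb: "m = b' *\<^sub>R rot d" "b' \<noteq> 0" using ab' m(1) by auto
    have rd: "rot d \<bullet> rot d = d \<bullet> d" "rot d \<bullet> d = 0" "rot d \<noteq> 0"
      using d by (auto simp: pt_inner vec_eq_iff forall_2)
    have "b = 0" using \<open>m \<bullet> y = 0\<close> mb rd d unfolding ab by (simp add: inner_add_right)
    then have yd: "y = a *\<^sub>R d" using ab by simp
    have "g x = (y \<bullet> d) / (d \<bullet> d)" unfolding g_def y_def ..
    also have "\<dots> = a" using d by (simp add: yd)
    finally have y: "y = g x *\<^sub>R d" using yd by simp
    \<comment> \<open>The line from \<open>w\<close> through \<open>x\<close> meets the chord at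
      parameter \<open>t + s\<close>. The bounds 1/2 on \<open>f\<close> and \<delta> / 2 on
      \<open>g\<close> keep this parameter between 0 and 1.\<close>
    define s where "s = g x / (1 - f x)"
    have "\<bar>s\<bar> = \<bar>g x\<bar> / (1 - f x)" using fx by (simp add: s_def abs_divide)
    also have "\<dots> \<le> \<bar>g x\<bar> / (1/2)" using fx by (intro divide_left_mono) auto
    also have "\<dots> < \<delta>" using gx by simp
    finally have s: "0 \<le> t + s" "t + s \<le> 1" unfolding \<delta>_def by (auto simp: abs_less_iff)
    have "p + (t + s) *\<^sub>R d = (1 - (t + s)) *\<^sub>R p + (t + s) *\<^sub>R q" by (simp add: d_def algebra_simps)
    then have 1: "p + (t + s) *\<^sub>R d \<in> Q2"
      using s pq by (auto intro!: convexD_alt[OF assms(2)])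
    have "(1 - f x) *\<^sub>R (s *\<^sub>R d) = y" using fx by (simp add: y s_def)
    then have "x = (1 - f x) *\<^sub>R (p + (t + s) *\<^sub>R d) + f x *\<^sub>R w"
      unfolding y_def by (simp add: zt algebra_simps)
    moreover have "w \<in> Q2" using w interior_subset by blast
    ultimately show "x \<in> Q2"
      using fx 1 convexD_alt[OF assms(2), of "p + (t + s) *\<^sub>R d" w "f x"] by simp
  qed
  then have "U \<inter> (Q1 - Q2) = {}" by blast
  then show ?thesis using U open_Int_closure_eq_empty by blast
qed

section \<open>The boundary of a difference of compact convex sets\<close>

locale convex_diff =
  fixes Q1 Q2 R :: "pt set"
  assumes Q1: "compact Q1" "convex Q1" "interior Q1 \<noteq> {}"
    and Q2: "compact Q2" "convex Q2" "Q2 \<noteq> {} \<Longrightarrow> interior Q2 \<noteq> {}" "Q2 \<subseteq> Q1"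
    and R: "R = closure (Q1 - Q2)"
begin

lemma R_subset: "R \<subseteq> Q1"
  unfolding R using Q1(1) by (intro closure_minimal compact_imp_closed) auto

lemma compact_R: "compact R"
  using R_subset Q1(1) R by (metis bounded_subset closed_closure compact_eq_bounded_closed)

lemma R_disjoint: "R \<inter> interior Q2 = {}"
  unfolding R using open_Int_closure_eq_empty[OF open_interior, of Q2 "Q1 - Q2"] interior_subset[of Q2] by blast

lemma interior_R_subset: "interior R \<subseteq> interior Q1"
  by (rule interior_mono[OF R_subset])

text \<open>\<open>Q1\<close> is the closure of its interior, and removing the closed set
  \<open>Q2\<close> preserves this near every point outside \<open>Q2\<close>. The property is what
  carries derivatives to boundary points and forces distinct rings to meet only along their
  frontiers.\<close>

lemma R_regular: "R \<subseteq> closure (interior R)"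
proof -
  have op: "open (interior Q1 - Q2)" using Q2(1) by (intro open_Diff compact_imp_closed) auto
  have "interior Q1 - Q2 \<subseteq> R" unfolding R using interior_subset closure_subset by blast
  then have 1: "interior Q1 - Q2 \<subseteq> interior R" using op by (rule interior_maximal)
  have "Q1 - Q2 \<subseteq> closure (interior Q1 - Q2)"
  proof
    fix x assume x: "x \<in> Q1 - Q2"
    have "x \<in> closure (interior Q1)"
      using convex_closure_interior[OF Q1(2,3)] closure_subset x by blast
    moreover have "x \<in> - Q2" "open (- Q2)" using x Q2(1) compact_imp_closed by auto
    ultimately have "x \<in> closure (- Q2 \<inter> interior Q1)"
      using open_Int_closure_subset[of "- Q2" "interior Q1"] by blast
    then show "x \<in> closure (interior Q1 - Q2)" by (simp add: Diff_eq Int_commute)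
  qed
  then have "R \<subseteq> closure (interior Q1 - Q2)" unfolding R by (intro closure_minimal) auto
  then show ?thesis using closure_mono[OF 1] by blast
qed

text \<open>The second alternative is restricted to \<open>interior Q1\<close> because there
  \<open>in_frontier_R_inner\<close> guarantees that boundary points of \<open>Q2\<close> belong to
  the frontier of the ring.\<close>

lemma frontier_R_cases:
  assumes "z \<in> frontier R"
  shows "z \<in> frontier Q1 \<or> z \<in> frontier Q2 \<inter> interior Q1"
proof -
  have z: "z \<in> R" "z \<notin> interior R" using assms compact_imp_closed[OF compact_R] by (auto simp: frontier_def closure_closed)
  then have zQ: "z \<in> Q1" using R_subset by auto
  have cl: "closure Q1 = Q1" "closure Q2 = Q2" using Q1 Q2 by (auto simp: compact_imp_closed closure_closed)
  show ?thesis
  proof (cases "z \<in> interior Q1")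
    case True
    have "z \<in> Q2"
    proof (rule ccontr)
      assume "z \<notin> Q2"
      moreover have "open (interior Q1 - Q2)" using Q2(1) by (intro open_Diff compact_imp_closed) auto
      moreover have "interior Q1 - Q2 \<subseteq> R" unfolding R using interior_subset closure_subset by blast
      ultimately show False using z(2) True interior_maximal by blast
    qed
    moreover have "z \<notin> interior Q2" using z R_disjoint by auto
    ultimately show ?thesis using True cl by (auto simp: frontier_def)
  next
    case False
    then show ?thesis using zQ cl by (auto simp: frontier_def)
  qed
qed

lemma in_frontier_R_outer: "z \<in> frontier Q1 \<Longrightarrow> z \<in> R \<Longrightarrow> z \<in> frontier R"
  using interior_R_subset closure_subset by (auto simp: frontier_def)

lemma in_frontier_R_inner:
  assumes "z \<in> frontier Q2" "z \<in> interior Q1"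
  shows "z \<in> frontier R"
proof -
  have "Q2 \<noteq> {}" using assms(1) by auto
  then have ne: "interior Q2 \<noteq> {}" by (rule Q2(3))
  have "z \<in> closure (- Q2)" using assms(1) by (auto simp: frontier_closures)
  then have "z \<in> closure (interior Q1 \<inter> - Q2)"
    using assms(2) open_Int_closure_subset[OF open_interior, of Q1 "- Q2"] by blast
  moreover have "interior Q1 \<inter> - Q2 \<subseteq> Q1 - Q2" using interior_subset by auto
  ultimately have zR: "z \<in> R" unfolding R using closure_mono by blast
  have "z \<notin> interior R"
  proof
    assume zi: "z \<in> interior R"
    have "z \<in> closure (interior Q2)"
      using assms(1) convex_closure_interior[OF Q2(2) ne] by (auto simp: frontier_def)
    then have "interior R \<inter> interior Q2 \<noteq> {}"
      using zi open_Int_closure_eq_empty[OF open_interior] by blast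
    then show False using R_disjoint interior_subset by blast
  qed
  then show ?thesis using zR closure_subset by (auto simp: frontier_def)
qed

text \<open>By convexity \<open>Q2\<close> meets the edge in an interval. What lies outside it stays
  in the frontier and forms at most two segments, while the open part between its ends is removed by
  \<open>boundary_chord_not_in_closure_diff\<close>. The ends go into \<open>X\<close>, since an end
  that coincides with an end of the edge borders no remaining segment on that side.\<close>

lemma outer_edge_cover:
  assumes ab: "closed_segment a b \<subseteq> frontier Q1"
  shows "\<exists>T X. finite T \<and> card T \<le> 2 \<and> finite X \<and> card X \<le> 2 \<and>
    (\<forall>(u, v)\<in>T. u \<noteq> v \<and> closed_segment u v \<subseteq> frontier R) \<and>
    closed_segment a b \<inter> frontier R \<subseteq> (\<Union>(u, v)\<in>T. closed_segment u v) \<union> X"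
proof (cases "a = b")
  case True
  then show ?thesis by (intro exI[of _ "{}"] exI[of _ "{a}"]) auto
next
  case ne: False
  define g where "g t = a + t *\<^sub>R (b - a)" for t
  have g01: "g 0 = a" "g 1 = b" by (auto simp: g_def)
  have inj: "g t \<noteq> g t'" if "t \<noteq> t'" for t t' using ne that by (simp add: g_def)
  have seg: "x \<in> closed_segment a b \<longleftrightarrow> (\<exists>t. 0 \<le> t \<and> t \<le> 1 \<and> x = g t)" for x
    unfolding g_def by (rule in_segment_line)
  then have gseg: "g t \<in> closed_segment a b" if "0 \<le> t" "t \<le> 1" for t using that by blast
  have clF: "closed (frontier R)" by simp
  define J where "J = {0..1} \<inter> g -` Q2"
  have "closed (g -` Q2)" unfolding g_def using Q2(1)
    by (intro continuous_closed_vimage compact_imp_closed) (auto intro!: continuous_intros)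
  then have cJ: "compact J" unfolding J_def by (intro compact_Int_closed) auto
  have "convex (g -` Q2)" unfolding g_def by (intro convex_line_vimage Q2(2))
  then have "connected J" unfolding J_def by (intro convex_connected convex_Int) auto
  then obtain t1 t2 where J: "J = {t1..t2}" using cJ connected_compact_interval_1 by metis
  have out: "g t \<in> frontier R" if "0 \<le> t" "t \<le> 1" "t \<notin> J" for t
  proof -
    have 1: "g t \<in> frontier Q1" using gseg that ab by auto
    then have "g t \<in> Q1" using Q1(1) compact_imp_closed frontier_subset_closed by blast
    moreover have "g t \<notin> Q2" using that by (auto simp: J_def)
    ultimately have "g t \<in> Q1 - Q2" by blast
    then have "g t \<in> R" unfolding R by (rule closure_subset[THEN subsetD])
    then show ?thesis using 1 in_frontier_R_outer by auto
  qed
  show ?thesis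
  proof (cases "J = {}")
    case True
    have "closed_segment (a + 0 *\<^sub>R (b - a)) (a + 1 *\<^sub>R (b - a)) \<subseteq> frontier R"
      using True by (intro segment_subset_closed[OF clF] out[unfolded g_def]) auto
    then show ?thesis using ne by (intro exI[of _ "{(a, b)}"] exI[of _ "{}"]) auto
  next
    case False
    then have "t1 \<le> t2" using J by auto
    then have "t1 \<in> J" "t2 \<in> J" unfolding J by auto
    then have t12: "0 \<le> t1" "t1 \<le> t2" "t2 \<le> 1" "g t1 \<in> Q2" "g t2 \<in> Q2"
      using \<open>t1 \<le> t2\<close> unfolding J_def by auto
    from t12 have "Q2 \<noteq> {}" by blast
    then obtain w where w: "w \<in> interior Q2" using Q2(3) by blast
    define T where "T = (if 0 < t1 then {(a, g t1)} else {}) \<union> (if t2 < 1 then {(g t2, b)} else {})"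
    have s1: "closed_segment a (g t1) \<subseteq> frontier R" if "0 < t1"
    proof -
      have "closed_segment (a + 0 *\<^sub>R (b - a)) (a + t1 *\<^sub>R (b - a)) \<subseteq> frontier R"
        using t12 J by (intro segment_subset_closed[OF clF that] out[unfolded g_def]) auto
      then show ?thesis by (simp add: g_def)
    qed
    have s2: "closed_segment (g t2) b \<subseteq> frontier R" if "t2 < 1"
    proof -
      have "closed_segment (a + t2 *\<^sub>R (b - a)) (a + 1 *\<^sub>R (b - a)) \<subseteq> frontier R"
        using t12 J by (intro segment_subset_closed[OF clF that] out[unfolded g_def]) auto
      then show ?thesis by (simp add: g_def)
    qed
    have cov: "closed_segment a b \<inter> frontier R \<subseteq> (\<Union>(u, v)\<in>T. closed_segment u v) \<union> {g t1, g t2}"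
    proof
      fix x assume x: "x \<in> closed_segment a b \<inter> frontier R"
      then obtain t where t: "0 \<le> t" "t \<le> 1" "x = g t" using seg by auto
      consider "t < t1" | "t = t1" | "t1 < t" "t < t2" | "t = t2" | "t2 < t" by linarith
      then show "x \<in> (\<Union>(u, v)\<in>T. closed_segment u v) \<union> {g t1, g t2}"
      proof cases
        case 1
        then have "x \<in> closed_segment a (g t1)"
          using t segment_point_on_line[of 0 t t1 a b] by (simp add: g_def)
        then show ?thesis using 1 t by (auto simp: T_def)
      next
        case 3
        have "g t \<in> closed_segment (g t1) (g t2)"
          using 3 segment_point_on_line[of t1 t t2 a b] by (simp add: g_def)
        then have "g t \<in> open_segment (g t1) (g t2)" using 3 inj by (auto simp: open_segment_def)
        then have "g t \<notin> R" unfolding R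
          using t12 w x t ab by (intro boundary_chord_not_in_closure_diff[OF Q1(2) Q2(2,4) w]) auto
        then show ?thesis using x t compact_R compact_imp_closed frontier_subset_closed by blast
      next
        case 5
        then have "x \<in> closed_segment (g t2) b"
          using t segment_point_on_line[of t2 t 1 a b] by (simp add: g_def)
        then show ?thesis using 5 t by (auto simp: T_def)
      qed (use t in auto)
    qed
    show ?thesis
    proof (intro exI[of _ T] exI[of _ "{g t1, g t2}"] conjI cov)
      show "finite T" by (simp add: T_def)
      show "card T \<le> 2" unfolding T_def by (intro order_trans[OF card_Un_le]) auto
      show "card {g t1, g t2} \<le> 2" by (simp add: card_insert_le_m1)
      show "\<forall>(u, v)\<in>T. u \<noteq> v \<and> closed_segment u v \<subseteq> frontier R"
        using s1 s2 inj[of 0 t1] inj[of t2 1] g01 by (auto simp: T_def split: if_splits)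
    qed auto
  qed
qed

text \<open>One segment is enough: the convex set \<open>interior Q1\<close> cuts the edge in a
  single interval, and its closure remains in the closed frontier of \<open>R\<close>. If this
  closure has no length, at most one point is left and goes into \<open>X\<close>.\<close>

lemma inner_edge_cover:
  assumes ab: "closed_segment a b \<subseteq> frontier Q2"
  shows "\<exists>T X. finite T \<and> card T \<le> 1 \<and> finite X \<and> card X \<le> 1 \<and>
    (\<forall>(u, v)\<in>T. u \<noteq> v \<and> closed_segment u v \<subseteq> frontier R) \<and>
    closed_segment a b \<inter> interior Q1 \<subseteq> (\<Union>(u, v)\<in>T. closed_segment u v) \<union> X"
proof (cases "a = b")
  case True
  then show ?thesis by (intro exI[of _ "{}"] exI[of _ "{a}"]) auto
next
  case ne: False
  define g where "g t = a + t *\<^sub>R (b - a)" for t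
  have inj: "g t \<noteq> g t'" if "t \<noteq> t'" for t t' using ne that by (simp add: g_def)
  have seg: "x \<in> closed_segment a b \<longleftrightarrow> (\<exists>t. 0 \<le> t \<and> t \<le> 1 \<and> x = g t)" for x
    unfolding g_def by (rule in_segment_line)
  then have gseg: "g t \<in> closed_segment a b" if "0 \<le> t" "t \<le> 1" for t using that by blast
  define J where "J = {0..1} \<inter> g -` interior Q1"
  have "convex (g -` interior Q1)" unfolding g_def by (intro convex_line_vimage convex_interior Q1(2))
  then have cv: "convex J" unfolding J_def by (intro convex_Int) auto
  have "bounded J" unfolding J_def by (intro bounded_Int) auto
  then have "compact (closure J)" "connected (closure J)"
    using convex_connected[OF convex_closure[OF cv]] by (auto simp: compact_closure)
  then obtain t1 t2 where J: "closure J = {t1..t2}" using connected_compact_interval_1 by metis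
  have inJ: "g t \<in> frontier R" if "t \<in> J" for t
    using that gseg ab by (intro in_frontier_R_inner) (auto simp: J_def)
  show ?thesis
  proof (cases "t1 < t2")
    case True
    have "closed_segment (a + t1 *\<^sub>R (b - a)) (a + t2 *\<^sub>R (b - a)) \<subseteq> frontier R"
    proof
      fix x assume "x \<in> closed_segment (a + t1 *\<^sub>R (b - a)) (a + t2 *\<^sub>R (b - a))"
      then obtain t where t: "t1 \<le> t" "t \<le> t2" "x = g t"
        using line_point_in_segment True unfolding g_def by (metis less_imp_le)
      have "g ` closure J \<subseteq> frontier R" unfolding g_def
        by (intro image_closure_subset continuous_intros) (use inJ in \<open>auto simp: g_def\<close>)
      then show "x \<in> frontier R" using t J by auto
    qed
    moreover have "closed_segment a b \<inter> interior Q1 \<subseteq> closed_segment (g t1) (g t2)"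
    proof
      fix x assume x: "x \<in> closed_segment a b \<inter> interior Q1"
      then obtain t where t: "0 \<le> t" "t \<le> 1" "x = g t" using seg by auto
      then have "t \<in> J" using x by (auto simp: J_def)
      then have "t \<in> closure J" using closure_subset by blast
      then show "x \<in> closed_segment (g t1) (g t2)" using J t segment_point_on_line[of t1 t t2 a b] by (simp add: g_def)
    qed
    ultimately show ?thesis using inj[of t1 t2] True
      by (intro exI[of _ "{(g t1, g t2)}"] exI[of _ "{}"]) (auto simp: g_def)
  next
    case False
    have "closed_segment a b \<inter> interior Q1 \<subseteq> {g t1}"
    proof
      fix x assume x: "x \<in> closed_segment a b \<inter> interior Q1"
      then obtain t where t: "0 \<le> t" "t \<le> 1" "x = g t" using seg by auto
      then have "t \<in> J" using x by (auto simp: J_def)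
      then have "t \<in> closure J" using closure_subset by blast
      then have "t = t1" using J False by auto
      then show "x \<in> {g t1}" using t by simp
    qed
    then show ?thesis by (intro exI[of _ "{}"] exI[of _ "{g t1}"]) auto
  qed
qed

end

text \<open>The ring condition supplies triangles over maximal frontier segments only, whereas the
  covers produce arbitrary ones. The maximal extension is the connected component of 0 among the
  parameters at which the line through \<open>a\<close> and \<open>b\<close> runs in the frontier;
  compactness of \<open>R\<close> makes it a compact interval.\<close>

lemma maximal_edge_exists:
  fixes a b :: pt
  assumes R: "compact R" and ab: "a \<noteq> b" "closed_segment a b \<subseteq> frontier R"
  obtains a' b' where "is_edge R a' b'" "closed_segment a b \<subseteq> closed_segment a' b'"
proof -
  define g where "g t = a + t *\<^sub>R (b - a)" for t
  have g01: "g 0 = a" "g 1 = b" by (auto simp: g_def)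
  have inj: "g t = g t' \<longleftrightarrow> t = t'" for t t' using ab by (simp add: g_def)
  define L where "L = g -` frontier R"
  have clL: "closed L" unfolding L_def g_def
    by (intro continuous_closed_vimage) (auto intro!: continuous_intros)
  have "bounded (frontier R)" using R compact_frontier compact_imp_bounded by blast
  then obtain B where B: "\<And>x. x \<in> frontier R \<Longrightarrow> norm x \<le> B" unfolding bounded_iff by blast
  have "\<bar>t\<bar> \<le> (B + norm a) / norm (b - a)" if "t \<in> L" for t
  proof -
    have "norm (t *\<^sub>R (b - a)) = norm (g t - a)" by (simp add: g_def)
    also have "\<dots> \<le> norm (g t) + norm a" by (rule norm_triangle_ineq4)
    also have "\<dots> \<le> B + norm a" using B that by (auto simp: L_def)
    finally show ?thesis using ab by (simp add: le_divide_eq)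
  qed
  then have bL: "bounded L" unfolding bounded_iff by (metis real_norm_def)
  define C where "C = connected_component_set L 0"
  have "compact C" "connected C"
    using clL bL closed_connected_component bounded_subset[OF bL connected_component_subset]
    by (auto simp: C_def compact_eq_bounded_closed)
  then obtain t1 t2 where C: "C = {t1..t2}" using connected_compact_interval_1 by metis
  have seg: "x \<in> closed_segment (g s) (g e) \<longleftrightarrow> (\<exists>t\<in>{s..e}. x = g t)" if "s \<le> e" for s e x
    using line_point_in_segment[of x a s b e] segment_point_on_line[of s _ e a b] that
    unfolding g_def by (metis atLeastAtMost_iff)
  have sub: "I \<subseteq> C" if "connected I" "0 \<in> I" "I \<subseteq> L" for I
    unfolding C_def using that by (intro connected_component_maximal)
  have "{0..1} \<subseteq> C"
    using ab(2) seg[of 0 1] g01 by (intro sub) (auto simp: L_def)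
  then have t: "t1 \<le> 0" "1 \<le> t2" unfolding C by auto
  have CL: "C \<subseteq> L" unfolding C_def by (rule connected_component_subset)
  have "is_edge R (g t1) (g t2)" unfolding is_edge_def
  proof (intro conjI allI impI)
    show "g t1 \<noteq> g t2" using t inj by auto
    show "closed_segment (g t1) (g t2) \<subseteq> frontier R"
      using CL seg[of t1 t2] t by (auto simp: C L_def)
    fix c d assume cd: "closed_segment (g t1) (g t2) \<subseteq> closed_segment c d \<and> closed_segment c d \<subseteq> frontier R"
    have "a \<in> closed_segment (g t1) (g t2)" "b \<in> closed_segment (g t1) (g t2)"
      using seg[of t1 t2] t g01 by (metis atLeastAtMost_iff order_trans zero_le_one)+
    then have "a \<in> closed_segment c d" "b \<in> closed_segment c d" using cd by auto
    \<comment> \<open>A segment containing the distinct points \<open>a\<close> and \<open>b\<close>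
      lies on their line, so \<open>c\<close> and \<open>d\<close> have parameters there. Their
      order is unknown, hence the minimum and maximum below.\<close>
    then have "a \<in> closed_segment (c + 0 *\<^sub>R (d - c)) (c + 1 *\<^sub>R (d - c))"
      "b \<in> closed_segment (c + 0 *\<^sub>R (d - c)) (c + 1 *\<^sub>R (d - c))" by simp_all
    then obtain x y where x: "a = c + x *\<^sub>R (d - c)" and y: "b = c + y *\<^sub>R (d - c)"
      using line_point_in_segment zero_le_one by metis
    have xy: "x \<noteq> y" using x y ab by auto
    have "b - a = (y - x) *\<^sub>R (d - c)" by (subst x, subst y) (simp add: algebra_simps)
    then have dc: "d - c = (1 / (y - x)) *\<^sub>R (b - a)" using xy by simp
    have "c = a - x *\<^sub>R (d - c)" by (subst x) simp
    then have c: "c = g (- x / (y - x))" unfolding dc g_def by simp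
    have "d = c + (d - c)" by simp
    then have "d = c + (1 / (y - x)) *\<^sub>R (b - a)" unfolding dc .
    then have "d = g (- x / (y - x)) + (1 / (y - x)) *\<^sub>R (b - a)" by (subst (asm) c)
    then have "d = g (- x / (y - x) + 1 / (y - x))" unfolding g_def by (simp only: scaleR_add_left add.assoc)
    then obtain s e where se: "c = g s" "d = g e" using c by metis
    define m M where "m = min s e" and "M = max s e"
    have mM: "m \<le> M" "closed_segment c d = closed_segment (g m) (g M)"
      unfolding m_def M_def se by (auto simp: min_def max_def closed_segment_commute)
    have in_seg: "g t \<in> closed_segment c d \<longleftrightarrow> t \<in> {m..M}" for t
      unfolding mM(2) using seg[OF mM(1)] inj by auto
    have "0 \<in> {m..M}" using in_seg[of 0] \<open>a \<in> closed_segment c d\<close> g01 by simp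
    moreover have "g \<mu> \<in> frontier R" if "\<mu> \<in> {m..M}" for \<mu> using that cd in_seg[of \<mu>] by blast
    ultimately have "{m..M} \<subseteq> C" by (intro sub) (auto simp: L_def)
    then have mMt: "{m..M} \<subseteq> {t1..t2}" unfolding C .
    have "closed_segment c d \<subseteq> closed_segment (g t1) (g t2)"
    proof
      fix x assume "x \<in> closed_segment c d"
      then obtain \<mu> where "\<mu> \<in> {m..M}" "x = g \<mu>" unfolding mM(2) seg[OF mM(1)] by blast
      then show "x \<in> closed_segment (g t1) (g t2)" using mMt seg[of t1 t2 x] t by auto
    qed
    then show "closed_segment c d = closed_segment (g t1) (g t2)" using cd by auto
  qed
  moreover have "closed_segment a b \<subseteq> closed_segment (g t1) (g t2)"
  proof
    fix x assume "x \<in> closed_segment a b"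
    then obtain \<mu> where "\<mu> \<in> {0..1}" "x = g \<mu>" using seg[of 0 1 x] g01 by auto
    then show "x \<in> closed_segment (g t1) (g t2)" using seg[of t1 t2 x] t by auto
  qed
  ultimately show thesis by (rule that)
qed

lemma card_UN_le_mult:
  assumes "finite I" "\<And>i. i \<in> I \<Longrightarrow> card (A i) \<le> m"
  shows "card (\<Union>i\<in>I. A i) \<le> m * card I"
proof -
  have "card (\<Union>i\<in>I. A i) \<le> (\<Sum>i\<in>I. card (A i))" by (rule card_UN_le[OF assms(1)])
  also have "\<dots> \<le> (\<Sum>i\<in>I. m)" by (intro sum_mono assms(2))
  finally show ?thesis by (simp add: mult.commute)
qed

text \<open>At most \<open>N0\<close> outer edges give two segments each and at most
  \<open>N0\<close> inner ones give one each. These \<open>3 * N0\<close> segments are extended to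
  maximal edges, each cut into at most two halves. The same number is used as a common bound for the
  exceptional points.\<close>

lemma ring_half_edges:
  assumes ring: "is_ring N0 c0 \<beta> R" and b: "0 < \<beta>" "\<beta> \<le> pi / 3"
  shows "compact R" "R \<subseteq> closure (interior R)"
    "\<exists>H X. finite H \<and> card H \<le> 6 * N0 \<and> finite X \<and> card X \<le> 6 * N0 \<and>
       frontier R \<subseteq> (\<Union>(u, v)\<in>H. closed_segment u v) \<union> X \<and>
       (\<forall>(u, v)\<in>H. \<exists>z0. fat_at (sin \<beta> / 16) R u v z0)"
proof -
  from ring obtain Q1 Q2 where Q: "Q2 \<subseteq> Q1 \<or> Q2 = {}" "convex_polygon N0 c0 Q1"
      "Q2 \<noteq> {} \<Longrightarrow> convex_polygon N0 c0 Q2" "R = closure (Q1 - Q2)"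
    and edges: "\<And>a b. is_edge R a b \<Longrightarrow> \<exists>m\<in>closed_segment a b. (a \<noteq> m \<longrightarrow> has_beta_triangle \<beta> R a m) \<and>
                                  (m \<noteq> b \<longrightarrow> has_beta_triangle \<beta> R m b)"
    unfolding is_ring_def by blast
  have int: "interior Q \<noteq> {}" if cp: "convex_polygon N0 c0 Q" for Q
  proof -
    obtain x r where "r > 0" "ball x r \<subseteq> Q" using cp unfolding convex_polygon_def regular_set_def by blast
    then have "x \<in> interior Q" unfolding mem_interior by blast
    then show ?thesis by blast
  qed
  interpret convex_diff Q1 Q2 R
  proof
    show "Q2 \<noteq> {} \<Longrightarrow> interior Q2 \<noteq> {}" using Q int by blast
    show "compact Q1" "convex Q1" "interior Q1 \<noteq> {}" using Q(2) int by (auto simp: convex_polygon_def)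
    show "compact Q2" "convex Q2" using Q(3) by (cases "Q2 = {}"; auto simp: convex_polygon_def)+
  qed (use Q in auto)
  show "compact R" "R \<subseteq> closure (interior R)" by (rule compact_R, rule R_regular)
  obtain S1 where S1: "finite S1" "card S1 \<le> N0" "frontier Q1 = (\<Union>(a, b)\<in>S1. closed_segment a b)"
    using Q(2) unfolding convex_polygon_def by blast
  obtain S2 where S2: "finite S2" "card S2 \<le> N0" "frontier Q2 = (\<Union>(a, b)\<in>S2. closed_segment a b)"
  proof (cases "Q2 = {}")
    case True
    then show thesis using that[of "{}"] by auto
  next
    case False
    then show thesis using Q(3) that unfolding convex_polygon_def by blast
  qed
  define good where "good m D s T X \<longleftrightarrow> finite T \<and> card T \<le> m \<and> finite X \<and> card X \<le> m \<and>
    (\<forall>(u, v)\<in>T. u \<noteq> v \<and> closed_segment u v \<subseteq> frontier R) \<and>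
    closed_segment (fst s) (snd s) \<inter> D \<subseteq> (\<Union>(u, v)\<in>T. closed_segment u v) \<union> X"
    for m :: nat and D :: "pt set" and s :: "pt \<times> pt" and T :: "(pt \<times> pt) set" and X
  have "\<exists>T X. good 2 (frontier R) s T X" if "s \<in> S1" for s
    unfolding good_def by (intro outer_edge_cover) (use S1(3) that in \<open>auto\<close>)
  then obtain T1 X1 where g1: "\<And>s. s \<in> S1 \<Longrightarrow> good 2 (frontier R) s (T1 s) (X1 s)" by metis
  have "\<exists>T X. good 1 (interior Q1) s T X" if "s \<in> S2" for s
    unfolding good_def by (intro inner_edge_cover) (use S2(3) that in \<open>auto\<close>)
  then obtain T2 X2 where g2: "\<And>s. s \<in> S2 \<Longrightarrow> good 1 (interior Q1) s (T2 s) (X2 s)" by metis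
  note 1 = g1[unfolded good_def] and 2 = g2[unfolded good_def]
  define T where "T = (\<Union>s\<in>S1. T1 s) \<union> (\<Union>s\<in>S2. T2 s)"
  define X where "X = (\<Union>s\<in>S1. X1 s) \<union> (\<Union>s\<in>S2. X2 s)"
  have fin: "finite T" "finite X" using 1 2 S1(1) S2(1) by (auto simp: T_def X_def)
  have cT: "card T \<le> 3 * N0"
  proof -
    have "card T \<le> card (\<Union>s\<in>S1. T1 s) + card (\<Union>s\<in>S2. T2 s)" unfolding T_def by (rule card_Un_le)
    also have "\<dots> \<le> 2 * card S1 + 1 * card S2" using 1 2 S1(1) S2(1) by (intro add_mono card_UN_le_mult) auto
    finally show ?thesis using S1(2) S2(2) by linarith
  qed
  have cX: "card X \<le> 3 * N0"
  proof -
    have "card X \<le> card (\<Union>s\<in>S1. X1 s) + card (\<Union>s\<in>S2. X2 s)" unfolding X_def by (rule card_Un_le)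
    also have "\<dots> \<le> 2 * card S1 + 1 * card S2" using 1 2 S1(1) S2(1) by (intro add_mono card_UN_le_mult) auto
    finally show ?thesis using S1(2) S2(2) by linarith
  qed
  have TF: "u \<noteq> v \<and> closed_segment u v \<subseteq> frontier R" if "(u, v) \<in> T" for u v
    using that 1 2 unfolding T_def by blast
  have cov: "z \<in> X \<or> (\<exists>s\<in>T. z \<in> closed_segment (fst s) (snd s))" if z: "z \<in> frontier R" for z
    using frontier_R_cases[OF z]
  proof
    assume "z \<in> frontier Q1"
    then obtain s where s: "s \<in> S1" "z \<in> closed_segment (fst s) (snd s)" using S1(3) by auto
    then have "z \<in> (\<Union>(u, v)\<in>T1 s. closed_segment u v) \<union> X1 s" using 1[OF s(1)] z by blast
    then consider "z \<in> X1 s" | t where "t \<in> T1 s" "z \<in> closed_segment (fst t) (snd t)" by auto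
    then show ?thesis using s(1) unfolding T_def X_def by cases blast+
  next
    assume zz: "z \<in> frontier Q2 \<inter> interior Q1"
    then obtain s where s: "s \<in> S2" "z \<in> closed_segment (fst s) (snd s)" using S2(3) by auto
    then have "z \<in> (\<Union>(u, v)\<in>T2 s. closed_segment u v) \<union> X2 s" using 2[OF s(1)] zz by blast
    then consider "z \<in> X2 s" | t where "t \<in> T2 s" "z \<in> closed_segment (fst t) (snd t)" by auto
    then show ?thesis using s(1) unfolding T_def X_def by cases blast+
  qed
  have "\<exists>a b m. closed_segment (fst s) (snd s) \<subseteq> closed_segment a b \<and> m \<in> closed_segment a b \<and>
      (a \<noteq> m \<longrightarrow> has_beta_triangle \<beta> R a m) \<and> (m \<noteq> b \<longrightarrow> has_beta_triangle \<beta> R m b) \<and> a \<noteq> b" if s: "s \<in> T" for s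
  proof -
    obtain a b where ab: "is_edge R a b" "closed_segment (fst s) (snd s) \<subseteq> closed_segment a b"
      using maximal_edge_exists[OF compact_R, of "fst s" "snd s"] TF s by (metis prod.collapse)
    then show ?thesis using edges[OF ab(1)] unfolding is_edge_def by blast
  qed
  then obtain fa fb fm where f: "\<And>s. s \<in> T \<Longrightarrow> closed_segment (fst s) (snd s) \<subseteq> closed_segment (fa s) (fb s) \<and>
      fm s \<in> closed_segment (fa s) (fb s) \<and>
      (fa s \<noteq> fm s \<longrightarrow> has_beta_triangle \<beta> R (fa s) (fm s)) \<and> (fm s \<noteq> fb s \<longrightarrow> has_beta_triangle \<beta> R (fm s) (fb s)) \<and> fa s \<noteq> fb s"
    by metis
  \<comment> \<open>A half that shrinks to a point is dropped, as no triangle is given over it. Both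
    cannot shrink, because the ends of an edge are distinct.\<close>
  define h where "h s = (if fa s \<noteq> fm s then {(fa s, fm s)} else {}) \<union> (if fm s \<noteq> fb s then {(fm s, fb s)} else {})" for s
  define H where "H = (\<Union>s\<in>T. h s)"
  have "card (h s) \<le> 2" for s unfolding h_def by (intro order_trans[OF card_Un_le]) auto
  then have "card H \<le> 2 * card T" unfolding H_def by (intro card_UN_le_mult fin)
  then have "card H \<le> 6 * N0" using cT by linarith
  moreover have "finite H" using fin by (auto simp: H_def h_def)
  moreover have "frontier R \<subseteq> (\<Union>(u, v)\<in>H. closed_segment u v) \<union> X"
  proof
    fix z assume "z \<in> frontier R"
    then consider "z \<in> X" | s where "s \<in> T" "z \<in> closed_segment (fst s) (snd s)" using cov by blast
    then show "z \<in> (\<Union>(u, v)\<in>H. closed_segment u v) \<union> X"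
    proof cases
      case 2
      then have "z \<in> closed_segment (fa s) (fb s)" using f by blast
      also have "closed_segment (fa s) (fb s) = closed_segment (fa s) (fm s) \<union> closed_segment (fm s) (fb s)"
        using f[OF 2(1)] by (intro Un_closed_segment[symmetric]) auto
      finally have "\<exists>(u, v)\<in>h s. z \<in> closed_segment u v"
        using f[OF 2(1)] unfolding h_def by (cases "fa s = fm s"; cases "fm s = fb s") auto
      then show ?thesis using 2(1) unfolding H_def by blast
    qed auto
  qed
  moreover have "\<forall>(u, v)\<in>H. \<exists>z0. fat_at (sin \<beta> / 16) R u v z0"
  proof (clarify)
    fix u v assume "(u, v) \<in> H"
    then obtain s where s: "s \<in> T" "(u, v) \<in> h s" unfolding H_def by blast
    from s(2) have "fa s \<noteq> fm s \<and> u = fa s \<and> v = fm s \<or> fm s \<noteq> fb s \<and> u = fm s \<and> v = fb s"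
      unfolding h_def by (auto split: if_splits)
    then have "u \<noteq> v" "has_beta_triangle \<beta> R u v" using f[OF s(1)] by blast+
    then show "\<exists>z0. fat_at (sin \<beta> / 16) R u v z0" using beta_triangle_fat b by blast
  qed
  ultimately show "\<exists>H X. finite H \<and> card H \<le> 6 * N0 \<and> finite X \<and> card X \<le> 6 * N0 \<and>
       frontier R \<subseteq> (\<Union>(u, v)\<in>H. closed_segment u v) \<union> X \<and>
       (\<forall>(u, v)\<in>H. \<exists>z0. fat_at (sin \<beta> / 16) R u v z0)"
    using fin cX by (intro exI[of _ H] exI[of _ X]) auto
qed

section \<open>Differences and rays\<close>

text \<open>Pascal's rule turns the sum of order \<open>Suc k\<close> for \<open>q\<close> into the
  one of order \<open>k\<close> for \<open>q x - q (x + 1)\<close>, in which the leading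
  coefficients cancel.\<close>

lemma alternating_binomial_sum_poly:
  fixes q :: "real poly"
  assumes "q = 0 \<or> degree q < k"
  shows "(\<Sum>\<nu>\<le>k. (-1) ^ \<nu> * real (k choose \<nu>) * poly q (real \<nu>)) = 0"
  using assms
proof (induction k arbitrary: q)
  case 0
  then show ?case by auto
next
  case (Suc k)
  define D where "D = q - pcompose q [:1, 1:]"
  have D: "poly D x = poly q x - poly q (x + 1)" for x by (simp add: D_def poly_pcompose add.commute)
  have "D = 0 \<or> degree D < k"
  proof (cases "degree q = 0")
    case True
    then obtain a where "q = [:a:]" by (meson degree_eq_zeroE)
    then show ?thesis by (simp add: D_def)
  next
    case False
    have dp: "degree (pcompose q [:1, 1:]) = degree q" by (simp add: degree_pcompose)
    have "coeff (pcompose q [:1, 1:]) (degree q) = lead_coeff q"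
      using lead_coeff_comp[of "[:1, 1:]" q] dp by simp
    then have c0: "coeff D (degree q) = 0" by (simp add: D_def)
    have "degree D \<le> degree q" unfolding D_def using degree_diff_le_max[of q "pcompose q [:1,1:]"] dp by simp
    then have "D = 0 \<or> degree D < degree q"
      using c0 by (metis le_neq_implies_less leading_coeff_0_iff)
    then show ?thesis using Suc.prems False by auto
  qed
  from Suc.IH[OF this]
  have IH: "(\<Sum>\<nu>\<le>k. (-1) ^ \<nu> * real (k choose \<nu>) * (poly q (real \<nu>) - poly q (real \<nu> + 1))) = 0"
    by (simp add: D)
  let ?f = "\<lambda>\<nu>. (-1) ^ \<nu> * real (Suc k choose \<nu>) * poly q (real \<nu>)"
  have "(\<Sum>\<nu>\<le>Suc k. ?f \<nu>) = ?f 0 + (\<Sum>\<nu>\<le>k. ?f (Suc \<nu>))" by (rule sum.atMost_Suc_shift)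
  also have "(\<Sum>\<nu>\<le>k. ?f (Suc \<nu>)) = (\<Sum>\<nu>\<le>k. (-1) ^ Suc \<nu> * real (k choose \<nu>) * poly q (real (Suc \<nu>)))
     + (\<Sum>\<nu>\<le>k. (-1) ^ Suc \<nu> * real (k choose Suc \<nu>) * poly q (real (Suc \<nu>)))"
    by (simp add: sum.distrib[symmetric] algebra_simps)
  also have "?f 0 + (A + (\<Sum>\<nu>\<le>k. (-1) ^ Suc \<nu> * real (k choose Suc \<nu>) * poly q (real (Suc \<nu>)))) =
     A + (\<Sum>\<nu>\<le>Suc k. (-1) ^ \<nu> * real (k choose \<nu>) * poly q (real \<nu>))" for A
    by (subst sum.atMost_Suc_shift) simp
  also have "(\<Sum>\<nu>\<le>Suc k. (-1) ^ \<nu> * real (k choose \<nu>) * poly q (real \<nu>)) = (\<Sum>\<nu>\<le>k. (-1) ^ \<nu> * real (k choose \<nu>) * poly q (real \<nu>))"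
    by simp
  also have "(\<Sum>\<nu>\<le>k. (-1) ^ Suc \<nu> * real (k choose \<nu>) * poly q (real (Suc \<nu>))) +
      (\<Sum>\<nu>\<le>k. (-1) ^ \<nu> * real (k choose \<nu>) * poly q (real \<nu>)) =
      (\<Sum>\<nu>\<le>k. (-1) ^ \<nu> * real (k choose \<nu>) * (poly q (real \<nu>) - poly q (real \<nu> + 1)))"
    unfolding sum.distrib[symmetric] by (intro sum.cong) (auto simp: algebra_simps)
  finally show ?case using IH by simp
qed

lemma kth_difference_poly:
  fixes q :: "real poly"
  assumes "degree q < k"
  shows "(\<Sum>\<nu>\<le>k. (-1) ^ (k + \<nu>) * real (k choose \<nu>) * poly q (real \<nu>)) = 0"
proof -
  have "(\<Sum>\<nu>\<le>k. (-1) ^ (k + \<nu>) * real (k choose \<nu>) * poly q (real \<nu>))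
      = (-1) ^ k * (\<Sum>\<nu>\<le>k. (-1) ^ \<nu> * real (k choose \<nu>) * poly q (real \<nu>))"
    by (simp add: sum_distrib_left power_add mult.assoc)
  then show ?thesis using alternating_binomial_sum_poly[of q k] assms by simp
qed

text \<open>Summation by parts. For the weights of a \<open>k\<close>-th difference the sum over
  piece 0 will vanish, so that only jumps between consecutive pieces remain.\<close>

lemma sum_along_chain:
  fixes Q :: "nat \<Rightarrow> nat \<Rightarrow> real"
  assumes "finite V" "\<And>\<nu>. \<nu> \<in> V \<Longrightarrow> lf \<nu> < m"
  shows "(\<Sum>\<nu>\<in>V. w \<nu> * Q (lf \<nu>) \<nu>) = (\<Sum>\<nu>\<in>V. w \<nu> * Q 0 \<nu>)
     + (\<Sum>l<m - 1. \<Sum>\<nu>\<in>{\<nu>\<in>V. l < lf \<nu>}. w \<nu> * (Q (Suc l) \<nu> - Q l \<nu>))"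
proof -
  have "(\<Sum>\<nu>\<in>V. w \<nu> * Q (lf \<nu>) \<nu>) = (\<Sum>\<nu>\<in>V. w \<nu> * Q 0 \<nu> + (\<Sum>l\<in>{l. l < m - 1 \<and> l < lf \<nu>}. w \<nu> * (Q (Suc l) \<nu> - Q l \<nu>)))"
  proof (rule sum.cong)
    fix \<nu> assume v: "\<nu> \<in> V"
    have "{l. l < m - 1 \<and> l < lf \<nu>} = {..<lf \<nu>}" using assms(2)[OF v] by auto
    then have "(\<Sum>l\<in>{l. l < m - 1 \<and> l < lf \<nu>}. w \<nu> * (Q (Suc l) \<nu> - Q l \<nu>)) = w \<nu> * (Q (lf \<nu>) \<nu> - Q 0 \<nu>)"
      by (simp add: sum_distrib_left[symmetric] sum_lessThan_telescope[of "\<lambda>l. Q l \<nu>"])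
    then show "w \<nu> * Q (lf \<nu>) \<nu> = w \<nu> * Q 0 \<nu> + (\<Sum>l\<in>{l. l < m - 1 \<and> l < lf \<nu>}. w \<nu> * (Q (Suc l) \<nu> - Q l \<nu>))"
      by (simp add: algebra_simps)
  qed simp
  also have "\<dots> = (\<Sum>\<nu>\<in>V. w \<nu> * Q 0 \<nu>) + (\<Sum>\<nu>\<in>V. \<Sum>l\<in>{l\<in>{..<m - 1}. l < lf \<nu>}. w \<nu> * (Q (Suc l) \<nu> - Q l \<nu>))"
    by (simp add: sum.distrib)
  also have "(\<Sum>\<nu>\<in>V. \<Sum>l\<in>{l\<in>{..<m - 1}. l < lf \<nu>}. w \<nu> * (Q (Suc l) \<nu> - Q l \<nu>))
     = (\<Sum>l<m - 1. \<Sum>\<nu>\<in>{\<nu>\<in>V. l < lf \<nu>}. w \<nu> * (Q (Suc l) \<nu> - Q l \<nu>))"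
    by (rule sum.swap_restrict) (use assms in auto)
  finally show ?thesis .
qed

text \<open>Induction on the number of break points, splitting off the part behind the last one. If
  both sides carry the same index they are merged; that consecutive indices differ is what later
  puts every joint into two different rings.\<close>

lemma chain_exists:
  fixes C :: "nat \<Rightarrow> real set"
  assumes "finite B" "a < b"
    and "\<And>c d. a \<le> c \<Longrightarrow> c < d \<Longrightarrow> d \<le> b \<Longrightarrow> {c<..<d} \<inter> B = {} \<Longrightarrow> \<exists>j\<in>J. {c..d} \<subseteq> C j"
  shows "\<exists>m u j. 0 < m \<and> u 0 = a \<and> u m = b \<and>
     (\<forall>l<m. u l < u (Suc l) \<and> j l \<in> J \<and> {u l..u (Suc l)} \<subseteq> C (j l)) \<and>
     (\<forall>l. Suc l < m \<longrightarrow> j l \<noteq> (j (Suc l) :: nat))"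
  using assms
proof (induction "card (B \<inter> {a<..<b})" arbitrary: b rule: less_induct)
  case less
  show ?case
  proof (cases "B \<inter> {a<..<b} = {}")
    case True
    then obtain j where "j \<in> J" "{a..b} \<subseteq> C j" using less.prems(3)[of a b] less.prems(2) by auto
    then show ?thesis using less.prems(2)
      by (intro exI[of _ 1] exI[of _ "\<lambda>l. if l = 0 then a else b"] exI[of _ "\<lambda>_. j"]) auto
  next
    case False
    have fin: "finite (B \<inter> {a<..<b})" using less.prems(1) by simp
    define c where "c = Max (B \<inter> {a<..<b})"
    have c: "c \<in> B \<inter> {a<..<b}" unfolding c_def by (rule Max_in[OF fin False])
    have gap: "{c<..<b} \<inter> B = {}"
    proof -
      have "x \<le> c" if "x \<in> B" "a < x" "x < b" for x unfolding c_def using that fin by (intro Max_ge) auto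
      then show ?thesis using c by fastforce
    qed
    obtain i where i: "i \<in> J" "{c..b} \<subseteq> C i" using less.prems(3)[OF _ _ _ gap] c by auto
    have "B \<inter> {a<..<c} \<subset> B \<inter> {a<..<b}" using c by auto
    then have "card (B \<inter> {a<..<c}) < card (B \<inter> {a<..<b})" using fin psubset_card_mono by blast
    from less.hyps[OF this less.prems(1)] c less.prems(3)
    obtain m u j where u: "0 < m" "u 0 = a" "u m = c"
      "\<And>l. l < m \<Longrightarrow> u l < u (Suc l) \<and> j l \<in> J \<and> {u l..u (Suc l)} \<subseteq> C (j l)"
      "\<And>l. Suc l < m \<Longrightarrow> j l \<noteq> j (Suc l)" by (auto 4 4)
    show ?thesis
    proof (cases "j (m - 1) = i")
      case True
      have "{u (m - 1)..b} \<subseteq> {u (m - 1)..c} \<union> {c..b}" by auto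
      moreover have "{u (m - 1)..c} \<subseteq> C i" using u(4)[of "m - 1"] u(1,3) True by simp
      ultimately have "{u (m - 1)..b} \<subseteq> C i" using i by blast
      moreover have "u (m - 1) < b" using u(4)[of "m - 1"] u(1,3) c by auto
      ultimately have "u' l < u' (Suc l) \<and> j l \<in> J \<and> {u' l..u' (Suc l)} \<subseteq> C (j l)"
        if "l < m" "u' = u(m := b)" for l u'
        using that u(4)[of l] True i by (cases "Suc l = m") auto
      then show ?thesis using u by (intro exI[of _ m] exI[of _ "u(m := b)"] exI[of _ j]) auto
    next
      case False
      have "u' l < u' (Suc l) \<and> j' l \<in> J \<and> {u' l..u' (Suc l)} \<subseteq> C (j' l)"
        if "l < Suc m" "u' = u(Suc m := b)" "j' = j(m := i)" for l u' j'
        using that u(3) u(4)[of l] i c by (cases "l = m") auto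
      moreover have "j' l \<noteq> j' (Suc l)" if "Suc l < Suc m" "j' = j(m := i)" for l j'
        using that u(5)[of l] False by (cases "Suc l = m") auto
      ultimately show ?thesis using u
        by (intro exI[of _ "Suc m"] exI[of _ "u(Suc m := b)"] exI[of _ "j(m := i)"]) auto
    qed
  qed
qed

lemma dist_le_segment_length:
  fixes a b :: "'a::real_normed_vector"
  assumes "x \<in> closed_segment a b" "y \<in> closed_segment a b"
  shows "dist x y \<le> dist a b"
proof -
  obtain l m where l: "0 \<le> l" "l \<le> 1" "x = (1 - l) *\<^sub>R a + l *\<^sub>R b"
    and m: "0 \<le> m" "m \<le> 1" "y = (1 - m) *\<^sub>R a + m *\<^sub>R b" using assms unfolding in_segment by blast
  have "x - y = (m - l) *\<^sub>R (a - b)" unfolding l(3) m(3) by (simp add: algebra_simps)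
  then have "dist x y = \<bar>m - l\<bar> * dist a b" by (simp add: dist_norm)
  also have "\<dots> \<le> 1 * dist a b" using l m by (intro mult_right_mono) auto
  finally show ?thesis by simp
qed

text \<open>Among \<open>2 N + 1\<close> rays from \<open>y\<close>, two meet the boundary of \<open>R\<close> on a common edge.\<close>

lemma nearby_long_edge:
  fixes N :: nat
  shows "\<exists>K>0. \<forall>R H X (y::pt). compact R \<longrightarrow> finite H \<longrightarrow> card H \<le> N \<longrightarrow> finite X \<longrightarrow> card X \<le> N \<longrightarrow>
     frontier R \<subseteq> (\<Union>(u, v)\<in>H. closed_segment u v) \<union> X \<longrightarrow> y \<in> R \<longrightarrow> y \<notin> X \<longrightarrow>
     (\<exists>(u, v)\<in>H. \<exists>z\<in>closed_segment u v. dist y z \<le> K * dist u v)"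
proof -
  define f where "f t = (vector [cos t, sin t] :: pt)" for t
  have "inj_on f {0..pi}"
    using cos_inj_pi by (auto simp: f_def inj_on_def vec_eq_iff forall_2 vector_2)
  moreover have "f ` {0..pi} \<subseteq> sphere 0 1"
  proof clarify
    fix t
    have "(norm (f t))\<^sup>2 = 1" unfolding pt_norm_sq by (simp add: f_def vector_2)
    then show "f t \<in> sphere 0 1" using norm_ge_zero[of "f t"] by (auto simp: power2_eq_1_iff)
  qed
  moreover have "infinite {0..pi}" using pi_gt_zero by (simp add: infinite_Icc)
  ultimately have "infinite (sphere (0::pt) 1)" using finite_imageD finite_subset by blast
  then obtain W where W: "finite W" "card W = 2 * N + 1" "W \<subseteq> sphere (0::pt) 1"
    using infinite_arbitrarily_large by blast
  have nW: "norm w = 1" if "w \<in> W" for w using W that by auto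
  have "\<exists>\<delta>>0. \<forall>w\<in>W. \<forall>w'\<in>W. w \<noteq> w' \<longrightarrow> \<delta> \<le> norm (w - w')"
  proof -
    define D where "D = insert 1 ((\<lambda>v. norm (fst v - snd v)) ` (W \<times> W - Id))"
    have D: "finite D" "D \<noteq> {}" using W(1) by (simp_all add: D_def)
    have "x > 0" if "x \<in> D" for x using that by (auto simp: D_def)
    then have "Min D > 0" using D by simp
    moreover have "Min D \<le> norm (w - w')" if "w \<in> W" "w' \<in> W" "w \<noteq> w'" for w w'
    proof (rule Min_le[OF D(1)])
      have "(w, w') \<in> W \<times> W - Id" using that by simp
      then show "norm (w - w') \<in> D" unfolding D_def by (intro insertI2) force
    qed
    ultimately show ?thesis by blast
  qed
  then obtain \<delta> where d: "\<delta> > 0" "\<And>w w'. w \<in> W \<Longrightarrow> w' \<in> W \<Longrightarrow> w \<noteq> w' \<Longrightarrow> \<delta> \<le> norm (w - w')" by blast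
  show ?thesis
  proof (intro exI[of _ "2 / \<delta>"] conjI allI impI)
    show "2 / \<delta> > 0" using d by simp
    fix R H X and y :: pt
    assume R: "compact R" and H: "finite H" "card H \<le> N" and X: "finite X" "card X \<le> N"
      and fr: "frontier R \<subseteq> (\<Union>(u, v)\<in>H. closed_segment u v) \<union> X" and y: "y \<in> R" "y \<notin> X"
    show "\<exists>(u, v)\<in>H. \<exists>z\<in>closed_segment u v. dist y z \<le> 2 / \<delta> * dist u v"
    proof (cases "y \<in> frontier R")
      case True
      then obtain u v where "(u, v) \<in> H" "y \<in> closed_segment u v" using fr y by auto
      then show ?thesis using d by (intro bexI[of _ "(u, v)"]) (auto intro!: bexI[of _ y])
    next
      case yfr: False
      have "\<exists>s>0. y + s *\<^sub>R w \<in> frontier R" if w: "w \<in> W" for w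
      proof -
        obtain B where B: "B > 0" "\<And>x. x \<in> R \<Longrightarrow> norm x < B" using R compact_imp_bounded bounded_pos_less by metis
        define M where "M = B + norm y"
        have M: "M > 0" using B by (simp add: M_def add_pos_nonneg)
        have "norm (M *\<^sub>R w) \<le> norm (y + M *\<^sub>R w) + norm y" using norm_triangle_ineq4[of "y + M *\<^sub>R w" y] by simp
        then have "y + M *\<^sub>R w \<notin> R" using B(2)[of "y + M *\<^sub>R w"] nW[OF w] M by (auto simp: M_def)
        then have "closed_segment y (y + M *\<^sub>R w) \<inter> frontier R \<noteq> {}"
          using y by (intro connected_Int_frontier) auto
        then obtain x where x: "x \<in> closed_segment y (y + M *\<^sub>R w)" "x \<in> frontier R" by auto
        then obtain l where l: "0 \<le> l" "x = y + (l * M) *\<^sub>R w" by (auto simp: in_segment algebra_simps)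
        then show ?thesis using x(2) yfr M by (intro exI[of _ "l * M"]) (auto intro!: mult_pos_pos simp: less_le)
      qed
      then obtain s where s: "\<And>w. w \<in> W \<Longrightarrow> s w > 0 \<and> y + s w *\<^sub>R w \<in> frontier R" by metis
      define hit where "hit w h \<longleftrightarrow> y + s w *\<^sub>R w \<in> closed_segment (fst h) (snd h)" for w h
      \<comment> \<open>Each ray is labelled by an edge that it hits or, failing that, by the
        exceptional point at which it meets the frontier. There are at most \<open>2 * N\<close>
        labels, so two rays share one; distinct rays have no point in common apart from
        \<open>y\<close>, so the shared label is an edge.\<close>
      define F where "F w = (if \<exists>h\<in>H. hit w h then Inl (SOME h. h \<in> H \<and> hit w h) else Inr (y + s w *\<^sub>R w))" for w
      have F: "(\<exists>h\<in>H. F w = Inl h \<and> hit w h) \<or> (F w = Inr (y + s w *\<^sub>R w) \<and> y + s w *\<^sub>R w \<in> X)" if "w \<in> W" for w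
      proof (cases "\<exists>h\<in>H. hit w h")
        case True
        then have "(SOME h. h \<in> H \<and> hit w h) \<in> H \<and> hit w (SOME h. h \<in> H \<and> hit w h)"
          by (intro someI_ex[of "\<lambda>h. h \<in> H \<and> hit w h"]) auto
        then show ?thesis using True by (auto simp: F_def)
      next
        case False
        then have "y + s w *\<^sub>R w \<in> X" using s[OF that] fr unfolding hit_def by fastforce
        then show ?thesis using False by (auto simp: F_def)
      qed
      have "F ` W \<subseteq> Inl ` H \<union> Inr ` X" using F by fastforce
      then have "card (F ` W) \<le> card (Inl ` H \<union> Inr ` X :: ((pt \<times> pt) + pt) set)" using H X by (intro card_mono) auto
      also have "\<dots> \<le> card (Inl ` H :: ((pt \<times> pt) + pt) set) + card (Inr ` X :: ((pt \<times> pt) + pt) set)" by (rule card_Un_le)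
      also have "\<dots> \<le> N + N" using H X by (intro add_mono) (simp_all add: card_image)
      finally have "\<not> inj_on F W" using W by (intro pigeonhole) auto
      then obtain w w' where w: "w \<in> W" "w' \<in> W" "w \<noteq> w'" "F w = F w'" unfolding inj_on_def by blast
      have ne: "y + s w *\<^sub>R w \<noteq> y + s w' *\<^sub>R w'"
      proof
        assume "y + s w *\<^sub>R w = y + s w' *\<^sub>R w'"
        then have eq: "s w *\<^sub>R w = s w' *\<^sub>R w'" by simp
        then have "norm (s w *\<^sub>R w) = norm (s w' *\<^sub>R w')" by simp
        then have "s w = s w'" using nW w s[OF w(1)] s[OF w(2)] by simp
        then show False using eq s[OF w(1)] w(3) by simp
      qed
      obtain h where h: "h \<in> H" "hit w h" "hit w' h" using F[OF w(1)] F[OF w(2)] w(4) ne by auto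
      define z where "z = y + s w *\<^sub>R w"
      have z: "z \<in> closed_segment (fst h) (snd h)" "y + s w' *\<^sub>R w' \<in> closed_segment (fst h) (snd h)"
        using h by (auto simp: hit_def z_def)
      have dz: "dist y z = s w" using nW[OF w(1)] s[OF w(1)] by (simp add: z_def dist_norm)
      \<comment> \<open>The two hits lie on one edge, so their distance is at most its length.
        Replacing radius \<open>s w\<close> by \<open>s w'\<close> costs no more than this distance,
        which leaves at least \<open>s w * \<delta> / 2\<close> from the separation of
        directions.\<close>
      have "s w * norm (w - w') = norm (s w *\<^sub>R (w - w'))" using s[OF w(1)] by simp
      also have "\<dots> = norm ((s w *\<^sub>R w - s w' *\<^sub>R w') + (s w' - s w) *\<^sub>R w')" by (simp add: algebra_simps)
      also have "\<dots> \<le> norm (s w *\<^sub>R w - s w' *\<^sub>R w') + \<bar>s w' - s w\<bar>"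
        using norm_triangle_ineq[of "s w *\<^sub>R w - s w' *\<^sub>R w'" "(s w' - s w) *\<^sub>R w'"] nW[OF w(2)] by simp
      also have "\<bar>s w' - s w\<bar> \<le> norm (s w *\<^sub>R w - s w' *\<^sub>R w')"
        using norm_triangle_ineq3[of "s w *\<^sub>R w" "s w' *\<^sub>R w'"] nW w s[OF w(1)] s[OF w(2)] by simp
      also have "norm (s w *\<^sub>R w - s w' *\<^sub>R w') = dist z (y + s w' *\<^sub>R w')" by (simp add: z_def dist_norm)
      also have "\<dots> \<le> dist (fst h) (snd h)" using z by (rule dist_le_segment_length)
      finally have "s w * norm (w - w') \<le> 2 * dist (fst h) (snd h)" by simp
      moreover have "s w * \<delta> \<le> s w * norm (w - w')" using d(2)[OF w(1-3)] s[OF w(1)] by (intro mult_left_mono) auto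
      ultimately have "s w \<le> 2 / \<delta> * dist (fst h) (snd h)" using d(1) by (simp add: field_simps)
      then show ?thesis using h(1) z dz by (intro bexI[of _ h]) (auto intro!: bexI[of _ z])
    qed
  qed
qed

section \<open>Differences along a generic line\<close>

type_synonym edge = "nat \<times> pt \<times> pt"

definition elen :: "edge \<Rightarrow> real" where "elen e = dist (fst (snd e)) (snd (snd e))"

definition eseg :: "edge \<Rightarrow> pt set" where "eseg e = closed_segment (fst (snd e)) (snd (snd e))"

definition near :: "pt \<Rightarrow> real \<Rightarrow> edge \<Rightarrow> bool" where
  "near x d e \<longleftrightarrow> (\<exists>z\<in>eseg e. dist x z \<le> d)"

lemma near_mono: "near x d e \<Longrightarrow> d \<le> d' \<Longrightarrow> near x d' e"
  unfolding near_def by force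

text \<open>A triple \<open>(j, u, v)\<close> is the half-edge from \<open>u\<close> to \<open>v\<close> of the ring \<open>R j\<close>; the finite set \<open>X j\<close>
  contains the boundary points of \<open>R j\<close> on none of its half-edges. The weight \<open>a\<close> will be the
  normalised \<open>p\<close>-norm of the piece \<open>P j\<close> over a ball attached to the half-edge.\<close>

locale framed_spline =
  fixes n k r N :: nat and R X :: "nat \<Rightarrow> pt set" and H :: "nat \<Rightarrow> (pt \<times> pt) set"
    and P :: "nat \<Rightarrow> pt \<Rightarrow> real" and S :: "pt \<Rightarrow> real" and a :: "edge \<Rightarrow> real" and A B c K :: real
  assumes k1: "1 \<le> k" and K: "real k \<le> K" and A: "0 \<le> A" and B: "0 \<le> B" and c: "0 < c" "c \<le> 1"
    and H: "\<And>j. j < n \<Longrightarrow> finite (H j) \<and> card (H j) \<le> N"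
    and X: "\<And>j. j < n \<Longrightarrow> finite (X j)"
    and compact_R: "\<And>j. j < n \<Longrightarrow> compact (R j)"
    and regular_R: "\<And>j. j < n \<Longrightarrow> R j \<subseteq> closure (interior (R j))"
    and frontier_R: "\<And>j. j < n \<Longrightarrow> frontier (R j) \<subseteq> (\<Union>(u, v)\<in>H j. closed_segment u v) \<union> X j"
    and fat: "\<And>j u v. j < n \<Longrightarrow> (u, v) \<in> H j \<Longrightarrow> \<exists>z0. fat_at c (R j) u v z0"
    and ray: "\<And>j y. j < n \<Longrightarrow> y \<in> R j \<Longrightarrow> y \<notin> X j \<Longrightarrow>
       \<exists>(u, v)\<in>H j. \<exists>z\<in>closed_segment u v. dist y z \<le> K * dist u v"
    and disj: "\<And>i j. i < n \<Longrightarrow> j < n \<Longrightarrow> i \<noteq> j \<Longrightarrow> interior (R i) \<inter> interior (R j) = {}"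
    and polyP: "\<And>j. j < n \<Longrightarrow> poly2 k (P j)"
    and SP: "\<And>j x. j < n \<Longrightarrow> x \<in> R j \<Longrightarrow> S x = P j x"
    and matching: "\<And>i j z h p q l. i < n \<Longrightarrow> j < n \<Longrightarrow> z \<in> R i \<Longrightarrow> z \<in> R j \<Longrightarrow>
       (\<And>v. P i (z + v *\<^sub>R h) = poly p v) \<Longrightarrow> (\<And>v. P j (z + v *\<^sub>R h) = poly q v) \<Longrightarrow>
       l < r \<Longrightarrow> coeff p l = coeff q l"
    and a_nonneg: "\<And>e. 0 \<le> a e"
    and control: "\<And>j u v y z. j < n \<Longrightarrow> (u, v) \<in> H j \<Longrightarrow> z \<in> closed_segment u v \<Longrightarrow>
       dist y z \<le> K * dist u v \<Longrightarrow> \<bar>P j y\<bar> \<le> A * a (j, u, v)"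
    and coeff_bound: "\<And>q M i. degree q < k \<Longrightarrow> 0 \<le> M \<Longrightarrow> (\<And>v. v \<in> {0..1} \<Longrightarrow> \<bar>poly q v\<bar> \<le> M) \<Longrightarrow>
       \<bar>coeff q i\<bar> \<le> B * M"
begin

definition edges :: "edge set" where "edges = (SIGMA j:{..<n}. H j)"

text \<open>The edges that can spoil the estimate at \<open>e\<close>: those touching it, where a
  segment may pass into another ring, and those of its own ring, where it may enter or leave.
  Admitting only touching edges no longer than \<open>e\<close> makes the total count linear in
  \<open>n\<close>.\<close>

definition adj :: "edge \<Rightarrow> edge set" where
  "adj e = {e' \<in> edges. elen e' \<le> elen e \<and> eseg e \<inter> eseg e' \<noteq> {} \<or> fst e' = fst e}"

definition long :: "real \<Rightarrow> pt \<Rightarrow> edge set" where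
  "long t x = {e \<in> edges. t < elen e \<and> near x (real k * t) e}"

text \<open>The share of the jumps charged to a long edge: the gain from smoothness when both edges
  at a crossing are long, and the full size \<open>a e\<close> once a short edge of
  \<open>adj e\<close> is near.\<close>

definition phi :: "real \<Rightarrow> pt \<Rightarrow> edge \<Rightarrow> real" where
  "phi t x e = a e * ((t / elen e) ^ r + of_bool (\<exists>e'\<in>adj e. elen e' \<le> t \<and> near x (real k * t) e'))"

text \<open>The values of \<open>S\<close> on pieces with a short edge nearby, for which a long edge
  may fail to control the polynomial along the segment.\<close>

definition psi :: "real \<Rightarrow> pt \<Rightarrow> real" where
  "psi t y = (if \<exists>j<n. y \<in> R j \<and> (\<exists>e\<in>edges. fst e = j \<and> elen e \<le> t \<and> near y (real k * t) e) then \<bar>S y\<bar> else 0)"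

lemma finite_edges: "finite edges"
  unfolding edges_def using H by auto

lemma edges_less: "e \<in> edges \<Longrightarrow> fst e < n"
  unfolding edges_def by auto

lemma edges_H: "e \<in> edges \<Longrightarrow> snd e \<in> H (fst e)"
  unfolding edges_def by auto

lemma elen_pos: "e \<in> edges \<Longrightarrow> 0 < elen e"
  using fat[of "fst e" "fst (snd e)" "snd (snd e)"] edges_less[of e] edges_H[of e]
  by (auto simp: elen_def fat_at_def)

lemma edge_control:
  assumes "e \<in> edges" "near y (K * elen e) e"
  shows "\<bar>P (fst e) y\<bar> \<le> A * a e"
  using assms control[of "fst e" "fst (snd e)" "snd (snd e)"] edges_less[of e] edges_H[of e]
  by (auto simp: near_def eseg_def elen_def)

lemma psi_nonneg: "0 \<le> psi t y" by (simp add: psi_def)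

lemma phi_nonneg: "0 < t \<Longrightarrow> e \<in> edges \<Longrightarrow> 0 \<le> phi t x e"
  unfolding phi_def using a_nonneg elen_pos[of e] by (intro mult_nonneg_nonneg add_nonneg_nonneg) auto

text \<open>Every point of \<open>R j\<close> is a limit of interior points of \<open>R j\<close>;
  one that is interior to \<open>R i\<close> would make the two interiors meet.\<close>

lemma common_point_frontier:
  assumes "i < n" "j < n" "i \<noteq> j" "z \<in> R i" "z \<in> R j"
  shows "z \<in> frontier (R i)"
proof -
  have "z \<notin> interior (R i)"
  proof
    assume "z \<in> interior (R i)"
    moreover have "z \<in> closure (interior (R j))" using regular_R assms by blast
    ultimately have "interior (R i) \<inter> interior (R j) \<noteq> {}"
      using open_Int_closure_eq_empty[OF open_interior] by blast
    then show False using disj assms by blast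
  qed
  then show ?thesis using assms closure_subset by (auto simp: frontier_def)
qed

text \<open>With the edge length as unit along the line, the polynomial is bounded by
  \<open>A * a e\<close> on the unit interval, and its coefficients by \<open>B\<close> times that.
  Returning to \<open>h\<close> as unit multiplies the \<open>i\<close>-th coefficient by
  \<open>(norm h / elen e) ^ i\<close>.\<close>

lemma edge_coeff_bound:
  assumes e: "e \<in> edges" and z: "z \<in> eseg e" and h: "h \<noteq> 0"
    and q: "degree q < k" "\<And>v. P (fst e) (z + v *\<^sub>R h) = poly q v"
  shows "\<bar>coeff q i\<bar> \<le> B * (A * a e) * (norm h / elen e) ^ i"
proof -
  define s where "s = elen e / norm h"
  have s: "s > 0" using elen_pos[OF e] h by (simp add: s_def)
  define Q where "Q = pcompose q [:0, s:]"
  have "\<bar>coeff Q i\<bar> \<le> B * (A * a e)"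
  proof (rule coeff_bound)
    show "degree Q < k" using q(1) s by (simp add: Q_def degree_pcompose)
    show "0 \<le> A * a e" using A a_nonneg by simp
    fix v :: real assume v: "v \<in> {0..1}"
    have "poly Q v = P (fst e) (z + (v * s) *\<^sub>R h)" by (simp add: Q_def poly_pcompose q(2) mult.commute)
    moreover have "near (z + (v * s) *\<^sub>R h) (K * elen e) e"
    proof -
      have "dist (z + (v * s) *\<^sub>R h) z = v * elen e" using v s h by (simp add: dist_norm abs_mult) (simp add: s_def)
      also have "\<dots> \<le> K * elen e" using v K k1 elen_pos[OF e] by (intro mult_right_mono) auto
      finally show ?thesis using z unfolding near_def by blast
    qed
    ultimately show "\<bar>poly Q v\<bar> \<le> A * a e" using edge_control[OF e] by simp
  qed
  moreover have "coeff Q i = s ^ i * coeff q i" by (simp add: Q_def coeff_pcompose_linear)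
  ultimately have "s ^ i * \<bar>coeff q i\<bar> \<le> B * (A * a e)" using s by (simp add: abs_mult)
  then have "\<bar>coeff q i\<bar> \<le> B * (A * a e) / s ^ i" using s by (simp add: field_simps)
  also have "\<dots> = B * (A * a e) * (norm h / elen e) ^ i" by (simp add: s_def power_divide)
  finally show ?thesis .
qed

text \<open>Taylor coefficients of order below \<open>r\<close> agree at \<open>z\<close>, and the remaining ones are controlled
  by the two edges.\<close>

lemma smooth_crossing_bound:
  assumes e: "e \<in> edges" "e' \<in> edges" and z: "z \<in> eseg e" "z \<in> eseg e'" "z \<in> R (fst e)" "z \<in> R (fst e')"
    and h: "h \<noteq> 0" "norm h \<le> t" and t: "t \<le> elen e" "t \<le> elen e'" and v: "\<bar>v\<bar> \<le> real k"
  shows "\<bar>P (fst e) (z + v *\<^sub>R h) - P (fst e') (z + v *\<^sub>R h)\<bar>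
     \<le> real k ^ (k + 1) * (B * A) * (a e * (t / elen e) ^ r + a e' * (t / elen e') ^ r)"
proof -
  obtain p where p: "degree p < k" "\<And>v. P (fst e) (z + v *\<^sub>R h) = poly p v"
    using poly2_line[OF polyP[OF edges_less[OF e(1)]] k1] by metis
  obtain q where q: "degree q < k" "\<And>v. P (fst e') (z + v *\<^sub>R h) = poly q v"
    using poly2_line[OF polyP[OF edges_less[OF e(2)]] k1] by metis
  have t0: "0 \<le> t" using h norm_ge_zero[of h] by linarith
  have one: "\<bar>coeff p i\<bar> \<le> B * A * (a e * (t / elen e) ^ r)"
    if e: "e \<in> edges" "z \<in> eseg e" and t: "t \<le> elen e"
      and p: "degree p < k" "\<And>v. P (fst e) (z + v *\<^sub>R h) = poly p v" and i: "r \<le> i" for e p i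
  proof -
    have "\<bar>coeff p i\<bar> \<le> B * (A * a e) * (norm h / elen e) ^ i"
      by (rule edge_coeff_bound[OF e h(1) p])
    also have "\<dots> \<le> B * (A * a e) * (t / elen e) ^ r"
    proof (rule mult_left_mono)
      have "(norm h / elen e) ^ i \<le> (t / elen e) ^ i"
        using h elen_pos[OF e(1)] by (intro power_mono divide_right_mono) auto
      also have "\<dots> \<le> (t / elen e) ^ r"
        using i t elen_pos[OF e(1)] t0 by (intro power_decreasing) (auto simp: divide_le_eq)
      finally show "(norm h / elen e) ^ i \<le> (t / elen e) ^ r" .
    qed (use A B a_nonneg in auto)
    finally show ?thesis by (simp add: mult.assoc)
  qed
  have nn: "0 \<le> a e * (t / elen e) ^ r" if "e \<in> edges" for e
    using a_nonneg elen_pos[OF that] t0 by auto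
  define M where "M = B * A * (a e * (t / elen e) ^ r + a e' * (t / elen e') ^ r)"
  have M: "0 \<le> M" unfolding M_def using A B nn[OF e(1)] nn[OF e(2)] by simp
  define d where "d = p - q"
  have "degree d < k" using p q by (simp add: d_def degree_diff_less)
  have dc: "\<bar>coeff d i\<bar> \<le> M" for i
  proof (cases "i < r")
    case True
    then have "coeff p i = coeff q i"
      by (intro matching[OF edges_less[OF e(1)] edges_less[OF e(2)] z(3,4) p(2) q(2)])
    then show ?thesis using M by (simp add: d_def)
  next
    case False
    have "\<bar>coeff d i\<bar> \<le> \<bar>coeff p i\<bar> + \<bar>coeff q i\<bar>" by (simp add: d_def)
    also have "\<dots> \<le> M" unfolding M_def distrib_left
      by (intro add_mono one e z t p q) (use False in auto)
    finally show ?thesis .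
  qed
  have "P (fst e) (z + v *\<^sub>R h) - P (fst e') (z + v *\<^sub>R h) = poly d v" by (simp add: d_def p q)
  also have "poly d v = (\<Sum>i\<le>degree d. coeff d i * v ^ i)" by (rule poly_altdef)
  also have "\<bar>\<dots>\<bar> \<le> (\<Sum>i\<le>degree d. M * real k ^ k)"
  proof (intro order_trans[OF sum_abs] sum_mono)
    fix i assume i: "i \<in> {..degree d}"
    have "\<bar>v ^ i\<bar> \<le> real k ^ i" unfolding power_abs using v by (intro power_mono) auto
    also have "\<dots> \<le> real k ^ k" using i \<open>degree d < k\<close> k1 by (intro power_increasing) auto
    finally show "\<bar>coeff d i * v ^ i\<bar> \<le> M * real k ^ k" unfolding abs_mult using dc M by (intro mult_mono) auto
  qed
  also have "\<dots> = real (degree d + 1) * (M * real k ^ k)" by simp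
  also have "\<dots> \<le> real k * (M * real k ^ k)" using \<open>degree d < k\<close> M by (intro mult_right_mono) auto
  finally show ?thesis by (simp add: M_def mult_ac)
qed

text \<open>At most \<open>k + 1\<close> nodes with weights at most \<open>2 ^ k\<close>, times the
  constants of the two ways to bound a jump: by smoothness, or with no cancellation.\<close>

definition D :: real where "D = (real k + 1) * 2 ^ k * (real k ^ (k + 1) * (B * A) + A)"

lemma D_nonneg: "0 \<le> D" using A B by (simp add: D_def)

text \<open>Along such a line the ring changes at finitely many parameters, and each change happens
  on half-edges of both rings. For \<open>h \<noteq> 0\<close> almost every \<open>x\<close>
  qualifies.\<close>

definition generic :: "pt \<Rightarrow> pt \<Rightarrow> bool" where
  "generic h x \<longleftrightarrow> (\<forall>e\<in>edges. \<forall>u v. x + u *\<^sub>R h \<in> eseg e \<longrightarrow> x + v *\<^sub>R h \<in> eseg e \<longrightarrow> u = v) \<and>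
     (\<forall>j<n. \<forall>u. x + u *\<^sub>R h \<notin> X j)"

text \<open>On an open parameter interval free of edge crossings the line avoids the frontier of
  every ring. Connectedness keeps it in the ring of its midpoint, and closedness of that ring adds
  the end points.\<close>

lemma generic_chain:
  assumes gen: "generic h x" and seg: "closed_segment x (x + real k *\<^sub>R h) \<subseteq> (\<Union>j<n. R j)"
  shows "\<exists>m u j. 0 < m \<and> u 0 = 0 \<and> u m = real k \<and>
     (\<forall>l<m. u l < u (Suc l) \<and> j l < n \<and> (\<forall>v\<in>{u l..u (Suc l)}. x + v *\<^sub>R h \<in> R (j l))) \<and>
     (\<forall>l. Suc l < m \<longrightarrow> j l \<noteq> j (Suc l))"
proof -
  define g where "g v = x + v *\<^sub>R h" for v
  have cg: "continuous_on U g" for U unfolding g_def by (intro continuous_intros)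
  define C where "C j = {v. g v \<in> R j}" for j
  define V where "V = (\<Union>e\<in>edges. {v. g v \<in> eseg e})"
  have "finite {v. g v \<in> eseg e}" if "e \<in> edges" for e
  proof (cases "{v. g v \<in> eseg e} = {}")
    case False
    then obtain v where "g v \<in> eseg e" by auto
    then have "{v. g v \<in> eseg e} \<subseteq> {v}" using gen that unfolding generic_def g_def by auto
    then show ?thesis using finite_subset by blast
  qed simp
  then have finV: "finite V" unfolding V_def using finite_edges by auto
  have "\<exists>m u j. 0 < m \<and> u 0 = 0 \<and> u m = real k \<and>
     (\<forall>l<m. u l < u (Suc l) \<and> j l \<in> {..<n} \<and> {u l..u (Suc l)} \<subseteq> C (j l)) \<and>
     (\<forall>l. Suc l < m \<longrightarrow> j l \<noteq> (j (Suc l) :: nat))"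
  proof (rule chain_exists[OF finV])
    show "0 < real k" using k1 by simp
    fix s e assume se: "0 \<le> s" "s < e" "e \<le> real k" "{s<..<e} \<inter> V = {}"
    define w where "w = (s + e) / 2"
    have w: "w \<in> {s<..<e}" using se by (simp add: w_def)
    have "g w = (1 - w / real k) *\<^sub>R x + (w / real k) *\<^sub>R (x + real k *\<^sub>R h)"
      using k1 by (simp add: g_def algebra_simps)
    then have "g w \<in> closed_segment x (x + real k *\<^sub>R h)"
      unfolding in_segment using w se by (intro exI[of _ "w / real k"]) (auto simp: divide_le_eq)
    then obtain j where j: "j < n" "g w \<in> R j" using seg by auto
    define Z where "Z = g ` {s<..<e}"
    have "connected Z" unfolding Z_def by (intro connected_continuous_image cg) auto
    moreover have "g w \<in> Z" using w by (simp add: Z_def)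
    then have "Z \<inter> R j \<noteq> {}" using j by blast
    moreover have "Z \<inter> frontier (R j) = {}"
    proof -
      have "g v \<notin> frontier (R j)" if v: "v \<in> {s<..<e}" for v
      proof
        assume "g v \<in> frontier (R j)"
        then have "(\<exists>(u, v')\<in>H j. g v \<in> closed_segment u v') \<or> g v \<in> X j"
          using frontier_R[OF j(1)] by auto
        then show False
        proof
          assume "\<exists>(u, v')\<in>H j. g v \<in> closed_segment u v'"
          then obtain u v' where "(u, v') \<in> H j" "g v \<in> closed_segment u v'" by auto
          then have "(j, u, v') \<in> edges" "g v \<in> eseg (j, u, v')" using j(1) by (auto simp: edges_def eseg_def)
          then have "v \<in> V" unfolding V_def by blast
          then show False using v se by auto
        qed (use gen j(1) in \<open>auto simp: generic_def g_def\<close>)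
      qed
      then show ?thesis by (auto simp: Z_def)
    qed
    ultimately have ZR: "Z \<subseteq> R j" using connected_Int_frontier[of Z "R j"] by blast
    have "g ` closure {s<..<e} \<subseteq> R j"
      by (rule image_closure_subset[OF cg]) (use ZR compact_R[OF j(1)] in \<open>auto simp: Z_def compact_imp_closed\<close>)
    then have "{s..e} \<subseteq> C j" using se by (auto simp: C_def closure_greaterThanLessThan image_subset_iff)
    then show "\<exists>j\<in>{..<n}. {s..e} \<subseteq> C j" using j(1) by auto
  qed
  then show ?thesis unfolding C_def g_def subset_iff Ball_def mem_Collect_eq lessThan_iff .
qed

end

section \<open>The pointwise estimate for a difference\<close>

context framed_spline
begin

lemma crossing_terms_bound:
  fixes cf :: "nat \<Rightarrow> real"
  assumes V: "finite V" "card V \<le> k + 1" and cf: "\<And>\<nu>. \<nu> \<in> V \<Longrightarrow> \<bar>cf \<nu>\<bar> \<le> 2 ^ k"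
    and y: "\<And>\<nu>. \<nu> \<in> V \<Longrightarrow> \<bar>y \<nu>\<bar> \<le> M" and M: "0 \<le> M"
  shows "\<bar>\<Sum>\<nu>\<in>V. cf \<nu> * y \<nu>\<bar> \<le> (real k + 1) * 2 ^ k * M"
proof -
  have "\<bar>\<Sum>\<nu>\<in>V. cf \<nu> * y \<nu>\<bar> \<le> (\<Sum>\<nu>\<in>V. 2 ^ k * M)"
    by (intro order_trans[OF sum_abs] sum_mono) (use cf y M in \<open>auto simp: abs_mult intro!: mult_mono\<close>)
  also have "\<dots> = real (card V) * (2 ^ k * M)" by simp
  also have "\<dots> \<le> (real k + 1) * (2 ^ k * M)" using V M by (intro mult_right_mono) auto
  finally show ?thesis by (simp add: mult.assoc)
qed

text \<open>A single piece contributes nothing, since the difference annihilates its polynomial.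
  With several pieces each jump is charged to long edges at the ends of the two pieces involved; a
  generic line meets an edge only once, so no edge is charged more than a fixed number of
  times.\<close>

theorem pointwise_difference_bound:
  assumes t: "0 < t" and h: "h \<noteq> 0" "norm h \<le> t" and gen: "generic h x"
    and seg: "closed_segment x (x + real k *\<^sub>R h) \<subseteq> (\<Union>j<n. R j)"
  shows "\<bar>\<Sum>\<nu>\<le>k. (-1) ^ (k + \<nu>) * real (k choose \<nu>) * S (x + real \<nu> *\<^sub>R h)\<bar>
     \<le> 4 * D * (\<Sum>e\<in>long t x. phi t x e) + 2 ^ k * (\<Sum>\<nu>\<le>k. psi t (x + real \<nu> *\<^sub>R h))"
proof -
  obtain m u j where m: "0 < m" "u 0 = 0" "u m = real k"
    and raw: "\<forall>l<m. u l < u (Suc l) \<and> j l < n \<and> (\<forall>v\<in>{u l..u (Suc l)}. x + v *\<^sub>R h \<in> R (j l))"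
      "\<forall>l. Suc l < m \<longrightarrow> j l \<noteq> j (Suc l)"
    using generic_chain[OF gen seg] by blast
  have ch: "\<And>l. l < m \<Longrightarrow> u l < u (Suc l)" "\<And>l. l < m \<Longrightarrow> j l < n"
      "\<And>l v. l < m \<Longrightarrow> u l \<le> v \<Longrightarrow> v \<le> u (Suc l) \<Longrightarrow> x + v *\<^sub>R h \<in> R (j l)"
    and jj: "\<And>l. Suc l < m \<Longrightarrow> j l \<noteq> j (Suc l)"
    using raw by auto
  have mono: "u l < u l'" if "l < l'" "l' \<le> m" for l l'
    using that
  proof (induction l')
    case (Suc l')
    then show ?case using ch(1)[of l'] by (cases "l = l'") auto
  qed simp
  have u_range: "0 \<le> u l" "u l \<le> real k" if "l \<le> m" for l
    using mono[of 0 l] mono[of l m] m that by (cases "l = 0"; force)+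
  define z where "z l = x + u l *\<^sub>R h" for l
  have zx: "dist x (z l) \<le> real k * t" if "l \<le> m" for l
  proof -
    have "dist x (z l) = u l * norm h" using u_range[OF that] by (simp add: z_def dist_norm)
    also have "\<dots> \<le> real k * t" using u_range[OF that] h by (intro mult_mono) auto
    finally show ?thesis .
  qed
  have crossing: "\<exists>e. e \<in> edges \<and> fst e = i \<and> z l \<in> eseg e"
    if l: "l \<le> m" and i: "i < n" "i' < n" "i \<noteq> i'" "z l \<in> R i" "z l \<in> R i'" for l i i'
  proof -
    have "z l \<in> frontier (R i)" by (rule common_point_frontier[OF i])
    moreover have "z l \<notin> X i" using gen i(1) unfolding generic_def z_def by blast
    ultimately obtain v w where vw: "(v, w) \<in> H i" "z l \<in> closed_segment v w" using frontier_R[OF i(1)] by auto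
    then show ?thesis using i(1) by (intro exI[of _ "(i, v, w)"]) (auto simp: edges_def eseg_def)
  qed
  have zR: "z l \<in> R (j l)" "z (Suc l) \<in> R (j l)" if "l < m" for l
    using ch[of l] ch(3)[of l "u l"] ch(3)[of l "u (Suc l)"] that unfolding z_def by auto
  have "\<exists>e. Suc l < m \<longrightarrow> e \<in> edges \<and> fst e = j l \<and> z (Suc l) \<in> eseg e" for l
    using crossing[of "Suc l" "j l" "j (Suc l)"] ch(2)[of l] ch(2)[of "Suc l"] jj[of l] zR[of l] zR[of "Suc l"]
    by (metis Suc_lessD less_imp_le)
  then obtain \<omega> where \<omega>: "\<And>l. Suc l < m \<Longrightarrow> \<omega> l \<in> edges \<and> fst (\<omega> l) = j l \<and> z (Suc l) \<in> eseg (\<omega> l)" by metis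
  have "\<exists>e. 0 < l \<and> l < m \<longrightarrow> e \<in> edges \<and> fst e = j l \<and> z l \<in> eseg e" for l
  proof (cases l)
    case (Suc l')
    then show ?thesis
      using crossing[of l "j l" "j l'"] ch(2)[of l'] ch(2)[of l] jj[of l'] zR[of l'] zR[of l]
      by (metis Suc_lessD less_imp_le)
  qed auto
  then obtain \<alpha> where \<alpha>: "\<And>l. 0 < l \<Longrightarrow> l < m \<Longrightarrow> \<alpha> l \<in> edges \<and> fst (\<alpha> l) = j l \<and> z l \<in> eseg (\<alpha> l)" by metis
  have "\<exists>q. l < m \<longrightarrow> degree q < k \<and> (\<forall>v. P (j l) (x + v *\<^sub>R h) = poly q v)" for l
    using poly2_line[OF polyP[OF ch(2)] k1] by metis
  then obtain q where q: "\<And>l. l < m \<Longrightarrow> degree (q l) < k" "\<And>l v. l < m \<Longrightarrow> P (j l) (x + v *\<^sub>R h) = poly (q l) v"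
    by metis
  define cf where "cf \<nu> = (-1) ^ (k + \<nu>) * real (k choose \<nu>)" for \<nu>
  have cf: "\<bar>cf \<nu>\<bar> \<le> 2 ^ k" for \<nu>
  proof -
    have "real (k choose \<nu>) \<le> real (2 ^ k)" by (intro of_nat_mono binomial_le_pow2)
    then show ?thesis by (simp add: cf_def abs_mult)
  qed
  \<comment> \<open>The first piece that contains the node. A node at a joint could be read in
    either piece, as both polynomials agree with \<open>S\<close> there.\<close>
  define lf where "lf \<nu> = (LEAST l. real \<nu> \<le> u (Suc l))" for \<nu> :: nat
  have lf: "lf \<nu> < m" "u (lf \<nu>) \<le> real \<nu>" "real \<nu> \<le> u (Suc (lf \<nu>))" if "\<nu> \<le> k" for \<nu>
  proof -
    have 1: "real \<nu> \<le> u (Suc (m - 1))" using m that by simp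
    show "real \<nu> \<le> u (Suc (lf \<nu>))" unfolding lf_def by (rule LeastI[of _ "m - 1"]) (rule 1)
    have "lf \<nu> \<le> m - 1" unfolding lf_def by (rule Least_le) (rule 1)
    then show "lf \<nu> < m" using m(1) by linarith
    show "u (lf \<nu>) \<le> real \<nu>"
    proof (cases "lf \<nu>")
      case 0
      then show ?thesis using m by simp
    next
      case (Suc l)
      then have "\<not> real \<nu> \<le> u (Suc l)" using not_less_Least[of l "\<lambda>l. real \<nu> \<le> u (Suc l)"] unfolding lf_def by simp
      then show ?thesis using Suc by simp
    qed
  qed
  have Sq: "S (x + real \<nu> *\<^sub>R h) = poly (q (lf \<nu>)) (real \<nu>)" if "\<nu> \<le> k" for \<nu>
    using SP[OF ch(2)[OF lf(1)[OF that]] ch(3)[OF lf[OF that]]] q(2)[OF lf(1)[OF that]] by simp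
  define lg where "lg e \<longleftrightarrow> t < elen e" for e
  \<comment> \<open>\<open>\<alpha> l\<close> and \<open>\<omega> l\<close> are the edges at which the segment enters and leaves its \<open>l\<close>-th piece; the
    polynomial of a piece in \<open>G\<close> is controlled on the whole segment by a long one of these.\<close>
  define G where "G = {l. l < m \<and> (m = 1 \<or> (0 < l \<and> lg (\<alpha> l)) \<or> (Suc l < m \<and> lg (\<omega> l)))}"
  define Q where "Q l \<nu> = (if l \<in> G then poly (q l) (real \<nu>) else 0)" for l and \<nu> :: nat
  define ph where "ph e = (if e \<in> long t x then phi t x e else 0)" for e
  have ph0: "0 \<le> ph e" for e using phi_nonneg[OF t] unfolding ph_def long_def by auto
  define \<Phi> where "\<Phi> l = (if 0 < l then ph (\<alpha> l) else 0) + (if Suc l < m then ph (\<omega> l) else 0)" for l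
  have \<Phi>0: "0 \<le> \<Phi> l" for l unfolding \<Phi>_def using ph0 by auto
  have longI: "e \<in> long t x" if "e \<in> edges" "lg e" "z l \<in> eseg e" "l \<le> m" for e l
    using that zx[OF that(4)] unfolding long_def near_def lg_def by blast
  \<comment> \<open>A short edge of \<open>adj e\<close> that the segment meets lies within
    \<open>real k * t\<close> of \<open>x\<close>, which switches on the second summand of
    \<open>phi\<close>.\<close>
  have ph_ge: "a e \<le> ph e" if e: "e \<in> long t x" and e': "e' \<in> adj e" "\<not> lg e'" "z l \<in> eseg e'" "l \<le> m" for e e' l
  proof -
    have "near x (real k * t) e'" using e' zx[OF e'(4)] unfolding near_def by blast
    then have "phi t x e = a e * ((t / elen e) ^ r + 1)"
      unfolding phi_def using e' by (auto simp: lg_def)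
    moreover have "0 \<le> (t / elen e) ^ r" using t elen_pos[of e] e by (auto simp: long_def)
    ultimately show ?thesis using e a_nonneg[of e] by (simp add: ph_def algebra_simps)
  qed
  have ph_ge': "a e * (t / elen e) ^ r \<le> ph e" if e: "e \<in> long t x" for e
    using e a_nonneg[of e] by (simp add: ph_def phi_def algebra_simps)
  have qa: "\<bar>poly (q l) (real \<nu>)\<bar> \<le> A * a e"
    if "l < m" "\<nu> \<le> k" "e \<in> edges" "fst e = j l" "lg e" "z l' \<in> eseg e" "l' \<le> m" for l \<nu> e l'
  proof -
    have "dist (x + real \<nu> *\<^sub>R h) (z l') = \<bar>real \<nu> - u l'\<bar> * norm h"
      by (simp add: z_def dist_norm scaleR_left_diff_distrib[symmetric])
    also have "\<dots> \<le> real k * t" using u_range[OF that(7)] that(2) h by (intro mult_mono) auto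
    also have "\<dots> \<le> K * elen e" using that(5) K t k1 by (intro mult_mono) (auto simp: lg_def)
    finally have "near (x + real \<nu> *\<^sub>R h) (K * elen e) e" using that(6) unfolding near_def by blast
    from edge_control[OF that(3) this] show ?thesis using q(2)[OF that(1)] that(4) by simp
  qed
  have controlled: "\<bar>Q l \<nu>\<bar> \<le> A * \<Phi> l"
    if "l < m" "\<nu> \<le> k" "e \<in> edges \<and> fst e = j l \<and> z i \<in> eseg e" "lg e" "i \<le> m"
      "e' \<in> adj e" "\<not> lg e'" "z i' \<in> eseg e'" "i' \<le> m" "ph e \<le> \<Phi> l" for l \<nu> e i e' i'
  proof -
    have "a e \<le> ph e" using that longI[of e i] by (intro ph_ge[of e e' i']) auto
    then have "A * a e \<le> A * \<Phi> l" using A that(10) by (intro mult_left_mono) auto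
    moreover have "\<bar>poly (q l) (real \<nu>)\<bar> \<le> A * a e" by (rule qa[of l \<nu> e i]) (use that in auto)
    ultimately show ?thesis using A \<Phi>0[of l] by (simp add: Q_def)
  qed

  \<comment> \<open>Pieces outside \<open>G\<close> enter with their values only; those in \<open>G\<close> are summed by parts along the chain.\<close>
  have split: "(\<Sum>\<nu>\<le>k. cf \<nu> * S (x + real \<nu> *\<^sub>R h)) =
      (\<Sum>\<nu>\<le>k. cf \<nu> * (if lf \<nu> \<in> G then 0 else S (x + real \<nu> *\<^sub>R h))) + (\<Sum>\<nu>\<le>k. cf \<nu> * Q (lf \<nu>) \<nu>)"
    unfolding sum.distrib[symmetric] by (intro sum.cong) (auto simp: Q_def Sq)
  have chain: "(\<Sum>\<nu>\<le>k. cf \<nu> * Q (lf \<nu>) \<nu>) = (\<Sum>\<nu>\<le>k. cf \<nu> * Q 0 \<nu>)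
     + (\<Sum>l<m - 1. \<Sum>\<nu>\<in>{\<nu>\<in>{..k}. l < lf \<nu>}. cf \<nu> * (Q (Suc l) \<nu> - Q l \<nu>))"
    by (rule sum_along_chain) (use lf in auto)
  have first: "(\<Sum>\<nu>\<le>k. cf \<nu> * Q 0 \<nu>) = 0"
    using kth_difference_poly[OF q(1)[OF m(1)]] by (cases "0 \<in> G") (simp_all add: Q_def cf_def)

  have crossing_bound: "\<bar>\<Sum>\<nu>\<in>{\<nu>\<in>{..k}. l < lf \<nu>}. cf \<nu> * (Q (Suc l) \<nu> - Q l \<nu>)\<bar> \<le> D * (\<Phi> l + \<Phi> (Suc l))"
    if l: "l < m - 1" for l
  proof -
    have sl: "Suc l < m" "l < m" using l by auto
    note w = \<omega>[OF sl(1)] and al = \<alpha>[OF zero_less_Suc sl(1)]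
    have "\<bar>Q (Suc l) \<nu> - Q l \<nu>\<bar> \<le> (real k ^ (k + 1) * (B * A) + A) * (\<Phi> l + \<Phi> (Suc l))" if v: "\<nu> \<le> k" for \<nu>
    proof (cases "lg (\<omega> l) \<and> lg (\<alpha> (Suc l))")
      case True
      have G: "l \<in> G" "Suc l \<in> G" using sl True by (auto simp: G_def)
      have zv: "x + real \<nu> *\<^sub>R h = z (Suc l) + (real \<nu> - u (Suc l)) *\<^sub>R h" by (simp add: z_def algebra_simps)
      have "Q (Suc l) \<nu> - Q l \<nu> = P (fst (\<alpha> (Suc l))) (x + real \<nu> *\<^sub>R h) - P (fst (\<omega> l)) (x + real \<nu> *\<^sub>R h)"
        using G q(2)[OF sl(1)] q(2)[OF sl(2)] w al by (simp add: Q_def)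
      also have "\<bar>\<dots>\<bar> \<le> real k ^ (k + 1) * (B * A) *
         (a (\<alpha> (Suc l)) * (t / elen (\<alpha> (Suc l))) ^ r + a (\<omega> l) * (t / elen (\<omega> l)) ^ r)"
        unfolding zv
      proof (rule smooth_crossing_bound)
        show "\<bar>real \<nu> - u (Suc l)\<bar> \<le> real k" using u_range[of "Suc l"] sl v by auto
        show "z (Suc l) \<in> R (fst (\<alpha> (Suc l)))" "z (Suc l) \<in> R (fst (\<omega> l))"
          using zR[OF sl(1)] zR[OF sl(2)] w al by auto
      qed (use w al h True in \<open>auto simp: lg_def\<close>)
      also have "\<dots> \<le> real k ^ (k + 1) * (B * A) * (\<Phi> (Suc l) + \<Phi> l)"
      proof (intro mult_left_mono add_mono)
        have "a (\<alpha> (Suc l)) * (t / elen (\<alpha> (Suc l))) ^ r \<le> ph (\<alpha> (Suc l))"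
          by (rule ph_ge'[OF longI[of _ "Suc l"]]) (use al True sl in auto)
        also have "\<dots> \<le> \<Phi> (Suc l)" using ph0 by (simp add: \<Phi>_def)
        finally show "a (\<alpha> (Suc l)) * (t / elen (\<alpha> (Suc l))) ^ r \<le> \<Phi> (Suc l)" .
        have "a (\<omega> l) * (t / elen (\<omega> l)) ^ r \<le> ph (\<omega> l)"
          by (rule ph_ge'[OF longI[of _ "Suc l"]]) (use w True sl in auto)
        also have "\<dots> \<le> \<Phi> l" using ph0 sl by (simp add: \<Phi>_def)
        finally show "a (\<omega> l) * (t / elen (\<omega> l)) ^ r \<le> \<Phi> l" .
      qed (use A B in auto)
      also have "\<dots> \<le> (real k ^ (k + 1) * (B * A) + A) * (\<Phi> l + \<Phi> (Suc l))"
        using A \<Phi>0[of l] \<Phi>0[of "Suc l"] by (simp add: algebra_simps)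
      finally show ?thesis .
    next
      \<comment> \<open>One of the two edges at the joint is short, and each polynomial is bounded
        by itself. If its own edge at the joint is long, the short one across touches it and lies in
        its \<open>adj\<close>. Otherwise its own short edge lies in \<open>adj\<close> of the long
        edge at the other end of the piece, which exists by membership in \<open>G\<close>.\<close>
      case False
      have Ql: "\<bar>Q l \<nu>\<bar> \<le> A * \<Phi> l"
      proof (cases "l \<in> G")
        case G: True
        have "ph (\<omega> l) \<le> \<Phi> l" using ph0 sl by (simp add: \<Phi>_def)
        show ?thesis
        proof (cases "lg (\<omega> l)")
          case True
          then have "\<not> lg (\<alpha> (Suc l))" "\<alpha> (Suc l) \<in> adj (\<omega> l)"
            using False w al unfolding adj_def lg_def by auto
          then show ?thesis using w al sl v True \<open>ph (\<omega> l) \<le> \<Phi> l\<close>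
            by (intro controlled[of l \<nu> "\<omega> l" "Suc l" "\<alpha> (Suc l)" "Suc l"]) auto
        next
          case s: False
          then have al': "0 < l" "lg (\<alpha> l)" using G sl by (auto simp: G_def)
          note all = \<alpha>[OF al'(1) sl(2)]
          have "\<omega> l \<in> adj (\<alpha> l)" using w all unfolding adj_def by auto
          moreover have "ph (\<alpha> l) \<le> \<Phi> l" using ph0 al' by (simp add: \<Phi>_def)
          ultimately show ?thesis using w all al' sl v s
            by (intro controlled[of l \<nu> "\<alpha> l" l "\<omega> l" "Suc l"]) auto
        qed
      qed (use A \<Phi>0 in \<open>simp add: Q_def\<close>)
      have Qs: "\<bar>Q (Suc l) \<nu>\<bar> \<le> A * \<Phi> (Suc l)"
      proof (cases "Suc l \<in> G")
        case G: True
        have "ph (\<alpha> (Suc l)) \<le> \<Phi> (Suc l)" using ph0 by (simp add: \<Phi>_def)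
        show ?thesis
        proof (cases "lg (\<alpha> (Suc l))")
          case True
          then have "\<not> lg (\<omega> l)" "\<omega> l \<in> adj (\<alpha> (Suc l))"
            using False w al unfolding adj_def lg_def by auto
          then show ?thesis using w al sl v True \<open>ph (\<alpha> (Suc l)) \<le> \<Phi> (Suc l)\<close>
            by (intro controlled[of "Suc l" \<nu> "\<alpha> (Suc l)" "Suc l" "\<omega> l" "Suc l"]) auto
        next
          case s: False
          then have w': "Suc (Suc l) < m" "lg (\<omega> (Suc l))" using G sl by (auto simp: G_def)
          note ww = \<omega>[OF w'(1)]
          have "\<alpha> (Suc l) \<in> adj (\<omega> (Suc l))" using al ww unfolding adj_def by auto
          moreover have "ph (\<omega> (Suc l)) \<le> \<Phi> (Suc l)" using ph0 w' by (simp add: \<Phi>_def)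
          ultimately show ?thesis using al ww w' sl v s
            by (intro controlled[of "Suc l" \<nu> "\<omega> (Suc l)" "Suc (Suc l)" "\<alpha> (Suc l)" "Suc l"]) auto
        qed
      qed (use A \<Phi>0 in \<open>simp add: Q_def\<close>)
      have "\<bar>Q (Suc l) \<nu> - Q l \<nu>\<bar> \<le> A * (\<Phi> l + \<Phi> (Suc l))"
        using Ql Qs unfolding distrib_left by linarith
      also have "\<dots> \<le> (real k ^ (k + 1) * (B * A) + A) * (\<Phi> l + \<Phi> (Suc l))"
        using A B \<Phi>0[of l] \<Phi>0[of "Suc l"] by (intro mult_right_mono) auto
      finally show ?thesis .
    qed
    moreover have "card {\<nu>\<in>{..k}. l < lf \<nu>} \<le> k + 1"
      by (rule order_trans[OF card_mono[of "{..k}"]]) auto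
    ultimately have "\<bar>\<Sum>\<nu>\<in>{\<nu>\<in>{..k}. l < lf \<nu>}. cf \<nu> * (Q (Suc l) \<nu> - Q l \<nu>)\<bar>
        \<le> (real k + 1) * 2 ^ k * ((real k ^ (k + 1) * (B * A) + A) * (\<Phi> l + \<Phi> (Suc l)))"
      using cf A B \<Phi>0[of l] \<Phi>0[of "Suc l"] by (intro crossing_terms_bound) auto
    then show ?thesis by (simp add: D_def mult.assoc)
  qed

  \<comment> \<open>A generic line meets an edge at one parameter only, so edges chosen at different
    joints are different and the sum over joints embeds into one over edges. The map
    \<open>i\<close> is the identity for entries and \<open>Suc\<close> for exits.\<close>
  have inj_sum: "(\<Sum>l\<in>I. ph (f l)) \<le> (\<Sum>e\<in>long t x. phi t x e)"
    if I: "finite I" and f: "\<And>l. l \<in> I \<Longrightarrow> f l \<in> edges \<and> i l \<le> m \<and> z (i l) \<in> eseg (f l)" and i: "inj_on i I" for I :: "nat set" and f i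
  proof -
    have "inj_on f I"
    proof (rule inj_onI)
      fix l l' assume l: "l \<in> I" "l' \<in> I" "f l = f l'"
      have "x + u (i l) *\<^sub>R h \<in> eseg (f l)" "x + u (i l') *\<^sub>R h \<in> eseg (f l)"
        using f[OF l(1)] f[OF l(2)] l(3) by (auto simp: z_def)
      then have "u (i l) = u (i l')" using gen f[OF l(1)] unfolding generic_def by blast
      then have "i l = i l'" using mono[of "i l" "i l'"] mono[of "i l'" "i l"] f[OF l(1)] f[OF l(2)]
        by (metis less_irrefl linorder_neqE_nat)
      then show "l = l'" using i l by (auto dest: inj_onD)
    qed
    then have "(\<Sum>l\<in>I. ph (f l)) = (\<Sum>e\<in>f ` I. ph e)" by (simp add: sum.reindex)
    also have "\<dots> \<le> (\<Sum>e\<in>edges. ph e)" using f ph0 finite_edges by (intro sum_mono2) auto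
    also have "\<dots> = (\<Sum>e\<in>long t x. phi t x e)"
      by (intro sum.mono_neutral_cong_right finite_edges) (auto simp: long_def ph_def)
    finally show ?thesis .
  qed
  have \<Phi>_sum: "(\<Sum>l<m. \<Phi> l) \<le> 2 * (\<Sum>e\<in>long t x. phi t x e)"
  proof -
    have "(\<Sum>l<m. \<Phi> l) = (\<Sum>l\<in>{l\<in>{..<m}. 0 < l}. ph (\<alpha> l)) + (\<Sum>l\<in>{l\<in>{..<m}. Suc l < m}. ph (\<omega> l))"
      unfolding \<Phi>_def sum.distrib by (simp only: sum.inter_filter[OF finite_lessThan])
    also have "\<dots> \<le> (\<Sum>e\<in>long t x. phi t x e) + (\<Sum>e\<in>long t x. phi t x e)"
      using \<alpha> \<omega> by (intro add_mono inj_sum[where i="\<lambda>l. l"] inj_sum[where i=Suc]) auto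
    finally show ?thesis by simp
  qed
  \<comment> \<open>The factor 4 arises as 2 times 2: each \<Phi> occurs in the jumps at both ends
    of its piece, and consists of an entry and an exit edge.\<close>
  have "\<bar>\<Sum>\<nu>\<le>k. cf \<nu> * Q (lf \<nu>) \<nu>\<bar> \<le> (\<Sum>l<m - 1. D * (\<Phi> l + \<Phi> (Suc l)))"
    unfolding chain first by (simp only: add_0_left) (intro order_trans[OF sum_abs] sum_mono crossing_bound, auto)
  also have "\<dots> = D * ((\<Sum>l<m - 1. \<Phi> l) + (\<Sum>l<m - 1. \<Phi> (Suc l)))"
    by (simp add: sum_distrib_left[symmetric] sum.distrib)
  also have "\<dots> \<le> D * ((\<Sum>l<m. \<Phi> l) + (\<Sum>l<m. \<Phi> l))"
  proof (intro mult_left_mono add_mono D_nonneg)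
    show "(\<Sum>l<m - 1. \<Phi> l) \<le> (\<Sum>l<m. \<Phi> l)" using \<Phi>0 by (intro sum_mono2) auto
    have "(\<Sum>l<m - 1. \<Phi> (Suc l)) = (\<Sum>l\<in>Suc ` {..<m - 1}. \<Phi> l)" by (simp add: sum.reindex)
    also have "\<dots> \<le> (\<Sum>l<m. \<Phi> l)" using \<Phi>0 by (intro sum_mono2) auto
    finally show "(\<Sum>l<m - 1. \<Phi> (Suc l)) \<le> (\<Sum>l<m. \<Phi> l)" .
  qed
  also have "\<dots> \<le> D * (2 * (\<Sum>e\<in>long t x. phi t x e) + 2 * (\<Sum>e\<in>long t x. phi t x e))"
    by (intro mult_left_mono add_mono \<Phi>_sum D_nonneg)
  finally have main: "\<bar>\<Sum>\<nu>\<le>k. cf \<nu> * Q (lf \<nu>) \<nu>\<bar> \<le> 4 * D * (\<Sum>e\<in>long t x. phi t x e)" by simp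

  \<comment> \<open>A piece outside \<open>G\<close> belongs to a chain of several pieces, so it has
    an entry or exit edge, and such an edge is short. Every node is within \<open>real k * t\<close>
    of the point where the segment meets it.\<close>
  have unc: "\<bar>if lf \<nu> \<in> G then 0 else S (x + real \<nu> *\<^sub>R h)\<bar> \<le> psi t (x + real \<nu> *\<^sub>R h)" if v: "\<nu> \<le> k" for \<nu>
  proof (cases "lf \<nu> \<in> G")
    case False
    define l where "l = lf \<nu>"
    note lf' = lf[OF v, folded l_def]
    have ends: "m \<noteq> 1" "0 < l \<Longrightarrow> \<not> lg (\<alpha> l)" "Suc l < m \<Longrightarrow> \<not> lg (\<omega> l)"
      using False lf'(1) by (auto simp: G_def l_def)
    have "\<exists>e l'. e \<in> edges \<and> fst e = j l \<and> \<not> lg e \<and> l' \<le> m \<and> z l' \<in> eseg e"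
    proof (cases "0 < l")
      case True
      then show ?thesis using \<alpha>[OF True lf'(1)] ends(2) lf'(1) by (intro exI[of _ "\<alpha> l"] exI[of _ l]) auto
    next
      case l0: False
      then have "Suc l < m" using ends(1) m(1) by auto
      then show ?thesis using \<omega>[of l] ends(3) by (intro exI[of _ "\<omega> l"] exI[of _ "Suc l"]) auto
    qed
    then obtain e l' where e: "e \<in> edges" "fst e = j l" "\<not> lg e" "l' \<le> m" "z l' \<in> eseg e" by blast
    have "dist (x + real \<nu> *\<^sub>R h) (z l') = \<bar>real \<nu> - u l'\<bar> * norm h"
      by (simp add: z_def dist_norm scaleR_left_diff_distrib[symmetric])
    also have "\<dots> \<le> real k * t" using u_range[OF e(4)] v h by (intro mult_mono) auto
    finally have "near (x + real \<nu> *\<^sub>R h) (real k * t) e" using e(5) unfolding near_def by blast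
    moreover have "x + real \<nu> *\<^sub>R h \<in> R (j l)" by (rule ch(3)[OF lf'])
    ultimately have "\<exists>j<n. x + real \<nu> *\<^sub>R h \<in> R j \<and> (\<exists>e\<in>edges. fst e = j \<and> elen e \<le> t \<and> near (x + real \<nu> *\<^sub>R h) (real k * t) e)"
      using e ch(2)[OF lf'(1)] by (intro exI[of _ "j l"]) (auto simp: lg_def)
    then show ?thesis by (simp add: psi_def False)
  qed (simp add: psi_nonneg)
  have "\<bar>\<Sum>\<nu>\<le>k. cf \<nu> * (if lf \<nu> \<in> G then 0 else S (x + real \<nu> *\<^sub>R h))\<bar> \<le> (\<Sum>\<nu>\<le>k. 2 ^ k * psi t (x + real \<nu> *\<^sub>R h))"
  proof (intro order_trans[OF sum_abs] sum_mono)
    fix \<nu> assume "\<nu> \<in> {..k}"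
    then show "\<bar>cf \<nu> * (if lf \<nu> \<in> G then 0 else S (x + real \<nu> *\<^sub>R h))\<bar> \<le> 2 ^ k * psi t (x + real \<nu> *\<^sub>R h)"
      unfolding abs_mult using unc[of \<nu>] cf[of \<nu>] by (intro mult_mono) auto
  qed
  then have "\<bar>\<Sum>\<nu>\<le>k. cf \<nu> * S (x + real \<nu> *\<^sub>R h)\<bar>
     \<le> 4 * D * (\<Sum>e\<in>long t x. phi t x e) + 2 ^ k * (\<Sum>\<nu>\<le>k. psi t (x + real \<nu> *\<^sub>R h))"
    using main unfolding split sum_distrib_left[symmetric] by linarith
  then show ?thesis by (simp add: cf_def)
qed

end

section \<open>Packing of edges\<close>

lemma hyperplane_null_pt:
  fixes w :: pt assumes "w \<noteq> 0"
  shows "{x. w \<bullet> x = b} \<in> null_sets lborel"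
proof -
  have "negligible {x. w \<bullet> x = b}" using assms by (intro negligible_hyperplane) auto
  then have "{x. w \<bullet> x = b} \<in> null_sets lebesgue" by (simp add: negligible_iff_null_sets)
  moreover have "{x. w \<bullet> x = b} \<in> sets lborel" using closed_hyperplane[of w b] by simp
  ultimately show ?thesis by (simp add: null_sets_completion_iff)
qed

context framed_spline
begin

text \<open>A line that meets an edge twice runs along it and passes through its first end point. So
  the bad \<open>x\<close> lie on finitely many parallel lines, through these end points or the
  exceptional points, each described by the normal \<open>rot h\<close>.\<close>

lemma AE_generic:
  assumes h: "h \<noteq> 0"
  shows "AE x in lborel. generic h x"
proof -
  define F where "F = (\<lambda>e. fst (snd e)) ` edges \<union> (\<Union>j<n. X j)"
  have finF: "finite F" using finite_edges X by (auto simp: F_def)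
  have rh: "rot h \<noteq> 0" using h by (auto simp: vec_eq_iff forall_2)
  have perp: "rot h \<bullet> (p + u *\<^sub>R h) = rot h \<bullet> p" for p u
    by (simp add: inner_add_right pt_inner algebra_simps)
  have null: "(\<Union>p\<in>F. {x. rot h \<bullet> x = rot h \<bullet> p}) \<in> null_sets lborel"
    using finF hyperplane_null_pt[OF rh] by (intro null_sets_UN') (auto intro: countable_finite)
  show ?thesis
  proof (rule AE_I'[OF null], rule subsetI)
    fix x assume "x \<in> {x \<in> space lborel. \<not> generic h x}"
    then have ng: "\<not> generic h x" by simp
    have line: "x \<in> (\<Union>p\<in>F. {x. rot h \<bullet> x = rot h \<bullet> p})" if "p \<in> F" "x = p + u *\<^sub>R h" for p u
      using that perp by auto
    from ng consider e u v where "e \<in> edges" "x + u *\<^sub>R h \<in> eseg e" "x + v *\<^sub>R h \<in> eseg e" "u \<noteq> v"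
      | j u where "j < n" "x + u *\<^sub>R h \<in> X j" unfolding generic_def by auto
    then show "x \<in> (\<Union>p\<in>F. {x. rot h \<bullet> x = rot h \<bullet> p})"
    proof cases
      case 1
      define p d where "p = fst (snd e)" and "d = snd (snd e) - fst (snd e)"
      have pF: "p \<in> F" using 1(1) by (auto simp: p_def F_def)
      have on: "\<exists>s. y = p + s *\<^sub>R d" if "y \<in> eseg e" for y
        using that unfolding eseg_def p_def d_def in_segment by (auto simp: algebra_simps intro: exI)
      obtain s s' where s: "x + u *\<^sub>R h = p + s *\<^sub>R d" "x + v *\<^sub>R h = p + s' *\<^sub>R d" using on 1 by metis
      have "(u - v) *\<^sub>R h = (x + u *\<^sub>R h) - (x + v *\<^sub>R h)" by (simp add: algebra_simps)
      also have "\<dots> = (s - s') *\<^sub>R d" unfolding s by (simp add: algebra_simps)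
      finally have eq: "(u - v) *\<^sub>R h = (s - s') *\<^sub>R d" .
      then have ss: "s - s' \<noteq> 0" using h 1(4) by auto
      then have "d = ((u - v) / (s - s')) *\<^sub>R h" using eq by (metis divide_inverse_commute right_inverse scaleR_one scaleR_scaleR left_inverse)
      moreover have "x = p + s *\<^sub>R d - u *\<^sub>R h" using s(1) by (simp add: algebra_simps)
      ultimately have "x = p + (s * ((u - v) / (s - s')) - u) *\<^sub>R h" by (simp add: scaleR_diff_left)
      then show ?thesis using line pF by blast
    next
      case 2
      have "x = (x + u *\<^sub>R h) + (- u) *\<^sub>R h" by simp
      then show ?thesis using line[of "x + u *\<^sub>R h" "- u"] 2 by (auto simp: F_def)
    qed
  qed
qed

lemma fat_edge:
  assumes "e \<in> edges"
  obtains z0 where "fat_at c (R (fst e)) (fst (snd e)) (snd (snd e)) z0"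
  using fat[of "fst e" "fst (snd e)" "snd (snd e)"] edges_less[OF assms] edges_H[OF assms] by auto

lemma card_edges_of_ring: "j < n \<Longrightarrow> card {e \<in> edges. fst e = j} \<le> N"
proof -
  assume j: "j < n"
  have "{e \<in> edges. fst e = j} = Pair j ` H j" using j by (auto simp: edges_def)
  then have "card {e \<in> edges. fst e = j} \<le> card (H j)" using H[OF j] by (simp add: card_image_le)
  then show ?thesis using H[OF j] by linarith
qed

lemma card_edges: "card edges \<le> n * N"
proof -
  have "card edges = (\<Sum>j<n. card (H j))" unfolding edges_def using H by (subst card_SigmaI) auto
  also have "\<dots> \<le> (\<Sum>j<n. N)" using H by (intro sum_mono) auto
  finally show ?thesis by simp
qed

text \<open>Since the interiors of the rings are disjoint, all \<open>U e\<close> containing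
  \<open>w\<close> belong to one ring, which has at most \<open>N\<close> half-edges.\<close>

lemma card_overlap_le:
  assumes L: "L \<subseteq> edges" and U: "\<And>e. e \<in> L \<Longrightarrow> open (U e) \<and> U e \<subseteq> R (fst e)"
  shows "card {e \<in> L. w \<in> U e} \<le> N"
proof (cases "{e \<in> L. w \<in> U e} = {}")
  case False
  then obtain e where e: "e \<in> L" "w \<in> U e" by blast
  have int: "w \<in> interior (R (fst e'))" if "e' \<in> L" "w \<in> U e'" for e'
    using that U[OF that(1)] interior_maximal[of "U e'"] by blast
  have "fst e' = fst e" if "e' \<in> L" "w \<in> U e'" for e'
    using int[OF that] int[OF e] disj[of "fst e'" "fst e"] edges_less that e L by blast
  then have "{e \<in> L. w \<in> U e} \<subseteq> {e' \<in> edges. fst e' = fst e}" using L by auto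
  then have "card {e \<in> L. w \<in> U e} \<le> card {e' \<in> edges. fst e' = fst e}"
    using finite_edges by (intro card_mono) auto
  also have "\<dots> \<le> N" using e L by (intro card_edges_of_ring edges_less) auto
  finally show ?thesis .
qed (use card.empty in \<open>metis le0\<close>)

lemma sum_indicator_overlap_le:
  assumes L: "L \<subseteq> edges" and U: "\<And>e. e \<in> L \<Longrightarrow> open (U e) \<and> U e \<subseteq> R (fst e)"
  shows "(\<Sum>e\<in>L. indicator (U e) w :: ennreal) \<le> ennreal (real N) * indicator (\<Union>e\<in>L. U e) w"
proof -
  have finL: "finite L" using L finite_edges finite_subset by blast
  have "(\<Sum>e\<in>L. indicator (U e) w :: ennreal) = (\<Sum>e\<in>{e \<in> L. w \<in> U e}. 1)"
    unfolding sum.inter_filter[OF finL] by (intro sum.cong) (auto simp: indicator_def)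
  also have "\<dots> = ennreal (real (card {e \<in> L. w \<in> U e}))"
    by (simp add: ennreal_of_nat_eq_real_of_nat)
  also have "\<dots> \<le> ennreal (real N) * indicator (\<Union>e\<in>L. U e) w"
  proof (cases "w \<in> (\<Union>e\<in>L. U e)")
    case True
    then show ?thesis using card_overlap_le[OF L U, of w] by (simp add: ennreal_leI)
  next
    case False
    then have "{e \<in> L. w \<in> U e} = {}" by blast
    then show ?thesis by (metis card.empty ennreal_0 of_nat_0 zero_le)
  qed
  finally show ?thesis .
qed

text \<open>The ratio of the areas of discs of radius \<open>(k + 2) * t\<close> and
  \<open>c * t\<close>, times the possible overlap \<open>N\<close>.\<close>

definition M :: real where "M = real N * (real k + 2)^2 / c^2"

lemma M_nonneg: "0 \<le> M" by (simp add: M_def)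

text \<open>The triangles on long edges near \<open>x\<close> occupy a fixed fraction of a ball around \<open>x\<close>.\<close>

lemma packing:
  assumes t: "0 < t"
  shows "real (card {e \<in> edges. t \<le> elen e \<and> near x (real k * t) e}) \<le> M"
proof -
  define L where "L = {e \<in> edges. t \<le> elen e \<and> near x (real k * t) e}"
  have finL: "finite L" using finite_edges by (simp add: L_def)
  have "\<exists>y. ball y (c * t) \<subseteq> R (fst e) \<and> ball y (c * t) \<subseteq> ball x ((real k + 2) * t)" if e: "e \<in> L" for e
  proof -
    have ee: "e \<in> edges" "t \<le> elen e" using e by (auto simp: L_def)
    obtain z where z: "z \<in> eseg e" "dist x z \<le> real k * t" using e by (auto simp: L_def near_def)
    obtain z0 where z0: "fat_at c (R (fst e)) (fst (snd e)) (snd (snd e)) z0" using fat_edge[OF ee(1)] .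
    \<comment> \<open>With this \<theta> the ball has radius \<open>c * t\<close> whatever the
      length of the edge. Its centre is within \<open>t\<close> of \<open>z\<close>, and
      \<open>z\<close> within \<open>k * t\<close> of \<open>x\<close>; as \<open>c \<le> 1\<close>,
      the radius \<open>(k + 2) * t\<close> contains it.\<close>
    define \<theta> where "\<theta> = t / elen e"
    have th: "\<theta> \<in> {0..1}" "\<theta> * elen e = t" using ee t elen_pos[OF ee(1)] by (auto simp: \<theta>_def divide_le_eq)
    have ball: "ball (z + \<theta> *\<^sub>R (z0 - z)) (\<theta> * (c * elen e)) \<subseteq> R (fst e)" and d0: "dist z z0 \<le> elen e"
      using z0 z(1) th(1) unfolding fat_at_def eseg_def elen_def by auto
    define y where "y = z + \<theta> *\<^sub>R (z0 - z)"
    have rad: "\<theta> * (c * elen e) = c * t" using th(2) by (simp add: mult_ac)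
    have "dist z y = \<theta> * dist z z0" using th by (simp add: y_def dist_norm norm_minus_commute)
    also have "\<dots> \<le> \<theta> * elen e" using d0 th by (intro mult_left_mono) auto
    finally have "dist x y \<le> real k * t + t" using z(2) th(2) dist_triangle[of x y z] by (simp add: algebra_simps)
    moreover have "c * t \<le> t" using c t by simp
    ultimately have "dist x y + c * t \<le> (real k + 2) * t" by (simp add: algebra_simps)
    then have "w \<in> ball x ((real k + 2) * t)" if "w \<in> ball y (c * t)" for w
      using dist_triangle[of x w y] that by simp
    then have "ball y (c * t) \<subseteq> ball x ((real k + 2) * t)" by blast
    then show ?thesis using ball unfolding rad y_def[symmetric] by blast
  qed
  then obtain y where y: "\<And>e. e \<in> L \<Longrightarrow> ball (y e) (c * t) \<subseteq> R (fst e)"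
      "\<And>e. e \<in> L \<Longrightarrow> ball (y e) (c * t) \<subseteq> ball x ((real k + 2) * t)" by metis
  have ct: "0 \<le> c * t" "0 \<le> (real k + 2) * t" using c t by auto
  have "ennreal (real (card L) * (pi * (c * t)^2)) = (\<Sum>e\<in>L. emeasure lborel (ball (y e) (c * t)))"
    using ct by (simp add: emeasure_ball_pt ennreal_mult' ennreal_of_nat_eq_real_of_nat)
  also have "\<dots> = (\<integral>\<^sup>+w. (\<Sum>e\<in>L. indicator (ball (y e) (c * t)) w) \<partial>lborel)"
    by (subst nn_integral_sum) (auto intro!: borel_measurable_indicator)
  also have "\<dots> \<le> (\<integral>\<^sup>+w. ennreal (real N) * indicator (ball x ((real k + 2) * t)) w \<partial>lborel)"
  proof (intro nn_integral_mono)
    fix w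
    have "(\<Sum>e\<in>L. indicator (ball (y e) (c * t)) w :: ennreal) \<le> ennreal (real N) * indicator (\<Union>e\<in>L. ball (y e) (c * t)) w"
      by (rule sum_indicator_overlap_le) (use y in \<open>auto simp: L_def\<close>)
    also have "\<dots> \<le> ennreal (real N) * indicator (ball x ((real k + 2) * t)) w"
      using y(2) by (intro mult_left_mono) (force simp: indicator_def)+
    finally show "(\<Sum>e\<in>L. indicator (ball (y e) (c * t)) w) \<le> ennreal (real N) * indicator (ball x ((real k + 2) * t)) w" .
  qed
  also have "\<dots> = ennreal (real N * (pi * ((real k + 2) * t)^2))"
    using ct by (simp add: nn_integral_cmult_indicator emeasure_ball_pt ennreal_mult')
  finally have "real (card L) * (pi * (c * t)^2) \<le> real N * (pi * ((real k + 2) * t)^2)"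
    by (subst (asm) ennreal_le_iff) auto
  then have "(real (card L) * c^2) * (pi * t^2) \<le> (real N * (real k + 2)^2) * (pi * t^2)"
    by (simp add: power_mult_distrib mult_ac)
  then have "real (card L) * c^2 \<le> real N * (real k + 2)^2" using t pi_gt_zero by (simp add: mult_le_cancel_right)
  then show ?thesis using c unfolding M_def L_def by (simp add: le_divide_eq)
qed

lemma finite_adj: "finite (adj e)"
  using finite_edges by (simp add: adj_def)

lemma adj_refl: "e \<in> edges \<Longrightarrow> e \<in> adj e"
  by (simp add: adj_def)

text \<open>Double counting from the shorter edge \<open>e'\<close>: the edges of at least its
  length that touch it are near its first end point at scale \<open>elen e'\<close>, so
  \<open>packing\<close> bounds their number. The edges of the same ring add at most
  \<open>N\<close> each.\<close>

lemma sum_card_adj: "(\<Sum>e\<in>edges. real (card (adj e))) \<le> real n * (real N * (M + real N))"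
proof -
  define T where "T e = {e' \<in> edges. elen e' \<le> elen e \<and> eseg e \<inter> eseg e' \<noteq> {}}" for e
  have "card (adj e) \<le> card (T e) + N" if "e \<in> edges" for e
  proof -
    have "adj e = T e \<union> {e' \<in> edges. fst e' = fst e}" by (auto simp: adj_def T_def)
    then have "card (adj e) \<le> card (T e) + card {e' \<in> edges. fst e' = fst e}" by (simp add: card_Un_le)
    then show ?thesis using card_edges_of_ring[OF edges_less[OF that]] by linarith
  qed
  then have "(\<Sum>e\<in>edges. real (card (adj e))) \<le> (\<Sum>e\<in>edges. real (card (T e)) + real N)"
    by (intro sum_mono) (metis of_nat_add of_nat_mono)
  also have "\<dots> = (\<Sum>e\<in>edges. real (card (T e))) + real (card edges) * real N" by (simp add: sum.distrib)
  also have "(\<Sum>e\<in>edges. real (card (T e))) = (\<Sum>e\<in>edges. \<Sum>e'\<in>{e' \<in> edges. elen e' \<le> elen e \<and> eseg e \<inter> eseg e' \<noteq> {}}. 1)"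
    by (simp add: T_def)
  also have "\<dots> = (\<Sum>e'\<in>edges. \<Sum>e\<in>{e \<in> edges. elen e' \<le> elen e \<and> eseg e \<inter> eseg e' \<noteq> {}}. 1)"
    by (rule sum.swap_restrict[OF finite_edges finite_edges])
  also have "\<dots> \<le> (\<Sum>e'\<in>edges. M)"
  proof (rule sum_mono)
    fix e' assume e': "e' \<in> edges"
    have "{e \<in> edges. elen e' \<le> elen e \<and> eseg e \<inter> eseg e' \<noteq> {}} \<subseteq>
        {e \<in> edges. elen e' \<le> elen e \<and> near (fst (snd e')) (real k * elen e') e}"
    proof
      fix e assume "e \<in> {e \<in> edges. elen e' \<le> elen e \<and> eseg e \<inter> eseg e' \<noteq> {}}"
      then obtain z where e: "e \<in> edges" "elen e' \<le> elen e" "z \<in> eseg e" "z \<in> eseg e'" by auto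
      have "dist (fst (snd e')) z \<le> 1 * elen e'"
        using e(4) unfolding eseg_def elen_def mult_1 by (intro dist_le_segment_length) auto
      also have "\<dots> \<le> real k * elen e'" using k1 elen_pos[OF e'] by (intro mult_right_mono) auto
      finally have "near (fst (snd e')) (real k * elen e') e" using e(3) unfolding near_def by blast
      then show "e \<in> {e \<in> edges. elen e' \<le> elen e \<and> near (fst (snd e')) (real k * elen e') e}" using e by simp
    qed
    then have "card {e \<in> edges. elen e' \<le> elen e \<and> eseg e \<inter> eseg e' \<noteq> {}} \<le>
        card {e \<in> edges. elen e' \<le> elen e \<and> near (fst (snd e')) (real k * elen e') e}"
      using finite_edges by (intro card_mono) auto
    then show "(\<Sum>e\<in>{e \<in> edges. elen e' \<le> elen e \<and> eseg e \<inter> eseg e' \<noteq> {}}. 1) \<le> M"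
      using packing[OF elen_pos[OF e'], of "fst (snd e')"] by simp
  qed
  also have "(\<Sum>e'\<in>edges. M) + real (card edges) * real N = real (card edges) * (M + real N)"
    by (simp add: distrib_left)
  also have "\<dots> \<le> (real n * real N) * (M + real N)"
    using card_edges M_nonneg by (intro mult_right_mono) (auto simp flip: of_nat_mult)
  finally show ?thesis by (simp add: mult.assoc)
qed

end

section \<open>Integral bounds for differences\<close>

lemma add_powr_le:
  fixes x y \<tau> :: real
  assumes "0 \<le> x" "0 \<le> y" "0 < \<tau>"
  shows "(x + y) powr \<tau> \<le> 2 powr \<tau> * (x powr \<tau> + y powr \<tau>)"
  using sum_powr_le[of "{True, False}" "\<lambda>b. if b then x else y" \<tau>] assms by (simp add: UNIV_bool)

context framed_spline
begin

lemma closed_near: "closed {x. near (x + w) d e}"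
proof -
  have "near y d e \<longleftrightarrow> infdist y (eseg e) \<le> d" for y
  proof
    assume "near y d e"
    then show "infdist y (eseg e) \<le> d" unfolding near_def using infdist_le2 by blast
  next
    have "closed (eseg e)" "eseg e \<noteq> {}" by (auto simp: eseg_def)
    then obtain z where "z \<in> eseg e" "infdist y (eseg e) = dist y z" using infdist_attains_inf by metis
    moreover assume "infdist y (eseg e) \<le> d"
    ultimately show "near y d e" unfolding near_def by auto
  qed
  then show ?thesis by (simp add: closed_Collect_le continuous_on_infdist continuous_intros)
qed

text \<open>The strip is covered by balls of radius \<open>(k + 1) * t\<close> with centres spaced
  by at most \<open>t\<close> along the edge. Since \<open>t < elen e\<close>, at most
  \<open>3 * elen e / t\<close> of them suffice.\<close>

lemma measure_near:
  assumes e: "e \<in> edges" and t: "0 < t" "t < elen e"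
  shows "emeasure lborel {x. near x (real k * t) e} \<le> ennreal (3 * pi * (real k + 1)^2 * (t * elen e))"
proof -
  define u d l where "u = fst (snd e)" and "d = snd (snd e) - fst (snd e)" and "l = elen e"
  have nd: "norm d = l" by (simp add: d_def l_def elen_def dist_norm norm_minus_commute)
  define m where "m = nat \<lceil>l / t\<rceil>"
  have l0: "0 < l" using t by (simp add: l_def)
  have m1: "l / t \<le> real m" using l0 t unfolding m_def by (simp add: of_nat_ceiling)
  have m2: "real m \<le> l / t + 1" using l0 t unfolding m_def by (simp add: le_divide_eq)
  have lt: "1 \<le> l / t" using t by (simp add: l_def)
  then have m0: "0 < real m" using m1 by linarith
  define B where "B i = cball (u + (real i / real m) *\<^sub>R d) ((real k + 1) * t)" for i
  have "{x. near x (real k * t) e} \<subseteq> (\<Union>i\<in>{..m}. B i)"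
  proof
    fix x assume "x \<in> {x. near x (real k * t) e}"
    then obtain z where z: "z \<in> eseg e" "dist x z \<le> real k * t" by (auto simp: near_def)
    then obtain s where s: "0 \<le> s" "s \<le> 1" "z = u + s *\<^sub>R d"
      unfolding eseg_def in_segment u_def d_def by (auto simp: algebra_simps)
    define i where "i = nat \<lfloor>s * real m\<rfloor>"
    have i: "real i \<le> s * real m" "s * real m \<le> real i + 1"
      using s m0 unfolding i_def by (simp_all add: of_nat_floor)
    have "s * real m \<le> 1 * real m" using s by (intro mult_right_mono) auto
    then have "i \<le> m" using i(1) by simp
    moreover have "x \<in> B i"
    proof -
      have "z - (u + (real i / real m) *\<^sub>R d) = (s - real i / real m) *\<^sub>R d" unfolding s(3) by (simp add: algebra_simps)
      then have "dist z (u + (real i / real m) *\<^sub>R d) = \<bar>s - real i / real m\<bar> * l" by (simp add: dist_norm nd)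
      also have "s - real i / real m = (s * real m - real i) / real m" using m0 by (simp add: field_simps)
      also have "\<bar>(s * real m - real i) / real m\<bar> * l \<le> 1 / real m * l"
      proof (rule mult_right_mono)
        have "\<bar>(s * real m - real i) / real m\<bar> = \<bar>s * real m - real i\<bar> / real m" by (simp add: abs_divide)
        also have "\<dots> \<le> 1 / real m" using i m0 by (intro divide_right_mono) auto
        finally show "\<bar>(s * real m - real i) / real m\<bar> \<le> 1 / real m" .
      qed (use l0 in simp)
      also have "\<dots> \<le> t" using m1 t m0 by (simp add: field_simps)
      finally have "dist x (u + (real i / real m) *\<^sub>R d) \<le> real k * t + t"
        using z(2) dist_triangle[of x "u + (real i / real m) *\<^sub>R d" z] by linarith
      then show ?thesis by (simp add: B_def dist_commute algebra_simps)
    qed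
    ultimately show "x \<in> (\<Union>i\<in>{..m}. B i)" by auto
  qed
  then have "emeasure lborel {x. near x (real k * t) e} \<le> emeasure lborel (\<Union>i\<in>{..m}. B i)"
    by (intro emeasure_mono) (auto simp: B_def)
  also have "\<dots> \<le> (\<Sum>i\<in>{..m}. emeasure lborel (B i))"
    by (intro emeasure_subadditive_finite) (auto simp: B_def)
  also have "\<dots> = ennreal ((real m + 1) * (pi * ((real k + 1) * t)^2))"
    using t by (simp add: B_def emeasure_cball_pt ennreal_mult' ennreal_of_nat_eq_real_of_nat[symmetric] add.commute)
  also have "\<dots> \<le> ennreal (3 * pi * (real k + 1)^2 * (t * l))"
  proof (rule ennreal_leI)
    have "(real m + 1) * (pi * ((real k + 1) * t)^2) \<le> (3 * (l / t)) * (pi * ((real k + 1) * t)^2)"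
      using m2 lt by (intro mult_right_mono) auto
    also have "\<dots> = 3 * pi * (real k + 1)^2 * (t * l)" using t by (simp add: power_mult_distrib power2_eq_square)
    finally show "(real m + 1) * (pi * ((real k + 1) * t)^2) \<le> 3 * pi * (real k + 1)^2 * (t * l)" .
  qed
  finally show ?thesis by (simp add: l_def)
qed

text \<open>The region where \<open>e\<close> still controls the polynomial of its ring while short
  edges of \<open>adj e\<close> interfere.\<close>

definition shadow :: "real \<Rightarrow> edge \<Rightarrow> pt set" where
  "shadow t e = {y. near y (K * elen e) e \<and> (\<exists>e'\<in>adj e. elen e' \<le> t \<and> near y (real k * t) e')}"

lemma shadow_shift_measurable: "{x. x + w \<in> shadow t e} \<in> sets borel"
proof -
  have "{x. x + w \<in> shadow t e} = {x. near (x + w) (K * elen e) e} \<inter> (\<Union>e'\<in>{e'\<in>adj e. elen e' \<le> t}. {x. near (x + w) (real k * t) e'})"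
    by (auto simp: shadow_def)
  moreover have "closed \<dots>" using finite_adj[of e] by (intro closed_Int closed_UN closed_near) (auto intro: closed_near)
  ultimately show ?thesis by simp
qed

text \<open>Two covers: a ball of radius \<open>(k + 1) * t\<close> for each short edge of
  \<open>adj e\<close>, or one ball of radius \<open>(K + 1) * elen e\<close> about
  \<open>e\<close>. The first is small for small \<open>t\<close>, and the second keeps the later
  integral over \<open>t\<close> finite at infinity.\<close>

lemma measure_shadow:
  assumes e: "e \<in> edges" and t: "0 < t"
  shows "emeasure lborel {x. x + w \<in> shadow t e}
    \<le> ennreal (pi * (K + 1)^2 * min (real (card (adj e)) * t^2) ((elen e)^2))"
proof -
  have k0: "0 \<le> real k" "0 \<le> K" using K by auto
  have sub: "dist (fst (snd e') - w) x \<le> d + elen e'" if nr: "near (x + w) d e'" for x d e'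
  proof -
    obtain z where z: "z \<in> eseg e'" "dist (x + w) z \<le> d" using nr by (auto simp: near_def)
    have "dist z (fst (snd e')) \<le> elen e'"
      using z unfolding eseg_def elen_def by (intro dist_le_segment_length) auto
    then have "dist (x + w) (fst (snd e')) \<le> d + elen e'" using z dist_triangle[of "x + w" "fst (snd e')" z] by linarith
    then show ?thesis by (simp add: dist_norm norm_minus_commute algebra_simps)
  qed
  have 1: "emeasure lborel {x. x + w \<in> shadow t e} \<le> ennreal (pi * (K + 1)^2 * (real (card (adj e)) * t^2))"
  proof -
    have "{x. x + w \<in> shadow t e} \<subseteq> (\<Union>e'\<in>adj e. cball (fst (snd e') - w) ((real k + 1) * t))"
    proof
      fix x assume "x \<in> {x. x + w \<in> shadow t e}"
      then obtain e' where e': "e' \<in> adj e" "elen e' \<le> t" "near (x + w) (real k * t) e'" by (auto simp: shadow_def)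
      then have "dist (fst (snd e') - w) x \<le> (real k + 1) * t" using sub[OF e'(3)] by (simp add: algebra_simps)
      then show "x \<in> (\<Union>e'\<in>adj e. cball (fst (snd e') - w) ((real k + 1) * t))" using e'(1) by auto
    qed
    then have "emeasure lborel {x. x + w \<in> shadow t e} \<le> emeasure lborel (\<Union>e'\<in>adj e. cball (fst (snd e') - w) ((real k + 1) * t))"
      using finite_adj[of e] by (intro emeasure_mono) (auto intro!: sets.finite_UN)
    also have "\<dots> \<le> (\<Sum>e'\<in>adj e. emeasure lborel (cball (fst (snd e') - w) ((real k + 1) * t)))"
      using finite_adj[of e] by (intro emeasure_subadditive_finite) auto
    also have "\<dots> = ennreal (real (card (adj e)) * (pi * ((real k + 1) * t)^2))"
      using t by (simp add: emeasure_cball_pt ennreal_mult' ennreal_of_nat_eq_real_of_nat)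
    also have "\<dots> \<le> ennreal (pi * (K + 1)^2 * (real (card (adj e)) * t^2))"
    proof (rule ennreal_leI)
      have "(real k + 1)^2 \<le> (K + 1)^2" using K by (intro power_mono) auto
      then have "(real k + 1)^2 * (pi * (real (card (adj e)) * t^2)) \<le> (K + 1)^2 * (pi * (real (card (adj e)) * t^2))"
        by (intro mult_right_mono) auto
      then show "real (card (adj e)) * (pi * ((real k + 1) * t)^2) \<le> pi * (K + 1)^2 * (real (card (adj e)) * t^2)"
        by (simp add: power_mult_distrib mult_ac)
    qed
    finally show ?thesis .
  qed
  have 2: "emeasure lborel {x. x + w \<in> shadow t e} \<le> ennreal (pi * (K + 1)^2 * (elen e)^2)"
  proof -
    have "{x. x + w \<in> shadow t e} \<subseteq> cball (fst (snd e) - w) ((K + 1) * elen e)"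
      using sub[of _ "K * elen e" e] by (auto simp: shadow_def algebra_simps)
    then have "emeasure lborel {x. x + w \<in> shadow t e} \<le> emeasure lborel (cball (fst (snd e) - w) ((K + 1) * elen e))"
      by (intro emeasure_mono) auto
    also have "\<dots> = ennreal (pi * (K + 1)^2 * (elen e)^2)"
      using k0 elen_pos[OF e] by (subst emeasure_cball_pt) (auto simp: power_mult_distrib mult_ac)
    finally show ?thesis .
  qed
  show ?thesis using 1 2 by (simp add: min_def)
qed

text \<open>A majorant that separates geometry from the size \<open>a e\<close>. The indicator at
  the node \<nu> = 0 accounts for the interference in \<open>phi\<close>, those at all nodes for
  \<open>psi\<close>.\<close>

definition unit_term :: "real \<Rightarrow> real \<Rightarrow> pt \<Rightarrow> pt \<Rightarrow> edge \<Rightarrow> real" where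
  "unit_term \<tau> t h x e = (if t < elen e \<and> near x (real k * t) e then (t / elen e) powr (real r * \<tau>) else 0)
      + (\<Sum>\<nu>\<le>k. of_bool (x + real \<nu> *\<^sub>R h \<in> shadow t e))"

lemma unit_term_nonneg: "0 \<le> unit_term \<tau> t h x e"
  unfolding unit_term_def by (intro add_nonneg_nonneg sum_nonneg) auto

definition C0 :: "real \<Rightarrow> real" where
  "C0 \<tau> = 2 powr \<tau> * ((4 * D) powr \<tau> * M powr \<tau> * 2 powr \<tau> + (2 ^ k) powr \<tau> * (real k + 1) powr \<tau> * A powr \<tau>)"

lemma C0_nonneg: "0 \<le> C0 \<tau>" by (simp add: C0_def)

lemma phi_powr_le:
  assumes t: "0 < t" and \<tau>: "0 < \<tau>" and e: "e \<in> long t x"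
  shows "phi t x e powr \<tau> \<le> 2 powr \<tau> * (a e powr \<tau> * unit_term \<tau> t h x e)"
proof -
  have ee: "e \<in> edges" "t < elen e" "near x (real k * t) e" using e by (auto simp: long_def)
  have l: "0 < t / elen e" using t elen_pos[OF ee(1)] by simp
  define b :: real where "b = of_bool (\<exists>e'\<in>adj e. elen e' \<le> t \<and> near x (real k * t) e')"
  have "real k * t \<le> K * elen e" using ee(2) K t by (intro mult_mono) auto
  then have nK: "near x (K * elen e) e" using ee(3) near_mono by blast
  have bb: "b powr \<tau> = b" "b \<ge> 0" by (auto simp: b_def)
  have "b \<le> of_bool (x + real 0 *\<^sub>R h \<in> shadow t e)" using nK by (auto simp: b_def shadow_def)
  also have "\<dots> \<le> (\<Sum>\<nu>\<le>k. of_bool (x + real \<nu> *\<^sub>R h \<in> shadow t e))"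
    by (rule member_le_sum[of 0 "{..k}" "\<lambda>\<nu>. of_bool (x + real \<nu> *\<^sub>R h \<in> shadow t e) :: real"]) auto
  finally have le: "(t / elen e) powr (real r * \<tau>) + b \<le> unit_term \<tau> t h x e"
    using ee by (simp add: unit_term_def)
  have "phi t x e powr \<tau> = a e powr \<tau> * ((t / elen e) ^ r + b) powr \<tau>"
    unfolding phi_def b_def[symmetric] using a_nonneg l bb by (subst powr_mult) auto
  also have "\<dots> \<le> a e powr \<tau> * (2 powr \<tau> * (((t / elen e) ^ r) powr \<tau> + b powr \<tau>))"
    using l bb \<tau> by (intro mult_left_mono add_powr_le) auto
  also have "((t / elen e) ^ r) powr \<tau> = (t / elen e) powr (real r * \<tau>)"
    using l by (simp add: powr_realpow[symmetric] powr_powr)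
  also have "a e powr \<tau> * (2 powr \<tau> * ((t / elen e) powr (real r * \<tau>) + b powr \<tau>))
     \<le> a e powr \<tau> * (2 powr \<tau> * unit_term \<tau> t h x e)"
    using le bb by (intro mult_left_mono) auto
  finally show ?thesis by (simp add: mult_ac)
qed

text \<open>If \<open>y\<close> has a short edge of its ring nearby, the ray property finds a
  half-edge \<open>e\<close> of the same ring, of any length, that controls the polynomial at
  \<open>y\<close>. The short edge belongs to \<open>adj e\<close> because the ring is the same, so
  \<open>y\<close> lies in the shadow of \<open>e\<close>.\<close>

lemma psi_powr_le:
  assumes \<tau>: "0 < \<tau>" and y: "\<And>j. j < n \<Longrightarrow> y \<notin> X j"
  shows "psi t y powr \<tau> \<le> A powr \<tau> * (\<Sum>e\<in>edges. a e powr \<tau> * of_bool (y \<in> shadow t e))"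
proof (cases "\<exists>j<n. y \<in> R j \<and> (\<exists>e\<in>edges. fst e = j \<and> elen e \<le> t \<and> near y (real k * t) e)")
  case True
  then obtain j e' where j: "j < n" "y \<in> R j" and e': "e' \<in> edges" "fst e' = j" "elen e' \<le> t" "near y (real k * t) e'" by blast
  obtain v w z where vw: "(v, w) \<in> H j" "z \<in> closed_segment v w" "dist y z \<le> K * dist v w"
    using ray[OF j y[OF j(1)]] by auto
  define e where "e = (j, v, w)"
  have e: "e \<in> edges" "fst e = j" using vw j by (auto simp: e_def edges_def)
  have nK: "near y (K * elen e) e" using vw unfolding near_def e_def eseg_def elen_def by auto
  have "e' \<in> adj e" using e e' by (auto simp: adj_def)
  then have sh: "y \<in> shadow t e" using nK e' by (auto simp: shadow_def)
  have "\<bar>S y\<bar> \<le> A * a e" using edge_control[OF e(1) nK] SP[OF j] e(2) by simp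
  then have "psi t y powr \<tau> \<le> (A * a e) powr \<tau>" using True \<tau> by (simp add: psi_def powr_mono2)
  also have "\<dots> = A powr \<tau> * (a e powr \<tau> * of_bool (y \<in> shadow t e))" using sh A a_nonneg by (simp add: powr_mult)
  also have "\<dots> \<le> A powr \<tau> * (\<Sum>e\<in>edges. a e powr \<tau> * of_bool (y \<in> shadow t e))"
    using e(1) finite_edges by (intro mult_left_mono member_le_sum[of e]) auto
  finally show ?thesis .
next
  case False
  then have "psi t y = 0" unfolding psi_def by (simp only: if_False)
  then show ?thesis by (simp add: sum_nonneg)
qed

text \<open>Raising the sums to the power \<tau> costs powers of \<open>M\<close> long edges and of
  \<open>k + 1\<close> nodes, uniformly in \<open>x\<close> and \<open>t\<close>. Only afterwards
  are the sums extended to all edges.\<close>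

lemma pointwise_difference_powr:
  assumes t: "0 < t" and \<tau>: "0 < \<tau>" and h: "h \<noteq> 0" "norm h \<le> t" and gen: "generic h x"
    and seg: "closed_segment x (x + real k *\<^sub>R h) \<subseteq> (\<Union>j<n. R j)"
  shows "\<bar>\<Sum>\<nu>\<le>k. (-1) ^ (k + \<nu>) * real (k choose \<nu>) * S (x + real \<nu> *\<^sub>R h)\<bar> powr \<tau>
     \<le> C0 \<tau> * (\<Sum>e\<in>edges. a e powr \<tau> * unit_term \<tau> t h x e)"
proof -
  define T where "T = (\<Sum>e\<in>edges. a e powr \<tau> * unit_term \<tau> t h x e)"
  have T0: "0 \<le> T" unfolding T_def by (intro sum_nonneg mult_nonneg_nonneg unit_term_nonneg) auto
  define F where "F = (\<Sum>e\<in>long t x. phi t x e)"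
  define G where "G = (\<Sum>\<nu>\<le>k. psi t (x + real \<nu> *\<^sub>R h))"
  have FG: "0 \<le> F" "0 \<le> G" unfolding F_def G_def
    using phi_nonneg[OF t] psi_nonneg by (auto intro!: sum_nonneg simp: long_def)
  have finL: "finite (long t x)" using finite_edges by (simp add: long_def)
  have cardL: "real (card (long t x)) \<le> M"
  proof -
    have "card (long t x) \<le> card {e \<in> edges. t \<le> elen e \<and> near x (real k * t) e}"
      using finite_edges by (intro card_mono) (auto simp: long_def)
    then show ?thesis using packing[OF t, of x] by linarith
  qed
  have "F powr \<tau> \<le> real (card (long t x)) powr \<tau> * (\<Sum>e\<in>long t x. phi t x e powr \<tau>)"
    unfolding F_def using phi_nonneg[OF t] \<tau> by (intro sum_powr_le finL) (auto simp: long_def)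
  also have "\<dots> \<le> M powr \<tau> * (\<Sum>e\<in>long t x. 2 powr \<tau> * (a e powr \<tau> * unit_term \<tau> t h x e))"
    using cardL \<tau> by (intro mult_mono powr_mono2 sum_mono phi_powr_le t sum_nonneg) auto
  also have "\<dots> \<le> M powr \<tau> * (\<Sum>e\<in>edges. 2 powr \<tau> * (a e powr \<tau> * unit_term \<tau> t h x e))"
    using finite_edges unit_term_nonneg
    by (intro mult_left_mono sum_mono2) (auto simp: long_def)
  also have "\<dots> = M powr \<tau> * (2 powr \<tau> * T)" unfolding T_def by (simp add: sum_distrib_left)
  finally have F: "F powr \<tau> \<le> M powr \<tau> * (2 powr \<tau> * T)" .
  have "G powr \<tau> \<le> real (card {..k}) powr \<tau> * (\<Sum>\<nu>\<le>k. psi t (x + real \<nu> *\<^sub>R h) powr \<tau>)"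
    unfolding G_def using psi_nonneg \<tau> by (intro sum_powr_le) auto
  also have "\<dots> \<le> (real k + 1) powr \<tau> * (\<Sum>\<nu>\<le>k. A powr \<tau> * (\<Sum>e\<in>edges. a e powr \<tau> * of_bool (x + real \<nu> *\<^sub>R h \<in> shadow t e)))"
  proof (intro mult_mono sum_mono psi_powr_le \<tau> sum_nonneg)
    fix \<nu> j assume "j < n"
    then show "x + real \<nu> *\<^sub>R h \<notin> X j" using gen unfolding generic_def by blast
  qed (auto simp: add.commute)
  also have "(\<Sum>\<nu>\<le>k. A powr \<tau> * (\<Sum>e\<in>edges. a e powr \<tau> * of_bool (x + real \<nu> *\<^sub>R h \<in> shadow t e)))
      = A powr \<tau> * (\<Sum>e\<in>edges. a e powr \<tau> * (\<Sum>\<nu>\<le>k. of_bool (x + real \<nu> *\<^sub>R h \<in> shadow t e)))"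
    unfolding sum_distrib_left by (rule sum.swap)
  also have "(real k + 1) powr \<tau> * \<dots> \<le> (real k + 1) powr \<tau> * (A powr \<tau> * T)"
    unfolding T_def by (intro mult_left_mono sum_mono) (auto simp: unit_term_def)
  finally have G: "G powr \<tau> \<le> (real k + 1) powr \<tau> * (A powr \<tau> * T)" .
  have "\<bar>\<Sum>\<nu>\<le>k. (-1) ^ (k + \<nu>) * real (k choose \<nu>) * S (x + real \<nu> *\<^sub>R h)\<bar> powr \<tau> \<le> (4 * D * F + 2 ^ k * G) powr \<tau>"
    using pointwise_difference_bound[OF t h gen seg] \<tau> unfolding F_def G_def by (intro powr_mono2) auto
  also have "\<dots> \<le> 2 powr \<tau> * ((4 * D * F) powr \<tau> + (2 ^ k * G) powr \<tau>)"
    using D_nonneg FG \<tau> by (intro add_powr_le) auto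
  also have "\<dots> = 2 powr \<tau> * ((4 * D) powr \<tau> * F powr \<tau> + (2 ^ k) powr \<tau> * G powr \<tau>)"
    using D_nonneg FG by (simp add: powr_mult)
  also have "\<dots> \<le> 2 powr \<tau> * ((4 * D) powr \<tau> * (M powr \<tau> * (2 powr \<tau> * T)) + (2 ^ k) powr \<tau> * ((real k + 1) powr \<tau> * (A powr \<tau> * T)))"
    by (intro mult_left_mono add_mono F G) auto
  also have "\<dots> = C0 \<tau> * T" by (simp add: C0_def algebra_simps)
  finally show ?thesis unfolding T_def .
qed

text \<open>Up to constants, a bound for the integral of \<open>unit_term\<close>: a strip of area
  \<open>t * elen e\<close> with its smooth factor, and the area of the shadow.\<close>

definition weight :: "real \<Rightarrow> real \<Rightarrow> edge \<Rightarrow> real" where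
  "weight \<tau> t e = (if t < elen e then (t / elen e) powr (real r * \<tau>) * (t * elen e) else 0)
     + min (real (card (adj e)) * t^2) ((elen e)^2)"

definition C1 :: "real \<Rightarrow> real" where
  "C1 \<tau> = C0 \<tau> * (3 * pi * (real k + 1)^2 + (real k + 1) * (pi * (K + 1)^2))"

lemma C1_nonneg: "0 \<le> C1 \<tau>"
  unfolding C1_def using C0_nonneg K by (intro mult_nonneg_nonneg add_nonneg_nonneg) auto

lemma unit_term_integral:
  assumes e: "e \<in> edges" and t: "0 < t"
  shows "(\<integral>\<^sup>+x. ennreal (unit_term \<tau> t h x e) \<partial>lborel) \<le>
     ennreal ((3 * pi * (real k + 1)^2 + (real k + 1) * (pi * (K + 1)^2)) * weight \<tau> t e)"
    "(\<lambda>x. ennreal (unit_term \<tau> t h x e)) \<in> borel_measurable lborel"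
proof -
  define b where "b = (if t < elen e then (t / elen e) powr (real r * \<tau>) else 0)"
  define mm where "mm = min (real (card (adj e)) * t^2) ((elen e)^2)"
  have mm0: "0 \<le> mm" by (simp add: mm_def)
  have meas1: "{x. near x (real k * t) e} \<in> sets borel" using closed_near[of 0] by simp
  have eq: "ennreal (unit_term \<tau> t h x e) = ennreal b * indicator {x. near x (real k * t) e} x +
      (\<Sum>\<nu>\<le>k. indicator {x. x + real \<nu> *\<^sub>R h \<in> shadow t e} x)" for x
  proof -
    have "ennreal (unit_term \<tau> t h x e) = ennreal (b * indicator {x. near x (real k * t) e} x + (\<Sum>\<nu>\<le>k. indicator {x. x + real \<nu> *\<^sub>R h \<in> shadow t e} x))"
      unfolding unit_term_def b_def by (rule arg_cong[where f=ennreal]) (auto simp: indicator_def of_bool_def intro!: sum.cong)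
    also have "\<dots> = ennreal (b * indicator {x. near x (real k * t) e} x) + ennreal (\<Sum>\<nu>\<le>k. indicator {x. x + real \<nu> *\<^sub>R h \<in> shadow t e} x)"
      by (intro ennreal_plus sum_nonneg) (auto simp: b_def)
    also have "ennreal (\<Sum>\<nu>\<le>k. indicator {x. x + real \<nu> *\<^sub>R h \<in> shadow t e} x) = (\<Sum>\<nu>\<le>k. indicator {x. x + real \<nu> *\<^sub>R h \<in> shadow t e} x)"
      by (subst sum_ennreal[symmetric]) (auto simp: ennreal_indicator)
    also have "ennreal (b * indicator {x. near x (real k * t) e} x) = ennreal b * indicator {x. near x (real k * t) e} x"
      by (auto simp: indicator_def)
    finally show ?thesis .
  qed
  have m1: "(\<lambda>x. ennreal b * indicator {x. near x (real k * t) e} x) \<in> borel_measurable lborel"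
    using meas1 by (intro borel_measurable_times_ennreal borel_measurable_indicator) auto
  have m2: "(\<lambda>x. indicator {x. x + real \<nu> *\<^sub>R h \<in> shadow t e} x :: ennreal) \<in> borel_measurable lborel" for \<nu>
    using shadow_shift_measurable by (intro borel_measurable_indicator) auto
  show "(\<lambda>x. ennreal (unit_term \<tau> t h x e)) \<in> borel_measurable lborel"
    unfolding eq using m1 m2 by (intro borel_measurable_add borel_measurable_sum) auto
  have "(\<integral>\<^sup>+x. ennreal (unit_term \<tau> t h x e) \<partial>lborel) =
      (\<integral>\<^sup>+x. ennreal b * indicator {x. near x (real k * t) e} x \<partial>lborel) +
      (\<Sum>\<nu>\<le>k. \<integral>\<^sup>+x. indicator {x. x + real \<nu> *\<^sub>R h \<in> shadow t e} x \<partial>lborel)"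
    unfolding eq using m1 m2 by (subst nn_integral_add) (auto intro!: borel_measurable_sum nn_integral_sum)
  also have "\<dots> = ennreal b * emeasure lborel {x. near x (real k * t) e} +
      (\<Sum>\<nu>\<le>k. emeasure lborel {x. x + real \<nu> *\<^sub>R h \<in> shadow t e})"
    using meas1 shadow_shift_measurable by (simp add: nn_integral_cmult_indicator)
  also have "\<dots> \<le> ennreal (3 * pi * (real k + 1)^2 * (b * (t * elen e))) + (\<Sum>\<nu>\<le>k. ennreal (pi * (K + 1)^2 * mm))"
  proof (intro add_mono sum_mono)
    show "ennreal b * emeasure lborel {x. near x (real k * t) e} \<le> ennreal (3 * pi * (real k + 1)^2 * (b * (t * elen e)))"
    proof (cases "t < elen e")
      case True
      have b0: "0 \<le> b" by (simp add: b_def)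
      have "ennreal b * emeasure lborel {x. near x (real k * t) e} \<le> ennreal b * ennreal (3 * pi * (real k + 1)^2 * (t * elen e))"
        by (intro mult_left_mono measure_near e t True) auto
      also have "\<dots> = ennreal (3 * pi * (real k + 1)^2 * (b * (t * elen e)))"
        using b0 by (simp add: ennreal_mult'[symmetric] mult_ac)
      finally show ?thesis .
    qed (simp add: b_def)
    show "emeasure lborel {x. x + real \<nu> *\<^sub>R h \<in> shadow t e} \<le> ennreal (pi * (K + 1)^2 * mm)" for \<nu>
      unfolding mm_def by (rule measure_shadow[OF e t])
  qed
  also have "\<dots> = ennreal (3 * pi * (real k + 1)^2 * (b * (t * elen e)) + (real k + 1) * (pi * (K + 1)^2 * mm))"
  proof -
    have "(\<Sum>\<nu>\<le>k. ennreal (pi * (K + 1)^2 * mm)) = ennreal ((real k + 1) * (pi * (K + 1)^2 * mm))"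
      using mm0 by (subst sum_ennreal) (auto simp: add.commute)
    moreover have "0 \<le> b * (t * elen e)" using t elen_pos[OF e] by (simp add: b_def)
    ultimately show ?thesis using mm0 by (subst ennreal_plus) auto
  qed
  also have "\<dots> \<le> ennreal ((3 * pi * (real k + 1)^2 + (real k + 1) * (pi * (K + 1)^2)) * weight \<tau> t e)"
  proof (rule ennreal_leI)
    have w: "weight \<tau> t e = b * (t * elen e) + mm" by (simp add: weight_def b_def mm_def)
    have nn: "0 \<le> b * (t * elen e)" using t elen_pos[OF e] by (simp add: b_def)
    have "0 \<le> 3 * pi * (real k + 1)^2 * mm" "0 \<le> (real k + 1) * (pi * (K + 1)^2) * (b * (t * elen e))"
      using mm0 nn by auto
    then show "3 * pi * (real k + 1)^2 * (b * (t * elen e)) + (real k + 1) * (pi * (K + 1)^2 * mm)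
        \<le> (3 * pi * (real k + 1)^2 + (real k + 1) * (pi * (K + 1)^2)) * weight \<tau> t e"
      unfolding w by (simp add: algebra_simps)
  qed
  finally show "(\<integral>\<^sup>+x. ennreal (unit_term \<tau> t h x e) \<partial>lborel) \<le>
     ennreal ((3 * pi * (real k + 1)^2 + (real k + 1) * (pi * (K + 1)^2)) * weight \<tau> t e)" .
qed

lemma weight_nonneg: "0 < t \<Longrightarrow> e \<in> edges \<Longrightarrow> 0 \<le> weight \<tau> t e"
  unfolding weight_def using elen_pos[of e] by (intro add_nonneg_nonneg) auto

lemma difference_integral_bound:
  assumes t: "0 < t" and \<tau>: "0 < \<tau>" and h: "norm h \<le> t" and \<Omega>: "\<Omega> = (\<Union>j<n. R j)"
  shows "(\<integral>\<^sup>+x\<in>\<Omega>. ennreal (\<bar>fdiff k \<Omega> h S x\<bar> powr \<tau>) \<partial>lborel)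
     \<le> ennreal (C1 \<tau> * (\<Sum>e\<in>edges. a e powr \<tau> * weight \<tau> t e))"
proof (cases "h = 0")
  case True
  \<comment> \<open>For \<open>h = 0\<close> all nodes coincide, and a difference of order at least
    one annihilates the constant polynomial with value \<open>S x\<close>.\<close>
  have "fdiff k \<Omega> h S x = 0" for x
    using kth_difference_poly[of "[:S x:]" k] k1 by (simp add: fdiff_def True)
  then show ?thesis using \<tau> by simp
next
  case False
  define c' where "c' = 3 * pi * (real k + 1)^2 + (real k + 1) * (pi * (K + 1)^2)"
  have "(\<integral>\<^sup>+x\<in>\<Omega>. ennreal (\<bar>fdiff k \<Omega> h S x\<bar> powr \<tau>) \<partial>lborel)
      \<le> (\<integral>\<^sup>+x. (\<Sum>e\<in>edges. ennreal (C0 \<tau> * a e powr \<tau>) * ennreal (unit_term \<tau> t h x e)) \<partial>lborel)"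
  proof (rule nn_integral_mono_AE)
    show "AE x in lborel. ennreal (\<bar>fdiff k \<Omega> h S x\<bar> powr \<tau>) * indicator \<Omega> x
        \<le> (\<Sum>e\<in>edges. ennreal (C0 \<tau> * a e powr \<tau>) * ennreal (unit_term \<tau> t h x e))"
      using AE_generic[OF False]
    proof eventually_elim
      case (elim x)
      have "\<bar>fdiff k \<Omega> h S x\<bar> powr \<tau> \<le> C0 \<tau> * (\<Sum>e\<in>edges. a e powr \<tau> * unit_term \<tau> t h x e)"
      proof (cases "closed_segment x (x + real k *\<^sub>R h) \<subseteq> \<Omega>")
        case True
        then show ?thesis using pointwise_difference_powr[OF t \<tau> False h elim] \<Omega> by (simp add: fdiff_def)
      next
        case False
        then show ?thesis using \<tau> C0_nonneg unit_term_nonneg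
          by (auto simp: fdiff_def intro!: mult_nonneg_nonneg sum_nonneg)
      qed
      then have "ennreal (\<bar>fdiff k \<Omega> h S x\<bar> powr \<tau>) \<le> ennreal (\<Sum>e\<in>edges. (C0 \<tau> * a e powr \<tau>) * unit_term \<tau> t h x e)"
        by (intro ennreal_leI) (simp add: sum_distrib_left mult.assoc)
      also have "\<dots> = (\<Sum>e\<in>edges. ennreal (C0 \<tau> * a e powr \<tau>) * ennreal (unit_term \<tau> t h x e))"
        using C0_nonneg unit_term_nonneg by (subst sum_ennreal[symmetric]) (auto simp: ennreal_mult' intro!: sum.cong)
      finally show ?case by (auto simp: indicator_def)
    qed
  qed
  also have "\<dots> = (\<Sum>e\<in>edges. ennreal (C0 \<tau> * a e powr \<tau>) * (\<integral>\<^sup>+x. ennreal (unit_term \<tau> t h x e) \<partial>lborel))"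
    using unit_term_integral(2)[OF _ t]
    by (subst nn_integral_sum) (auto intro!: sum.cong nn_integral_cmult borel_measurable_times_ennreal)
  also have "\<dots> \<le> (\<Sum>e\<in>edges. ennreal (C0 \<tau> * a e powr \<tau>) * ennreal (c' * weight \<tau> t e))"
    unfolding c'_def using unit_term_integral(1)[OF _ t] by (intro sum_mono mult_left_mono) auto
  also have "\<dots> = ennreal (\<Sum>e\<in>edges. (C0 \<tau> * a e powr \<tau>) * (c' * weight \<tau> t e))"
    using C0_nonneg weight_nonneg[OF t] K
    by (subst sum_ennreal[symmetric]) (auto simp: ennreal_mult' c'_def intro!: mult_nonneg_nonneg add_nonneg_nonneg)
  also have "(\<Sum>e\<in>edges. (C0 \<tau> * a e powr \<tau>) * (c' * weight \<tau> t e)) = C1 \<tau> * (\<Sum>e\<in>edges. a e powr \<tau> * weight \<tau> t e)"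
    unfolding C1_def c'_def[symmetric] sum_distrib_left by (simp add: mult_ac)
  finally show ?thesis .
qed

end

section \<open>The Bernstein inequality\<close>

text \<open>Hoelder's inequality for finite sums with exponents 1/\<alpha> and 1/\<beta>, obtained
  by applying Young's inequality to each term after division by the totals.\<close>

lemma sum_powr_mult_le:
  fixes x y :: "'a \<Rightarrow> real"
  assumes "finite F" "\<And>i. i \<in> F \<Longrightarrow> 0 \<le> x i" "\<And>i. i \<in> F \<Longrightarrow> 0 \<le> y i"
    and ab: "0 < \<alpha>" "0 < \<beta>" "\<alpha> + \<beta> = 1"
  shows "(\<Sum>i\<in>F. x i powr \<alpha> * y i powr \<beta>) \<le> (\<Sum>i\<in>F. x i) powr \<alpha> * (\<Sum>i\<in>F. y i) powr \<beta>"
proof (cases "(\<Sum>i\<in>F. x i) = 0 \<or> (\<Sum>i\<in>F. y i) = 0")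
  case True
  then have "x i powr \<alpha> * y i powr \<beta> = 0" if "i \<in> F" for i
    using that assms(1-3) by (auto simp: sum_nonneg_eq_0_iff)
  then have "(\<Sum>i\<in>F. x i powr \<alpha> * y i powr \<beta>) = 0" by (intro sum.neutral) blast
  then show ?thesis by simp
next
  case False
  define X where "X = (\<Sum>i\<in>F. x i)"
  define Y where "Y = (\<Sum>i\<in>F. y i)"
  have XY: "0 < X" "0 < Y" using False assms(2,3) by (auto simp: X_def Y_def less_le sum_nonneg)
  have "x i powr \<alpha> * y i powr \<beta> \<le> X powr \<alpha> * Y powr \<beta> * (\<alpha> * (x i / X) + \<beta> * (y i / Y))" if i: "i \<in> F" for i
  proof -
    have "(x i / X) powr \<alpha> * (y i / Y) powr \<beta> \<le> \<alpha> * (x i / X) + \<beta> * (y i / Y)"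
    proof (cases "x i = 0 \<or> y i = 0")
      case True
      then have "(x i / X) powr \<alpha> * (y i / Y) powr \<beta> = 0" by auto
      moreover have "0 \<le> \<alpha> * (x i / X) + \<beta> * (y i / Y)"
        using assms(2,3)[OF i] XY ab by (intro add_nonneg_nonneg mult_nonneg_nonneg divide_nonneg_pos) auto
      ultimately show ?thesis by linarith
    next
      case False
      then show ?thesis using assms(2,3)[OF i] XY ab by (intro Youngs_inequality_0) auto
    qed
    then have "X powr \<alpha> * Y powr \<beta> * ((x i / X) powr \<alpha> * (y i / Y) powr \<beta>) \<le> X powr \<alpha> * Y powr \<beta> * (\<alpha> * (x i / X) + \<beta> * (y i / Y))"
      by (intro mult_left_mono) auto
    moreover have "X powr \<alpha> * Y powr \<beta> * ((x i / X) powr \<alpha> * (y i / Y) powr \<beta>) = x i powr \<alpha> * y i powr \<beta>"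
      using assms(2,3)[OF i] XY by (simp add: powr_divide)
    ultimately show ?thesis by simp
  qed
  then have "(\<Sum>i\<in>F. x i powr \<alpha> * y i powr \<beta>) \<le> (\<Sum>i\<in>F. X powr \<alpha> * Y powr \<beta> * (\<alpha> * (x i / X) + \<beta> * (y i / Y)))"
    by (rule sum_mono)
  also have "\<dots> = X powr \<alpha> * Y powr \<beta> * (\<Sum>i\<in>F. \<alpha> * (x i / X) + \<beta> * (y i / Y))"
    by (simp only: sum_distrib_left)
  also have "(\<Sum>i\<in>F. \<alpha> * (x i / X) + \<beta> * (y i / Y)) = \<alpha> * ((\<Sum>i\<in>F. x i) / X) + \<beta> * ((\<Sum>i\<in>F. y i) / Y)"
    by (simp only: sum.distrib sum_distrib_left sum_divide_distrib)
  also have "\<dots> = 1" using XY ab by (simp add: X_def[symmetric] Y_def[symmetric])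
  finally show ?thesis by (simp add: X_def Y_def)
qed

text \<open>The integral of the minimum is split at \<open>l / sqrt m\<close>, where its two arguments agree.\<close>

lemma weight_integral_bound:
  fixes l m \<sigma> \<rho> :: real
  assumes l: "0 < l" and m: "1 \<le> m" and s: "0 < \<sigma>" "\<sigma> < 2" and r: "0 < 1 + \<rho> - \<sigma>"
  shows "(\<integral>\<^sup>+t\<in>{0<..}. ennreal (t powr (- \<sigma> - 1) * ((if t < l then (t / l) powr \<rho> * (t * l) else 0) + min (m * t^2) (l^2))) \<partial>lborel)
     \<le> ennreal ((1 / (1 + \<rho> - \<sigma>) + 1 / (2 - \<sigma>) + 1 / \<sigma>) * (m powr (\<sigma>/2) * l powr (2 - \<sigma>)))"
proof -
  define L where "L = l / sqrt m"
  have L: "0 < L" using l m by (simp add: L_def)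
  have Lp: "L powr e = l powr e * m powr (- e / 2)" for e

  proof -
    have "L powr e = l powr e / (m powr (1/2)) powr e"
      using l m by (simp add: L_def powr_divide powr_half_sqrt)
    also have "(m powr (1/2)) powr e = m powr (e/2)" by (simp add: powr_powr)
    finally show ?thesis by (simp add: powr_minus_divide)
  qed
  \<comment> \<open>The three conditions on the exponents are spent here: \<open>f1\<close> is
    integrable at 0 by 0 < 1 + \<rho> - \<sigma>, \<open>f2\<close> at 0 by \<sigma> < 2, and
    \<open>f3\<close> at infinity by 0 < \<sigma>.\<close>
  define f1 where "f1 t = l powr (1 - \<rho>) * t powr (\<rho> - \<sigma>)" for t
  define f2 where "f2 t = m * t powr (1 - \<sigma>)" for t
  define f3 where "f3 t = l^2 * t powr (- \<sigma> - 1)" for t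
  have pw: "ennreal (t powr (- \<sigma> - 1) * ((if t < l then (t / l) powr \<rho> * (t * l) else 0) + min (m * t^2) (l^2))) * indicator {0<..} t
     \<le> ennreal (f1 t) * indicator {0..l} t + (ennreal (f2 t) * indicator {0..L} t + ennreal (f3 t) * indicator {L..} t)" for t
  proof (cases "0 < t")
    case t: True
    have 1: "t powr (- \<sigma> - 1) * (if t < l then (t / l) powr \<rho> * (t * l) else 0) \<le> f1 t * indicator {0..l} t"
    proof (cases "t < l")
      case True
      have tt: "t powr (- \<sigma> - 1) * (t powr \<rho> * t powr 1) = t powr (\<rho> - \<sigma>)"
        unfolding powr_add[symmetric] by (simp add: algebra_simps)
      have ll: "l powr 1 / l powr \<rho> = l powr (1 - \<rho>)" by (simp add: powr_diff)
      have "t powr (- \<sigma> - 1) * ((t / l) powr \<rho> * (t * l)) = (t powr (- \<sigma> - 1) * (t powr \<rho> * t powr 1)) * (l powr 1 / l powr \<rho>)"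
        using t l by (simp add: powr_divide)
      then have "t powr (- \<sigma> - 1) * ((t / l) powr \<rho> * (t * l)) = f1 t"
        unfolding tt ll f1_def by (simp add: mult.commute)
      then show ?thesis using True t by simp
    qed (auto simp: f1_def indicator_def)
    have 2: "t powr (- \<sigma> - 1) * min (m * t^2) (l^2) \<le> f2 t * indicator {0..L} t + f3 t * indicator {L..} t"
    proof (cases "t \<le> L")
      case True
      have "t powr (- \<sigma> - 1) * min (m * t^2) (l^2) \<le> t powr (- \<sigma> - 1) * (m * t^2)" by (intro mult_left_mono) auto
      also have "\<dots> = m * (t powr (- \<sigma> - 1) * t powr 2)" using t by (simp add: powr_numeral)
      also have "\<dots> = f2 t" unfolding f2_def powr_add[symmetric] by simp
      also have "\<dots> \<le> f2 t * indicator {0..L} t + f3 t * indicator {L..} t"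
        using True t by (simp add: indicator_def f3_def)
      finally show ?thesis .
    next
      case False
      have "t powr (- \<sigma> - 1) * min (m * t^2) (l^2) \<le> t powr (- \<sigma> - 1) * l^2" by (intro mult_left_mono) auto
      then show ?thesis using False t by (simp add: indicator_def f3_def mult.commute)
    qed
    have ei: "ennreal (b * indicator A t) = ennreal b * indicator A t" for b :: real and A
      by (simp add: indicator_def)
    have nn: "0 \<le> f1 t" "0 \<le> f2 t" "0 \<le> f3 t" using m by (auto simp: f1_def f2_def f3_def)
    have "ennreal (t powr (- \<sigma> - 1) * ((if t < l then (t / l) powr \<rho> * (t * l) else 0) + min (m * t^2) (l^2)))
        \<le> ennreal (f1 t * indicator {0..l} t + (f2 t * indicator {0..L} t + f3 t * indicator {L..} t))"
      using 1 2 by (intro ennreal_leI) (simp add: distrib_left)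
    also have "\<dots> = ennreal (f1 t * indicator {0..l} t) + (ennreal (f2 t * indicator {0..L} t) + ennreal (f3 t * indicator {L..} t))"
      using nn by (subst ennreal_plus; (subst ennreal_plus)?) auto
    finally show ?thesis using t unfolding ei by simp
  qed simp
  have i1: "(\<integral>\<^sup>+t. ennreal (f1 t) * indicator {0..l} t \<partial>lborel) = ennreal (l powr (1 - \<rho>) * (l powr (\<rho> - \<sigma> + 1) / (\<rho> - \<sigma> + 1)))"
    unfolding f1_def using l r
    by (intro nn_integral_has_integral_lebesgue' has_integral_mult_right has_integral_powr_from_0) auto
  have i2: "(\<integral>\<^sup>+t. ennreal (f2 t) * indicator {0..L} t \<partial>lborel) = ennreal (m * (L powr (1 - \<sigma> + 1) / (1 - \<sigma> + 1)))"
    unfolding f2_def using L s m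
    by (intro nn_integral_has_integral_lebesgue' has_integral_mult_right has_integral_powr_from_0) auto
  have i3: "(\<integral>\<^sup>+t. ennreal (f3 t) * indicator {L..} t \<partial>lborel) = ennreal (l^2 * (- (L powr (- \<sigma> - 1 + 1)) / (- \<sigma> - 1 + 1)))"
    unfolding f3_def using L s
    by (intro nn_integral_has_integral_lebesgue' has_integral_mult_right has_integral_powr_to_inf) auto
  define v where "v = m powr (\<sigma>/2) * l powr (2 - \<sigma>)"
  have v0: "0 \<le> v" by (simp add: v_def)
  have e1: "l powr (1 - \<rho>) * (l powr (\<rho> - \<sigma> + 1) / (\<rho> - \<sigma> + 1)) \<le> v / (1 + \<rho> - \<sigma>)"
  proof -
    \<comment> \<open>The strip term carries no \<open>m\<close>; as \<open>1 \<le> m\<close>, it is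
      absorbed into the common bound \<open>v\<close>.\<close>
    have "l powr (1 - \<rho>) * l powr (\<rho> - \<sigma> + 1) = 1 * l powr (2 - \<sigma>)" by (simp add: powr_add[symmetric])
    also have "\<dots> \<le> v" unfolding v_def using m s by (intro mult_right_mono ge_one_powr_ge_zero) auto
    finally have "l powr (1 - \<rho>) * l powr (\<rho> - \<sigma> + 1) / (1 + \<rho> - \<sigma>) \<le> v / (1 + \<rho> - \<sigma>)" using r by (intro divide_right_mono) auto
    then show ?thesis by (simp add: algebra_simps)
  qed
  have e2: "m * (L powr (1 - \<sigma> + 1) / (1 - \<sigma> + 1)) = v / (2 - \<sigma>)"
  proof -
    have "m * L powr (2 - \<sigma>) = l powr (2 - \<sigma>) * (m powr 1 * m powr (- (2 - \<sigma>) / 2))" unfolding Lp using m by simp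
    also have "m powr 1 * m powr (- (2 - \<sigma>) / 2) = m powr (\<sigma>/2)" unfolding powr_add[symmetric] by (simp add: field_simps)
    finally show ?thesis by (simp add: v_def mult.commute)
  qed
  have e3: "l^2 * (- (L powr (- \<sigma> - 1 + 1)) / (- \<sigma> - 1 + 1)) = v / \<sigma>"
  proof -
    have "l^2 * L powr (- \<sigma>) = (l powr 2 * l powr (- \<sigma>)) * m powr (\<sigma> / 2)" unfolding Lp using l by (simp add: powr_numeral)
    also have "l powr 2 * l powr (- \<sigma>) = l powr (2 - \<sigma>)" unfolding powr_add[symmetric] by simp
    finally show ?thesis using s by (simp add: v_def mult.commute)
  qed
  have "(\<integral>\<^sup>+t\<in>{0<..}. ennreal (t powr (- \<sigma> - 1) * ((if t < l then (t / l) powr \<rho> * (t * l) else 0) + min (m * t^2) (l^2))) \<partial>lborel)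
     \<le> (\<integral>\<^sup>+t. ennreal (f1 t) * indicator {0..l} t + (ennreal (f2 t) * indicator {0..L} t + ennreal (f3 t) * indicator {L..} t) \<partial>lborel)"
    by (intro nn_integral_mono pw)
  also have "\<dots> = (\<integral>\<^sup>+t. ennreal (f1 t) * indicator {0..l} t \<partial>lborel) + ((\<integral>\<^sup>+t. ennreal (f2 t) * indicator {0..L} t \<partial>lborel) + (\<integral>\<^sup>+t. ennreal (f3 t) * indicator {L..} t \<partial>lborel))"
    by (subst nn_integral_add; (subst nn_integral_add)?) (auto simp: f1_def f2_def f3_def)
  also have "\<dots> \<le> ennreal (v / (1 + \<rho> - \<sigma>)) + (ennreal (v / (2 - \<sigma>)) + ennreal (v / \<sigma>))"
    unfolding i1 i2 i3 e2 e3 by (intro add_mono ennreal_leI e1 order_refl)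
  also have "\<dots> = ennreal (v / (1 + \<rho> - \<sigma>) + (v / (2 - \<sigma>) + v / \<sigma>))"
    using v0 s r by (subst ennreal_plus; (subst ennreal_plus)?) auto
  also have "v / (1 + \<rho> - \<sigma>) + (v / (2 - \<sigma>) + v / \<sigma>) = (1 / (1 + \<rho> - \<sigma>) + 1 / (2 - \<sigma>) + 1 / \<sigma>) * v"
    by (simp add: algebra_simps)
  finally show ?thesis unfolding v_def .
qed

lemma en_pow_mono_ennreal:
  assumes "x \<le> ennreal y" "0 \<le> y" "0 \<le> a"
  shows "en_pow x a \<le> ennreal (y powr a)"
proof -
  have x: "x \<noteq> top" using assms(1) by (metis ennreal_neq_top neq_top_trans)
  then have "enn2real x \<le> y" using assms(1,2) by (simp add: enn2real_leI)
  then have "enn2real x powr a \<le> y powr a" using assms(3) by (intro powr_mono2) auto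
  then show ?thesis using x by (simp add: en_pow_def ennreal_leI)
qed

section \<open>Integration over scales and summation over edges\<close>

context framed_spline
begin

definition C2 :: "real \<Rightarrow> real \<Rightarrow> real" where
  "C2 s \<tau> = 1 / (1 + real r * \<tau> - s * \<tau>) + 1 / (2 - s * \<tau>) + 1 / (s * \<tau>)"

lemma edge_weight_integral:
  assumes e: "e \<in> edges" and st: "0 < s * \<tau>" "s * \<tau> < 2" "0 < 1 + real r * \<tau> - s * \<tau>"
  shows "(\<integral>\<^sup>+t\<in>{0<..}. ennreal (t powr (- (s * \<tau>) - 1) * weight \<tau> t e) \<partial>lborel)
     \<le> ennreal (C2 s \<tau> * (real (card (adj e)) powr (s * \<tau> / 2) * elen e powr (2 - s * \<tau>)))"
proof -
  have "adj e \<noteq> {}" using adj_refl[OF e] by auto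
  then have "1 \<le> real (card (adj e))" using finite_adj[of e] by (simp add: Suc_leI card_gt_0_iff)
  then show ?thesis unfolding weight_def C2_def by (intro weight_integral_bound elen_pos e st)
qed

lemma modulus_bound:
  assumes t: "0 < t" and \<tau>: "0 < \<tau>" and \<Omega>: "\<Omega> = (\<Union>j<n. R j)"
  shows "modulus k \<Omega> S t \<tau> \<le> ennreal ((C1 \<tau> * (\<Sum>e\<in>edges. a e powr \<tau> * weight \<tau> t e)) powr (1 / \<tau>))"
  unfolding modulus_def
proof (rule SUP_least)
  fix h :: pt assume "h \<in> {h. norm h \<le> t}"
  then show "Lnorm \<tau> \<Omega> (fdiff k \<Omega> h S) \<le> ennreal ((C1 \<tau> * (\<Sum>e\<in>edges. a e powr \<tau> * weight \<tau> t e)) powr (1 / \<tau>))"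
    unfolding Lnorm_def using difference_integral_bound[OF t \<tau> _ \<Omega>] \<tau> C1_nonneg weight_nonneg[OF t]
    by (intro en_pow_mono_ennreal) (auto intro!: mult_nonneg_nonneg sum_nonneg)
qed

text \<open>The power \<tau> undoes the root in \<open>modulus_bound\<close>, so the integrand
  becomes linear in the edge terms and can be integrated edge by edge.\<close>

lemma besov_integral_bound:
  assumes \<tau>: "0 < \<tau>" and st: "0 < s * \<tau>" "s * \<tau> < 2" "0 < 1 + real r * \<tau> - s * \<tau>" and \<Omega>: "\<Omega> = (\<Union>j<n. R j)"
  shows "(\<integral>\<^sup>+ t\<in>{0<..}. en_pow (ennreal (t powr (- s)) * modulus k \<Omega> S t \<tau>) \<tau> * ennreal (1 / t) \<partial>lborel)
    \<le> ennreal (C1 \<tau> * C2 s \<tau> * (\<Sum>e\<in>edges. a e powr \<tau> * (real (card (adj e)) powr (s * \<tau> / 2) * elen e powr (2 - s * \<tau>))))"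
proof -
  define g where "g t e = ennreal (t powr (- (s * \<tau>) - 1) * weight \<tau> t e) * indicator {0<..} t" for t e
  have gm: "(\<lambda>t. g t e) \<in> borel_measurable lborel" for e
    unfolding g_def weight_def by measurable
  have pw: "en_pow (ennreal (t powr (- s)) * modulus k \<Omega> S t \<tau>) \<tau> * ennreal (1 / t) * indicator {0<..} t
      \<le> (\<Sum>e\<in>edges. ennreal (C1 \<tau> * a e powr \<tau>) * g t e)" for t
  proof (cases "0 < t")
    case t: True
    define Y where "Y = C1 \<tau> * (\<Sum>e\<in>edges. a e powr \<tau> * weight \<tau> t e)"
    have Y: "0 \<le> Y" unfolding Y_def using C1_nonneg weight_nonneg[OF t]
      by (intro mult_nonneg_nonneg sum_nonneg) auto
    have "ennreal (t powr (- s)) * modulus k \<Omega> S t \<tau> \<le> ennreal (t powr (- s)) * ennreal (Y powr (1 / \<tau>))"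
      unfolding Y_def by (intro mult_left_mono modulus_bound t \<tau> \<Omega>) auto
    also have "\<dots> = ennreal (t powr (- s) * Y powr (1 / \<tau>))" by (simp add: ennreal_mult)
    finally have "en_pow (ennreal (t powr (- s)) * modulus k \<Omega> S t \<tau>) \<tau> \<le> ennreal ((t powr (- s) * Y powr (1 / \<tau>)) powr \<tau>)"
      using \<tau> by (intro en_pow_mono_ennreal) auto
    also have "(t powr (- s) * Y powr (1 / \<tau>)) powr \<tau> = t powr (- (s * \<tau>)) * Y"
      using \<tau> Y by (simp add: powr_mult powr_powr)
    finally have "en_pow (ennreal (t powr (- s)) * modulus k \<Omega> S t \<tau>) \<tau> * ennreal (1 / t) \<le> ennreal (t powr (- (s * \<tau>)) * Y) * ennreal (1 / t)"
      by (intro mult_right_mono) auto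
    also have "\<dots> = ennreal (t powr (- (s * \<tau>) - 1) * Y)"
      using t Y by (simp add: ennreal_mult'[symmetric] powr_diff)
    also have "t powr (- (s * \<tau>) - 1) * Y = (\<Sum>e\<in>edges. (C1 \<tau> * a e powr \<tau>) * (t powr (- (s * \<tau>) - 1) * weight \<tau> t e))"
      unfolding Y_def sum_distrib_left by (simp add: mult_ac)
    also have "ennreal \<dots> = (\<Sum>e\<in>edges. ennreal (C1 \<tau> * a e powr \<tau>) * g t e)"
      using C1_nonneg weight_nonneg[OF t] t
      by (subst sum_ennreal[symmetric]) (auto simp: g_def ennreal_mult' intro!: sum.cong)
    finally show ?thesis using t by simp
  qed simp
  have "(\<integral>\<^sup>+ t\<in>{0<..}. en_pow (ennreal (t powr (- s)) * modulus k \<Omega> S t \<tau>) \<tau> * ennreal (1 / t) \<partial>lborel)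
      \<le> (\<integral>\<^sup>+t. (\<Sum>e\<in>edges. ennreal (C1 \<tau> * a e powr \<tau>) * g t e) \<partial>lborel)"
    by (intro nn_integral_mono pw)
  also have "\<dots> = (\<Sum>e\<in>edges. ennreal (C1 \<tau> * a e powr \<tau>) * (\<integral>\<^sup>+t. g t e \<partial>lborel))"
    using gm by (subst nn_integral_sum) (auto intro!: sum.cong nn_integral_cmult borel_measurable_times_ennreal)
  also have "\<dots> \<le> (\<Sum>e\<in>edges. ennreal (C1 \<tau> * a e powr \<tau>) * ennreal (C2 s \<tau> * (real (card (adj e)) powr (s * \<tau> / 2) * elen e powr (2 - s * \<tau>))))"
    unfolding g_def by (intro sum_mono mult_left_mono edge_weight_integral st) auto
  also have "\<dots> = ennreal (\<Sum>e\<in>edges. (C1 \<tau> * a e powr \<tau>) * (C2 s \<tau> * (real (card (adj e)) powr (s * \<tau> / 2) * elen e powr (2 - s * \<tau>))))"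
  proof -
    have "0 \<le> C2 s \<tau>" using st by (simp add: C2_def)
    then show ?thesis using C1_nonneg
      by (subst sum_ennreal[symmetric]) (auto simp: ennreal_mult' intro!: sum.cong mult_nonneg_nonneg)
  qed
  also have "(\<Sum>e\<in>edges. (C1 \<tau> * a e powr \<tau>) * (C2 s \<tau> * (real (card (adj e)) powr (s * \<tau> / 2) * elen e powr (2 - s * \<tau>))))
      = C1 \<tau> * C2 s \<tau> * (\<Sum>e\<in>edges. a e powr \<tau> * (real (card (adj e)) powr (s * \<tau> / 2) * elen e powr (2 - s * \<tau>)))"
    unfolding sum_distrib_left by (simp add: mult_ac)
  finally show ?thesis .
qed

lemma besov_bound:
  fixes I :: "edge \<Rightarrow> real"
  assumes p: "0 < p" and \<tau>: "0 < \<tau>" and s: "0 < s" and rel: "1 / \<tau> = s / 2 + 1 / p" and sr: "s / 2 < real r + 1 / p"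
    and \<Omega>: "\<Omega> = (\<Union>j<n. R j)"
    and I: "\<And>e. 0 \<le> I e" and a: "\<And>e. e \<in> edges \<Longrightarrow> a e = (I e / (elen e)^2) powr (1 / p)"
    and J: "0 \<le> J" "(\<Sum>e\<in>edges. I e) \<le> real N * J"
  shows "besov_seminorm s k \<tau> \<Omega> S \<le>
    ennreal ((C1 \<tau> * C2 s \<tau> * ((real N * (M + real N)) powr (s * \<tau> / 2) * real N powr (\<tau> / p))) powr (1 / \<tau>)
       * real n powr (s / 2)) * ennreal (J powr (1 / p))"
proof -
  have one: "s * \<tau> / 2 + \<tau> / p = 1" using rel \<tau> p by (simp add: field_simps)
  have st: "0 < s * \<tau>" using s \<tau> by simp
  have "0 < \<tau> / p" using \<tau> p by simp
  then have st2: "s * \<tau> < 2" using one by linarith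
  \<comment> \<open>Multiplied by \<tau>, the smoothness condition becomes
    \<open>s * \<tau> < 1 + r * \<tau>\<close>, which is convergence of the strip integral at
    \<open>t = 0\<close>.\<close>
  have "s = s / 2 + s / 2" by simp
  also have "\<dots> < s / 2 + (real r + 1 / p)" using sr by linarith
  also have "\<dots> = 1 / \<tau> + real r" using rel by simp
  finally have "s * \<tau> < (1 / \<tau> + real r) * \<tau>" using \<tau> by (intro mult_strict_right_mono)
  then have st3: "0 < 1 + real r * \<tau> - s * \<tau>" using \<tau> by (simp add: distrib_right)
  have C2: "0 \<le> C2 s \<tau>" using st st2 st3 by (simp add: C2_def)
  define m where "m e = real (card (adj e))" for e
  \<comment> \<open>Lengths cancel: \<open>a e powr \<tau>\<close> contains \<open>elen e\<close> to
    the power - 2 \<tau> / p, and \<open>2 * (\<tau> / p) = 2 - s * \<tau>\<close>.\<close>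
  have edge_term: "a e powr \<tau> * (m e powr (s * \<tau> / 2) * elen e powr (2 - s * \<tau>)) = m e powr (s * \<tau> / 2) * I e powr (\<tau> / p)"
    if e: "e \<in> edges" for e
  proof -
    have l: "0 < elen e" by (rule elen_pos[OF e])
    have "a e powr \<tau> = (I e / elen e ^ 2) powr (\<tau> / p)" by (simp add: a[OF e] powr_powr)
    also have "\<dots> = I e powr (\<tau> / p) / (elen e ^ 2) powr (\<tau> / p)" using I l by (simp add: powr_divide)
    also have "(elen e ^ 2) powr (\<tau> / p) = elen e powr (2 * (\<tau> / p))"
    proof -
      have "elen e ^ 2 = elen e powr 2" using l by (simp add: powr_numeral)
      then show ?thesis by (simp only: powr_powr)
    qed
    also have "2 * (\<tau> / p) = 2 - s * \<tau>" using one by simp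
    finally show ?thesis using l by simp
  qed
  have "(\<Sum>e\<in>edges. a e powr \<tau> * (m e powr (s * \<tau> / 2) * elen e powr (2 - s * \<tau>))) = (\<Sum>e\<in>edges. m e powr (s * \<tau> / 2) * I e powr (\<tau> / p))"
    by (intro sum.cong edge_term) auto
  also have "\<dots> \<le> (\<Sum>e\<in>edges. m e) powr (s * \<tau> / 2) * (\<Sum>e\<in>edges. I e) powr (\<tau> / p)"
    using I one st p \<tau> by (intro sum_powr_mult_le finite_edges) (auto simp: m_def)
  also have "\<dots> \<le> (real n * (real N * (M + real N))) powr (s * \<tau> / 2) * (real N * J) powr (\<tau> / p)"
    unfolding m_def using sum_card_adj J st p \<tau> I
    by (intro mult_mono powr_mono2) (auto intro!: sum_nonneg)
  also have "\<dots> = ((real N * (M + real N)) powr (s * \<tau> / 2) * real N powr (\<tau> / p)) * (real n powr (s * \<tau> / 2) * J powr (\<tau> / p))"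
    using M_nonneg J by (simp add: powr_mult mult_ac)
  finally have sum_le: "(\<Sum>e\<in>edges. a e powr \<tau> * (m e powr (s * \<tau> / 2) * elen e powr (2 - s * \<tau>)))
     \<le> ((real N * (M + real N)) powr (s * \<tau> / 2) * real N powr (\<tau> / p)) * (real n powr (s * \<tau> / 2) * J powr (\<tau> / p))" .
  define G where "G = C1 \<tau> * C2 s \<tau> * ((real N * (M + real N)) powr (s * \<tau> / 2) * real N powr (\<tau> / p))"
  have G0: "0 \<le> G" unfolding G_def using C1_nonneg C2 by (intro mult_nonneg_nonneg) auto
  have "(\<integral>\<^sup>+ t\<in>{0<..}. en_pow (ennreal (t powr (- s)) * modulus k \<Omega> S t \<tau>) \<tau> * ennreal (1 / t) \<partial>lborel)
     \<le> ennreal (C1 \<tau> * C2 s \<tau> * (\<Sum>e\<in>edges. a e powr \<tau> * (m e powr (s * \<tau> / 2) * elen e powr (2 - s * \<tau>))))"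
    unfolding m_def by (rule besov_integral_bound[OF \<tau> st st2 st3 \<Omega>])
  also have "\<dots> \<le> ennreal (G * (real n powr (s * \<tau> / 2) * J powr (\<tau> / p)))"
    using mult_left_mono[OF sum_le, of "C1 \<tau> * C2 s \<tau>"] C1_nonneg C2
    by (intro ennreal_leI) (simp add: G_def mult.assoc)
  finally have "besov_seminorm s k \<tau> \<Omega> S \<le> ennreal ((G * (real n powr (s * \<tau> / 2) * J powr (\<tau> / p))) powr (1 / \<tau>))"
    unfolding besov_seminorm_def using G0 \<tau> by (intro en_pow_mono_ennreal) auto
  also have "(G * (real n powr (s * \<tau> / 2) * J powr (\<tau> / p))) powr (1 / \<tau>) = G powr (1 / \<tau>) * real n powr (s / 2) * J powr (1 / p)"
    using G0 \<tau> by (simp add: powr_mult powr_powr mult.assoc)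
  also have "ennreal \<dots> = ennreal (G powr (1 / \<tau>) * real n powr (s / 2)) * ennreal (J powr (1 / p))"
    by (simp add: ennreal_mult)
  finally show ?thesis unfolding G_def .
qed

end

lemma nn_integral_powr_compact_finite:
  fixes f :: "pt \<Rightarrow> real"
  assumes "compact Q" "continuous_on Q f" "0 < p"
  shows "(\<integral>\<^sup>+x\<in>Q. ennreal (\<bar>f x\<bar> powr p) \<partial>lborel) < top"
proof -
  have "bounded (f ` Q)" using assms compact_continuous_image compact_imp_bounded by blast
  then obtain b where b: "\<And>x. x \<in> Q \<Longrightarrow> \<bar>f x\<bar> \<le> b" unfolding bounded_iff by auto
  have "(\<integral>\<^sup>+x\<in>Q. ennreal (\<bar>f x\<bar> powr p) \<partial>lborel) \<le> (\<integral>\<^sup>+x. ennreal (\<bar>b\<bar> powr p) * indicator Q x \<partial>lborel)"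
    using b assms(3) by (intro nn_integral_mono) (force simp: indicator_def intro!: ennreal_leI powr_mono2)
  also have "\<dots> = ennreal (\<bar>b\<bar> powr p) * emeasure lborel Q"
    using borel_closed[OF compact_imp_closed[OF assms(1)]] by (intro nn_integral_cmult_indicator) auto
  also have "\<dots> < top"
    using emeasure_bounded_finite[OF compact_imp_bounded[OF assms(1)]] by (simp add: ennreal_mult_less_top)
  finally show ?thesis .
qed

lemma Cr_continuous_on: "Cr m \<Omega> f \<Longrightarrow> continuous_on \<Omega> f"
  by (cases m) auto

section \<open>Control of pieces by integrals of the spline\<close>

context
  fixes k :: nat and p c K C :: real
  assumes kp: "k \<ge> 1" "p > 0" and c: "0 < c" and K: "0 \<le> K" and C: "0 < C"
    and bound: "\<And>P (y::pt) z0 \<rho>. poly2 k P \<Longrightarrow> \<rho> > 0 \<Longrightarrow> dist y z0 \<le> (K + 1) / c * \<rho> \<Longrightarrow>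
     ennreal (\<bar>P y\<bar> powr p * \<rho>^2) \<le> ennreal C * (\<integral>\<^sup>+z\<in>ball z0 \<rho>. ennreal (\<bar>P z\<bar> powr p) \<partial>lborel)"
begin

text \<open>The point \<open>y\<close> is within \<open>(K + 1) * dist u v\<close> of
  \<open>z0\<close>, which is \<open>(K + 1) / c\<close> times the radius of the ball. This ratio is
  the same for all edges, so one constant \<open>C\<close> serves every scale.\<close>

lemma fat_edge_control:
  assumes P: "poly2 k P" and fat: "fat_at c R u v z0" and z: "z \<in> closed_segment u v" "dist y z \<le> K * dist u v"
  shows "\<bar>P y\<bar> \<le> (C / c^2) powr (1 / p) *
    (enn2real (\<integral>\<^sup>+w\<in>ball z0 (c * dist u v). ennreal (\<bar>P w\<bar> powr p) \<partial>lborel) / (dist u v)^2) powr (1 / p)"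
proof -
  define l where "l = dist u v"
  have l: "0 < l" using fat by (simp add: l_def fat_at_def)
  define I where "I = (\<integral>\<^sup>+w\<in>ball z0 (c * l). ennreal (\<bar>P w\<bar> powr p) \<partial>lborel)"
  have "I \<le> (\<integral>\<^sup>+w\<in>cball z0 (c * l). ennreal (\<bar>P w\<bar> powr p) \<partial>lborel)"
    unfolding I_def by (intro nn_integral_mono) (auto simp: indicator_def)
  also have "\<dots> < top" by (intro nn_integral_powr_compact_finite poly2_continuous[OF P] kp) auto
  finally have Ifin: "I = ennreal (enn2real I)" by simp
  have "dist z z0 \<le> l" using fat z(1) by (simp add: fat_at_def l_def)
  then have "dist y z0 \<le> (K + 1) * l" using z(2) dist_triangle[of y z0 z] by (simp add: l_def algebra_simps)
  then have "dist y z0 \<le> (K + 1) / c * (c * l)" using c by simp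
  from bound[OF P _ this] have "ennreal (\<bar>P y\<bar> powr p * (c * l)^2) \<le> ennreal C * ennreal (enn2real I)"
    using c l unfolding I_def[symmetric] Ifin[symmetric] by simp
  then have "\<bar>P y\<bar> powr p * (c * l)^2 \<le> C * enn2real I"
    using C by (simp add: ennreal_mult'[symmetric] ennreal_le_iff)
  then have "\<bar>P y\<bar> powr p \<le> (C / c^2) * (enn2real I / l^2)"
    using c l by (simp add: field_simps power_mult_distrib)
  then have "(\<bar>P y\<bar> powr p) powr (1 / p) \<le> ((C / c^2) * (enn2real I / l^2)) powr (1 / p)"
    using kp by (intro powr_mono2) auto
  also have "((C / c^2) * (enn2real I / l^2)) powr (1 / p) = (C / c^2) powr (1 / p) * (enn2real I / l^2) powr (1 / p)"
    by (rule powr_mult)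
  also have "(\<bar>P y\<bar> powr p) powr (1 / p) = \<bar>P y\<bar>" using kp by (simp add: powr_powr)
  finally show ?thesis unfolding I_def l_def .
qed

end

context framed_spline
begin

text \<open>Each ball lies in its ring, where \<open>S\<close> is the polynomial, and no point lies
  in more than \<open>N\<close> of the balls. Finiteness of the total integral allows
  \<open>enn2real\<close> to be exchanged with the sum.\<close>

lemma sum_edge_integrals_le:
  assumes ctr: "\<And>e. e \<in> edges \<Longrightarrow> ball (ctr e) (c * elen e) \<subseteq> R (fst e)" and p: "0 < p"
    and S: "continuous_on (\<Union>j<n. R j) S"
  shows "(\<Sum>e\<in>edges. enn2real (\<integral>\<^sup>+w\<in>ball (ctr e) (c * elen e). ennreal (\<bar>P (fst e) w\<bar> powr p) \<partial>lborel))
    \<le> real N * enn2real (\<integral>\<^sup>+w\<in>(\<Union>j<n. R j). ennreal (\<bar>S w\<bar> powr p) \<partial>lborel)"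
proof -
  define \<Omega> where "\<Omega> = (\<Union>j<n. R j)"
  have cO: "compact \<Omega>" unfolding \<Omega>_def using compact_R by (intro compact_UN) auto
  define U where "U e = ball (ctr e) (c * elen e)" for e
  define J where "J = (\<integral>\<^sup>+w\<in>\<Omega>. ennreal (\<bar>S w\<bar> powr p) \<partial>lborel)"
  have Jfin: "J < top" unfolding J_def by (rule nn_integral_powr_compact_finite[OF cO _ p]) (use S in \<open>simp add: \<Omega>_def\<close>)
  have "(\<lambda>x. indicator \<Omega> x *\<^sub>R S x) \<in> borel_measurable borel"
    using S borel_closed[OF compact_imp_closed[OF cO]] unfolding \<Omega>_def[symmetric]
    by (intro borel_measurable_continuous_on_indicator) auto
  then have m: "(\<lambda>x. ennreal (\<bar>indicator \<Omega> x *\<^sub>R S x\<bar> powr p)) \<in> borel_measurable lborel"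
    by measurable
  have eq: "(\<lambda>x. ennreal (\<bar>indicator \<Omega> x *\<^sub>R S x\<bar> powr p)) = (\<lambda>w. ennreal (\<bar>S w\<bar> powr p) * indicator \<Omega> w)"
    using p by (auto simp: indicator_def)
  note Smeas = m[unfolded eq]
  have Pmeas: "(\<lambda>w. ennreal (\<bar>P (fst e) w\<bar> powr p) * indicator (U e) w) \<in> borel_measurable lborel" if "e \<in> edges" for e
  proof -
    have [measurable]: "P (fst e) \<in> borel_measurable borel" "U e \<in> sets borel"
      using poly2_measurable polyP edges_less[OF that] by (auto simp: U_def)
    show ?thesis by simp
  qed
  have "(\<Sum>e\<in>edges. \<integral>\<^sup>+w\<in>U e. ennreal (\<bar>P (fst e) w\<bar> powr p) \<partial>lborel)
      = (\<integral>\<^sup>+w. (\<Sum>e\<in>edges. ennreal (\<bar>P (fst e) w\<bar> powr p) * indicator (U e) w) \<partial>lborel)"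
    using Pmeas by (subst nn_integral_sum) auto
  also have "\<dots> \<le> (\<integral>\<^sup>+w. ennreal (real N) * (ennreal (\<bar>S w\<bar> powr p) * indicator \<Omega> w) \<partial>lborel)"
  proof (intro nn_integral_mono)
    fix w
    have "(\<Sum>e\<in>edges. ennreal (\<bar>P (fst e) w\<bar> powr p) * indicator (U e) w) = (\<Sum>e\<in>edges. ennreal (\<bar>S w\<bar> powr p) * indicator (U e) w)"
    proof (intro sum.cong refl)
      fix e assume e: "e \<in> edges"
      then have "w \<in> U e \<Longrightarrow> S w = P (fst e) w" using ctr[OF e] SP[OF edges_less[OF e]] by (auto simp: U_def)
      then show "ennreal (\<bar>P (fst e) w\<bar> powr p) * indicator (U e) w = ennreal (\<bar>S w\<bar> powr p) * indicator (U e) w"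
        by (auto simp: indicator_def)
    qed
    also have "\<dots> = ennreal (\<bar>S w\<bar> powr p) * (\<Sum>e\<in>edges. indicator (U e) w)" by (rule sum_distrib_left[symmetric])
    also have "\<dots> \<le> ennreal (\<bar>S w\<bar> powr p) * (ennreal (real N) * indicator (\<Union>e\<in>edges. U e) w)"
      using ctr by (intro mult_left_mono sum_indicator_overlap_le) (auto simp: U_def)
    also have "\<dots> \<le> ennreal (\<bar>S w\<bar> powr p) * (ennreal (real N) * indicator \<Omega> w)"
    proof -
      have "(\<Union>e\<in>edges. U e) \<subseteq> \<Omega>" using ctr edges_less unfolding U_def \<Omega>_def by fast
      then show ?thesis by (intro mult_left_mono) (auto simp: indicator_def)
    qed
    finally show "(\<Sum>e\<in>edges. ennreal (\<bar>P (fst e) w\<bar> powr p) * indicator (U e) w) \<le> ennreal (real N) * (ennreal (\<bar>S w\<bar> powr p) * indicator \<Omega> w)"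
      by (simp add: mult_ac)
  qed
  also have "\<dots> = ennreal (real N) * J" unfolding J_def using Smeas by (rule nn_integral_cmult)
  finally have le: "(\<Sum>e\<in>edges. \<integral>\<^sup>+w\<in>U e. ennreal (\<bar>P (fst e) w\<bar> powr p) \<partial>lborel) \<le> ennreal (real N) * J" .
  have NJ: "ennreal (real N) * J < top" using Jfin by (simp add: ennreal_mult_less_top)
  have fin: "(\<integral>\<^sup>+w\<in>U e. ennreal (\<bar>P (fst e) w\<bar> powr p) \<partial>lborel) < top" if "e \<in> edges" for e
    using le NJ member_le_sum[OF that _ finite_edges, of "\<lambda>e. \<integral>\<^sup>+w\<in>U e. ennreal (\<bar>P (fst e) w\<bar> powr p) \<partial>lborel"]
    by (metis (no_types, lifting) le_less_trans zero_le)
  have "(\<Sum>e\<in>edges. enn2real (\<integral>\<^sup>+w\<in>U e. ennreal (\<bar>P (fst e) w\<bar> powr p) \<partial>lborel))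
      = enn2real (\<Sum>e\<in>edges. \<integral>\<^sup>+w\<in>U e. ennreal (\<bar>P (fst e) w\<bar> powr p) \<partial>lborel)"
    using fin by (subst enn2real_sum) (auto simp: o_def)
  also have "\<dots> \<le> enn2real (ennreal (real N) * J)" using le NJ by (intro enn2real_mono)
  also have "\<dots> = real N * enn2real J" by (simp add: enn2real_mult)
  finally show ?thesis unfolding U_def J_def \<Omega>_def .
qed

end


theorem theorem4p5:
  fixes N0 :: nat and c0 \<beta> s p \<tau> :: real and k r :: nat
  assumes "c0 \<ge> 1" and "0 < \<beta>" and "\<beta> \<le> pi / 3"
    and "0 < p" and "k \<ge> 2" and "r \<le> k - 2"
    and "0 < s / 2" and "s / 2 < real r + 1 / p" and "1 / \<tau> = s / 2 + 1 / p"
  shows "\<exists>c>0. \<forall>\<Omega> n0 n S. admissible_domain N0 c0 \<beta> \<Omega> n0 \<longrightarrow> n \<ge> n0 \<longrightarrow>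
            spline_class N0 c0 \<beta> \<Omega> n k r S \<longrightarrow>
            besov_seminorm s k \<tau> \<Omega> S \<le> ennreal (c * real n powr (s / 2)) * Lnorm p \<Omega> S"
proof -
  define c where "c = sin \<beta> / 16"
  have sin: "0 < sin \<beta>" using assms pi_gt_zero by (intro sin_gt_zero) auto
  have c: "0 < c" "c \<le> 1" unfolding c_def using sin sin_le_one[of \<beta>] by linarith+
  define N where "N = 6 * N0"
  have k1: "1 \<le> k" using assms by simp
  obtain K' where K': "K' > 0" and near: "\<And>R H X (y::pt). compact R \<Longrightarrow> finite H \<Longrightarrow> card H \<le> N \<Longrightarrow> finite X \<Longrightarrow> card X \<le> N \<Longrightarrow>
     frontier R \<subseteq> (\<Union>(u, v)\<in>H. closed_segment u v) \<union> X \<Longrightarrow> y \<in> R \<Longrightarrow> y \<notin> X \<Longrightarrow>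
     (\<exists>(u, v)\<in>H. \<exists>z\<in>closed_segment u v. dist y z \<le> K' * dist u v)"
    using nearby_long_edge[of N] by blast
  \<comment> \<open>The value \<open>real k\<close> reaches all nodes of a difference from a long
    edge met by its segment, and \<open>K'\<close> reaches from a point of a ring to the edge found
    by rays.\<close>
  define K where "K = max (real k) K'"
  have K: "real k \<le> K" "K' \<le> K" "0 \<le> K" by (auto simp: K_def)
  obtain C where C: "0 < C" and Cb: "\<And>P (y::pt) z0 \<rho>. poly2 k P \<Longrightarrow> \<rho> > 0 \<Longrightarrow> dist y z0 \<le> (K + 1) / c * \<rho> \<Longrightarrow>
     ennreal (\<bar>P y\<bar> powr p * \<rho>^2) \<le> ennreal C * (\<integral>\<^sup>+z\<in>ball z0 \<rho>. ennreal (\<bar>P z\<bar> powr p) \<partial>lborel)"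
    using poly2_pointwise_le_ball_norm[of k p "(K + 1) / c"] k1 assms(4) K(3) c(1) by auto
  define A where "A = (C / c^2) powr (1 / p)"
  have "infinite {0..1::real}" by (simp add: infinite_Icc)
  then obtain W where W: "finite W" "card W = k" "W \<subseteq> {0..1::real}"
    using infinite_arbitrarily_large by blast
  obtain B where B: "0 \<le> B" and Bb: "\<And>(q::real poly) M i. q = 0 \<or> degree q < card W \<Longrightarrow> M \<ge> 0 \<Longrightarrow>
      (\<forall>x\<in>W. \<bar>poly q x\<bar> \<le> M) \<Longrightarrow> \<bar>coeff q i\<bar> \<le> B * M"
    using poly_coeff_bound_nodes[OF W(1)] by blast
  have "0 < s / 2 + 1 / p" using assms by (simp add: add_pos_pos)
  then have \<tau>: "0 < \<tau>" using assms(9) by (metis zero_less_divide_1_iff)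
  \<comment> \<open>The locale constants are taken as functions of its numerical parameters before
    any spline is chosen, so that \<open>G\<close> is independent of the domain, of \<open>n\<close>
    and of \<open>S\<close>.\<close>
  define M0 where "M0 = framed_spline.M k N c"
  define G where "G = (framed_spline.C1 k N A B c K \<tau> * framed_spline.C2 r s \<tau> *
     ((real N * (M0 + real N)) powr (s * \<tau> / 2) * real N powr (\<tau> / p))) powr (1 / \<tau>)"
  have G0: "0 \<le> G" by (simp add: G_def)
  show ?thesis
  proof (intro exI[of _ "G + 1"] conjI allI impI)
    show "0 < G + 1" using G0 by simp
    fix \<Omega> n0 n S
    assume "spline_class N0 c0 \<beta> \<Omega> n k r S"
    then obtain R P where RP: "\<And>j. j < n \<Longrightarrow> is_ring N0 c0 \<beta> (R j) \<and> poly2 k (P j)"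
      and disj: "\<And>i j. i < n \<Longrightarrow> j < n \<Longrightarrow> i \<noteq> j \<Longrightarrow> interior (R i) \<inter> interior (R j) = {}"
      and \<Omega>: "\<Omega> = (\<Union>j<n. R j)" and SP: "\<And>j x. j < n \<Longrightarrow> x \<in> R j \<Longrightarrow> S x = P j x" and Cr: "Cr r \<Omega> S"
      unfolding spline_class_def by blast
    note ring = ring_half_edges[OF conjunct1[OF RP] assms(2,3), folded c_def N_def]
    define good where "good j H X \<longleftrightarrow> finite H \<and> card H \<le> N \<and> finite X \<and> card X \<le> N \<and>
       frontier (R j) \<subseteq> (\<Union>(u, v)\<in>H. closed_segment u v) \<union> X \<and>
       (\<forall>(u, v)\<in>H. \<exists>z0. fat_at c (R j) u v z0)" for j and H :: "(pt \<times> pt) set" and X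
    have "\<exists>H X. good j H X" if "j < n" for j unfolding good_def by (rule ring(3)[OF that])
    then obtain H X where "\<And>j. j < n \<Longrightarrow> good j (H j) (X j)" by metis
    note HX = this[unfolded good_def]
    \<comment> \<open>One centre per edge is fixed, so that the pointwise control and the sum of the
      \<open>I e\<close> refer to the same ball.\<close>
    define ctr where "ctr e = (SOME z0. fat_at c (R (fst e)) (fst (snd e)) (snd (snd e)) z0)" for e :: edge
    have ctr: "fat_at c (R j) u v (ctr (j, u, v))" if "j < n" "(u, v) \<in> H j" for j u v
    proof -
      have "\<exists>z0. fat_at c (R j) u v z0" using HX[OF that(1)] that(2) by blast
      then show ?thesis unfolding ctr_def by (simp add: someI_ex)
    qed
    define I where "I e = enn2real (\<integral>\<^sup>+w\<in>ball (ctr e) (c * elen e). ennreal (\<bar>P (fst e) w\<bar> powr p) \<partial>lborel)" for e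
    define a where "a e = (I e / (elen e)^2) powr (1 / p)" for e
    interpret framed_spline n k r N R X H P S a A B c K
    proof
      show "1 \<le> k" "real k \<le> K" "0 \<le> A" "0 \<le> B" "0 < c" "c \<le> 1" using k1 K B c by (auto simp: A_def)
      show "finite (H j) \<and> card (H j) \<le> N" if "j < n" for j using HX[OF that] by blast
      show "finite (X j)" if "j < n" for j using HX[OF that] by blast
      show "compact (R j)" "R j \<subseteq> closure (interior (R j))" if "j < n" for j using ring(1,2)[OF that] .
      show "frontier (R j) \<subseteq> (\<Union>(u, v)\<in>H j. closed_segment u v) \<union> X j" if "j < n" for j using HX[OF that] by blast
      show "\<exists>z0. fat_at c (R j) u v z0" if "j < n" "(u, v) \<in> H j" for j u v using ctr[OF that] by blast
      show "\<exists>(u, v)\<in>H j. \<exists>z\<in>closed_segment u v. dist y z \<le> K * dist u v" if j: "j < n" and y: "y \<in> R j" "y \<notin> X j" for j y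
      proof -
        obtain u v z where uv: "(u, v) \<in> H j" "z \<in> closed_segment u v" "dist y z \<le> K' * dist u v"
          using near[OF ring(1)[OF j], of "H j" "X j" y] HX[OF j] y by blast
        moreover have "K' * dist u v \<le> K * dist u v" using K by (intro mult_right_mono) auto
        ultimately show ?thesis by force
      qed
      show "interior (R i) \<inter> interior (R j) = {}" if "i < n" "j < n" "i \<noteq> j" for i j by (rule disj[OF that])
      show "poly2 k (P j)" if "j < n" for j using RP[OF that] by blast
      show "S x = P j x" if "j < n" "x \<in> R j" for j x by (rule SP[OF that])
      show "coeff u l = coeff v l" if ij: "i < n" "j < n" and z: "z \<in> R i" "z \<in> R j"
        and uv: "\<And>v. P i (z + v *\<^sub>R h) = poly u v" "\<And>w. P j (z + w *\<^sub>R h) = poly v w" and l: "l < r"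
        for i j z h u v l
      proof (rule Cr_matching_coeffs[OF Cr])
        show "real_polynomial_function (P i)" "real_polynomial_function (P j)"
          using RP ij poly2_real_polynomial_function by blast+
        show "R i \<subseteq> closure (interior (R i))" "R j \<subseteq> closure (interior (R j))" using ring(2) ij by blast+
        show "R i \<subseteq> \<Omega>" "R j \<subseteq> \<Omega>" using \<Omega> ij by auto
      qed (use SP ij z uv l in auto)
      show "0 \<le> a e" for e by (simp add: a_def)
      show "\<bar>P j y\<bar> \<le> A * a (j, u, v)"
        if j: "j < n" "(u, v) \<in> H j" and z: "z \<in> closed_segment u v" "dist y z \<le> K * dist u v" for j u v y z
        using fat_edge_control[OF k1 assms(4) c(1) K(3) C Cb conjunct2[OF RP[OF j(1)]] ctr[OF j] z]
        by (simp add: A_def a_def I_def elen_def)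
      show "\<bar>coeff q i\<bar> \<le> B * M" if "degree q < k" "0 \<le> M" "\<And>v. v \<in> {0..1} \<Longrightarrow> \<bar>poly q v\<bar> \<le> M" for q M i
        using that W by (intro Bb) auto
    qed
    define J where "J = enn2real (\<integral>\<^sup>+w\<in>\<Omega>. ennreal (\<bar>S w\<bar> powr p) \<partial>lborel)"
    have cS: "continuous_on \<Omega> S" by (rule Cr_continuous_on[OF Cr])
    \<comment> \<open>A finite union of compact rings is compact, so the \<open>L^p\<close> norm of
      the continuous \<open>S\<close> is finite and passing to \<open>enn2real\<close> loses
      nothing.\<close>
    have "compact \<Omega>" unfolding \<Omega> using compact_R by (intro compact_UN) auto
    then have "(\<integral>\<^sup>+w\<in>\<Omega>. ennreal (\<bar>S w\<bar> powr p) \<partial>lborel) < top"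
      using cS assms(4) by (rule nn_integral_powr_compact_finite)
    then have Lp: "Lnorm p \<Omega> S = ennreal (J powr (1 / p))"
      unfolding Lnorm_def en_pow_def J_def by simp
    have "(\<Sum>e\<in>edges. I e) \<le> real N * J"
      unfolding I_def J_def \<Omega>
    proof (rule sum_edge_integrals_le[OF _ assms(4)])
      show "continuous_on (\<Union>j<n. R j) S" using cS \<Omega> by simp
      show "ball (ctr e) (c * elen e) \<subseteq> R (fst e)" if "e \<in> edges" for e
      proof -
        obtain j u v where e: "e = (j, u, v)" by (metis surj_pair)
        have "fat_at c (R j) u v (ctr e)" using ctr[of j u v] that unfolding e edges_def by auto
        then have "ball (u + 1 *\<^sub>R (ctr e - u)) (1 * (c * dist u v)) \<subseteq> R j"
          unfolding fat_at_def by (metis atLeastAtMost_iff ends_in_segment(1) order_refl zero_le_one)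
        then show ?thesis by (simp add: e elen_def)
      qed
    qed
    then have "besov_seminorm s k \<tau> \<Omega> S \<le> ennreal (G * real n powr (s / 2)) * ennreal (J powr (1 / p))"
      unfolding G_def M0_def using assms \<tau> \<Omega>
      by (intro besov_bound[where I=I]) (auto simp: a_def I_def J_def)
    also have "\<dots> \<le> ennreal ((G + 1) * real n powr (s / 2)) * Lnorm p \<Omega> S"
      unfolding Lp by (intro mult_right_mono ennreal_leI) auto
    finally show "besov_seminorm s k \<tau> \<Omega> S \<le> ennreal ((G + 1) * real n powr (s / 2)) * Lnorm p \<Omega> S" .
  qed
qed

end
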